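(* Write $\chi^m_n=m+\sqrt n$. Consider the two pairs of $5\times5$ matrices (rows and columns indexed by $1,\dots,5$, index $1$ being the vacuum): (A) $$\hat S=\frac{1}{\sqrt{30\chi^4_{15}}}\begin{pmatrix}1&\chi^4_{15}&\chi^5_{15}&\chi^3_{15}&\chi^3_{15}\\ \chi^4_{15}&1&\chi^5_{15}&-\chi^3_{15}&-\chi^3_{15}\\ \chi^5_{15}&\chi^5_{15}&-\chi^5_{15}&0&0\\ \chi^3_{15}&-\chi^3_{15}&0&\frac12\chi^1_5\chi^3_{15}&-\frac{2\sqrt{30\chi^4_{15}}}{\chi^5_5}\\ \chi^3_{15}&-\chi^3_{15}&0&-\frac{2\sqrt{30\chi^4_{15}}}{\chi^5_5}&\frac12\chi^1_5\chi^3_{15}\end{pmatrix},$$ $$\hat T^2=\mathrm{diag}(1,1,e^{2\pi i/3},e^{4\pi i/5},e^{-4\pi i/5});$$ (B) $$\hat S=\frac{1}{2\sqrt{6\chi^5_{24}}}\begin{pmatrix}1&\chi^5_{24}&\chi^3_6&\chi^3_6&\chi^4_{24}\\ \chi^5_{24}&1&\chi^3_6&\chi^3_6&-\chi^4_{24}\\ \chi^3_6&\chi^3_6&-\chi^3_6-i\sqrt{6\chi^5_{24}}&-\chi^3_6+i\sqrt{6\chi^5_{24}}&0\\ \chi^3_6&\chi^3_6&-\chi^3_6+i\sqrt{6\chi^5_{24}}&-\chi^3_6-i\sqrt{6\chi^5_{24}}&0\\ \chi^4_{24}&-\chi^4_{24}&0&0&\chi^4_{24}\end{pmatrix},$$ $$\hat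 T^2=\mathrm{diag}(1,1,-1,-1,e^{2\pi i/3}).$$ In each case let $d_i=\hat S_{1i}/\hat S_{11}$, $D^2=2\sum_{i=1}^5 d_i^2$, $\theta_i^2=(\hat T^2)_{ii}$, and $$\hat N_{ij}^{\ \ k}=\sum_{m=1}^5\frac{\hat S_{im}\hat S_{jm}\overline{\hat S_{km}}}{\hat S_{1m}}.$$ Then each pair is valid unitary fermionic modular data of rank 10; that is, items 1–4 hold, and moreover items 5–8 hold: 1. $\hat S$ and $\hat T^2$ are unitary and $s\mapsto\hat S$, $t^2\mapsto\hat T^2$ defines a projective congruence representation of $\Gamma_\theta$. 2. (Verlinde) All $\hat N_{ij}^{\ \ k}$ are non-negative integers; the largest of them is $3$ in case (A) and $4$ in case (B). 3. (Frobenius–Schur) For every $a$ with $\hat N_{aa}^{\ \ 1}=1$, $$\frac{2}{D^2}\sum_{j,k=1}^5\hat N_{jk}^{\ \ a}\,d_jd_k\,\frac{\theta_j^2}{\theta_k^2}\in\{1,-1\}.$$ 4. (Signed-permutation condition) For the lift to a linear congruence representation $\rho$ of $\Gamma_\theta$ given by $\rho(s)=\hat S$, $\rho(t^2)=e^{-2\pi i c/12}\hat T^2$ with $c=0$, let $n$ be its (even) level. For every degenerate eigenvalue $\theta$ of $\rho(t^2)$ and every $a\in(\mathbb Z/n)^\times$ with $\theta^{a^2}=\theta$, the matrix $$H(a)=\rho(s)^2\,\rho(t^2)^{-(a-1)/2}\,\rho(s)\,\bigl(\rho(t^2)\rho(s)\bigr)^{\bar a-1}\,\rho(t^2)^{-(a-1)/2}\,\rho(s),\qquad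 a\bar a\equiv1 \bmod n,$$ is a signed permutation matrix ($a,\bar a$ being represented by positive odd integers). 5. $D^2\approx472.379$ in case (A) and $D^2\approx475.151$ in case (B). 6. The central charge is $c=0$ (it is defined modulo $\frac12$) in both cases. 7. Both sets of modular data are non-abelian and primitive, i.e. not obtained by stacking two other theories. 8. There exist full rank-10 fusion rules $N_{ij}^{\ \ k}\in\mathbb Z_{\ge0}$, on the ten labels $i,i^f$ ($i=1,\dots,5$), such that $\hat N_{ij}^{\ \ k}=N_{ij}^{\ \ k}+N_{ij}^{\ \ k^f}$ for $i,j,k\in\{1,\dots,5\}$ and such that the balancing equation $$S_{ij}=\frac1D\,\theta_i^{-1}\theta_j^{-1}\sum_k N_{i^*j}^{\ \ \ k}\,\theta_k d_k$$ holds, where $S=\frac1{\sqrt2}\begin{pmatrix}1&1\\1&1\end{pmatrix}\otimes\hat S$, $d_{i^f}=d_i$, $\theta_{i^f}=-\theta_i$, with $\theta_i$ a square root of $(\hat T^2)_{ii}$, and $i^*$ is the dual of $i$. Furthermore, each of these two fusion rules $\hat N$ is also realized by non-unitary valid modular data, with $D^2\approx7.621$ for the fusion rule of (A) and $D^2\approx4.849$ for that of (B).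
   Context: A super-modular category is a ribbon fusion category whose only nontrivial transparent simple object is a fermion $f$ (with $\theta_f=-1$, $f\times f=1$). Its simple objects come in pairs $i$, $i^f=f\times i$; choosing one of each pair gives the fermionic quotient, with label set of half the rank (here $5$), matrices $\hat S,\hat T^2$ and fusion coefficients $\hat N_{ij}^{\ \ k}$. The full matrices are $S=\frac1{\sqrt2}\begin{pmatrix}1&1\\1&1\end{pmatrix}\otimes\hat S$ and $T=\mathrm{diag}(1,-1)\otimes\hat T$, where $\theta_i=T_{ii}$ are the topological spins (only $\theta_i^2$ is independent of the choice of quotient). "Valid modular data" means data satisfying items 1–4 (the Verlinde condition in item 2 being the non-negative integrality); the existence of a super-modular category realizing them is not claimed. $\Gamma_\theta$ is the subgroup of $\mathrm{SL}_2(\mathbb{Z})$ generated by $s=\begin{pmatrix}0&-1\\1&0\end{pmatrix}$ and $t^2=\begin{pmatrix}1&2\\0&1\end{pmatrix}$. $\Gamma(n)$ denotes the kernel of $\mathrm{SL}_2(\mathbb{Z})\to\mathrm{SL}_2(\mathbb{Z}/n)$. A (projective or linear) representation of $\Gamma_\theta$ is called congruence if its kernel contains $\Gamma(n)$ for some positive integer $n$; the smallest such $n$ is its level. The central charge of a super-modular category is that of any of its minimal modular extensions (modular categories containing it, with twice its value of $D^2$); the 16 extensions have central charges differing by multiples of $\frac12$, so $c$ is defined modulo $\frac12$. It is assumed, as is conjectured, that minimal modular extensions exist; then $s\mapsto\hat S$, $t^2\mapsto e^{-2\pi i c/12}\hat T^2$ is a linear congruence representation of $\Gamma_\theta$, and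 $c$ modulo $\frac12$ is read off from the 24 linear congruence representations $t^2\mapsto e^{-2\pi i(c+m/2)/12}\hat T^2$, $m\in\mathbb Z/24$, which lead to the given data. Stacking means the product of two super-modular categories with their fermions identified, or of a super-modular category with a modular category. *)

theory Defs
  imports
    "HOL-Algebra.Generated_Groups"
    "HOL-Combinatorics.Permutations"
    "Jordan_Normal_Form.Schur_Decomposition"
begin

(* Labels are 0-based: the vacuum, index 1 in the literature, is index 0 here. Throughout, n is
   the number of labels of the fermionic quotient, i.e. half the rank of the super-modular
   category. *)


subsection \<open>The theta subgroup and its congruence representations\<close>

definition SL2Z :: "int mat monoid" where
  "SL2Z = \<lparr>carrier = {A \<in> carrier_mat 2 2. det A = 1},
     Group.monoid.mult = (*), one = 1\<^sub>m 2\<rparr>"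

definition s_gen :: "int mat" where
  "s_gen = mat_of_rows_list 2 [[0, -1], [1, 0]]"

definition t2_gen :: "int mat" where
  "t2_gen = mat_of_rows_list 2 [[1, 2], [0, 1]]"

definition Gamma_theta :: "int mat monoid" where
  "Gamma_theta = subgroup_generated SL2Z {s_gen, t2_gen}"

definition Gamma :: "nat \<Rightarrow> int mat set" where
  "Gamma m = {A \<in> carrier SL2Z. \<forall>i<2. \<forall>j<2. A $$ (i, j) mod int m = 1\<^sub>m 2 $$ (i, j) mod int m}"

definition GL :: "nat \<Rightarrow> complex mat monoid" where
  "GL n = units_of (ring_mat TYPE(complex) n ())"

definition scalars :: "nat \<Rightarrow> complex mat set" where
  "scalars n = {x \<cdot>\<^sub>m 1\<^sub>m n | x. x \<noteq> 0}"

definition PGL :: "nat \<Rightarrow> complex mat set monoid" where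
  "PGL n = GL n Mod scalars n"

definition congruence_hom :: "('a, 'b) monoid_scheme \<Rightarrow> (int mat \<Rightarrow> 'a) \<Rightarrow> bool" where
  "congruence_hom H \<phi> \<longleftrightarrow>
     \<phi> \<in> hom Gamma_theta H \<and> (\<exists>m>0. Gamma m \<subseteq> kernel Gamma_theta H \<phi>)"

definition level :: "('a, 'b) monoid_scheme \<Rightarrow> (int mat \<Rightarrow> 'a) \<Rightarrow> nat" where
  "level H \<phi> = (LEAST m. m > 0 \<and> Gamma m \<subseteq> kernel Gamma_theta H \<phi>)"

definition projective_congruence :: "nat \<Rightarrow> complex mat \<Rightarrow> complex mat \<Rightarrow> bool" where
  "projective_congruence n S T2 \<longleftrightarrow> S \<in> carrier (GL n) \<and> T2 \<in> carrier (GL n) \<and>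
     (\<exists>\<pi>. congruence_hom (PGL n) \<pi> \<and>
        \<pi> s_gen = scalars n #>\<^bsub>GL n\<^esub> S \<and> \<pi> t2_gen = scalars n #>\<^bsub>GL n\<^esub> T2)"

definition linear_lift ::
  "nat \<Rightarrow> complex mat \<Rightarrow> complex mat \<Rightarrow> real \<Rightarrow> (int mat \<Rightarrow> complex mat) \<Rightarrow> bool" where
  "linear_lift n S T2 c \<rho> \<longleftrightarrow> congruence_hom (GL n) \<rho> \<and> \<rho> s_gen = S \<and>
     \<rho> t2_gen = exp (- 2 * of_real pi * \<i> * of_real c / 12) \<cdot>\<^sub>m T2"

(* The central charge of a super-modular category is that of any minimal modular extension, whose
   existence is assumed; the linear lifts of this form that are congruence representations are then
   the 24 ones whose c is such a central charge, and this is how c is read off from the data. *)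
definition central_charge :: "nat \<Rightarrow> complex mat \<Rightarrow> complex mat \<Rightarrow> real \<Rightarrow> bool" where
  "central_charge n S T2 c \<longleftrightarrow> (\<exists>\<rho>. linear_lift n S T2 c \<rho>)"


subsection \<open>Fermionic modular data\<close>

definition qdim :: "complex mat \<Rightarrow> nat \<Rightarrow> complex" where
  "qdim S i = S $$ (0, i) / S $$ (0, 0)"

(* The factor 2 counts i and its partner f x i. *)
definition Dsq :: "nat \<Rightarrow> complex mat \<Rightarrow> complex" where
  "Dsq n S = 2 * (\<Sum>i<n. (qdim S i)\<^sup>2)"

definition verlinde :: "nat \<Rightarrow> complex mat \<Rightarrow> nat \<Rightarrow> nat \<Rightarrow> nat \<Rightarrow> complex" where
  "verlinde n S i j k = (\<Sum>m<n. S $$ (i, m) * S $$ (j, m) * cnj (S $$ (k, m)) / S $$ (0, m))"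

definition is_unitary :: "nat \<Rightarrow> complex mat \<Rightarrow> bool" where
  "is_unitary n A \<longleftrightarrow> A \<in> carrier_mat n n \<and> A * mat_adjoint A = 1\<^sub>m n"

definition positive_real :: "complex \<Rightarrow> bool" where
  "positive_real z \<longleftrightarrow> (\<exists>r>0. z = of_real r)"

definition verlinde_integral :: "nat \<Rightarrow> complex mat \<Rightarrow> bool" where
  "verlinde_integral n S \<longleftrightarrow> (\<forall>i<n. \<forall>j<n. \<forall>k<n. verlinde n S i j k \<in> \<nat>)"

definition frobenius_schur :: "nat \<Rightarrow> complex mat \<Rightarrow> complex mat \<Rightarrow> bool" where
  "frobenius_schur n S T2 \<longleftrightarrow>
     (\<forall>a<n. verlinde n S a a 0 = 1 \<longrightarrow>
        2 / Dsq n S * (\<Sum>j<n. \<Sum>k<n. verlinde n S j k a * qdim S j * qdim S k *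
                          (T2 $$ (j, j) / T2 $$ (k, k))) \<in> {1, -1})"

definition signed_permutation_mat :: "nat \<Rightarrow> complex mat \<Rightarrow> bool" where
  "signed_permutation_mat n A \<longleftrightarrow>
     (\<exists>p \<epsilon>. p permutes {..<n} \<and> (\<forall>i<n. \<epsilon> i \<in> {1, -1}) \<and>
        A = mat n n (\<lambda>(i, j). if j = p i then \<epsilon> i else 0))"

definition H_mat :: "nat \<Rightarrow> complex mat \<Rightarrow> complex mat \<Rightarrow> int \<Rightarrow> int \<Rightarrow> complex mat" where
  "H_mat n S T a a' =
     S [^]\<^bsub>GL n\<^esub> (2::int) \<otimes>\<^bsub>GL n\<^esub> T [^]\<^bsub>GL n\<^esub> (- ((a - 1) div 2)) \<otimes>\<^bsub>GL n\<^esub> S \<otimes>\<^bsub>GL n\<^esub>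
     (T \<otimes>\<^bsub>GL n\<^esub> S) [^]\<^bsub>GL n\<^esub> (a' - 1) \<otimes>\<^bsub>GL n\<^esub> T [^]\<^bsub>GL n\<^esub> (- ((a - 1) div 2)) \<otimes>\<^bsub>GL n\<^esub> S"

definition degenerate_eigenvalue :: "complex mat \<Rightarrow> complex \<Rightarrow> bool" where
  "degenerate_eigenvalue A \<theta> \<longleftrightarrow> eigenvalue A \<theta> \<and> Polynomial.order \<theta> (char_poly A) \<ge> 2"

definition signed_permutation_condition :: "nat \<Rightarrow> complex mat \<Rightarrow> complex mat \<Rightarrow> real \<Rightarrow> bool" where
  "signed_permutation_condition n S T2 c \<longleftrightarrow>
     (\<exists>\<rho>. linear_lift n S T2 c \<rho> \<and> even (level (GL n) \<rho>) \<and>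
        (\<forall>\<theta> (a::nat) (a'::nat).
           degenerate_eigenvalue (\<rho> t2_gen) \<theta> \<and> odd a \<and> odd a' \<and>
           a * a' mod level (GL n) \<rho> = 1 mod level (GL n) \<rho> \<and> \<theta> ^ (a\<^sup>2) = \<theta> \<longrightarrow>
           signed_permutation_mat n (H_mat n (\<rho> s_gen) (\<rho> t2_gen) (int a) (int a'))))"

(* c selects the linear lift used in the signed-permutation condition. Besides the defining
   conditions, the normalisations implicit in the notion of modular data are required: S is
   symmetric with first entry sqrt 2 / D > 0, T2 is the diagonal matrix of squared spins and the
   vacuum has spin 1. *)
definition valid_fermionic_data :: "nat \<Rightarrow> complex mat \<Rightarrow> complex mat \<Rightarrow> real \<Rightarrow> bool" where
  "valid_fermionic_data n S T2 c \<longleftrightarrow>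
     n > 0 \<and> S\<^sup>T = S \<and> positive_real (S $$ (0, 0)) \<and>
     diagonal_mat T2 \<and> T2 $$ (0, 0) = 1 \<and>
     is_unitary n S \<and> is_unitary n T2 \<and> projective_congruence n S T2 \<and>
     verlinde_integral n S \<and>
     frobenius_schur n S T2 \<and>
     signed_permutation_condition n S T2 c"

(* Unitarity of the theory, as opposed to unitarity of the matrices S and T2: all quantum
   dimensions are positive, hence equal to the Frobenius-Perron dimensions. *)
definition unitary_theory :: "nat \<Rightarrow> complex mat \<Rightarrow> bool" where
  "unitary_theory n S \<longleftrightarrow> (\<forall>i<n. positive_real (qdim S i))"


subsection \<open>Stacking\<close>

definition modular_data :: "nat \<Rightarrow> complex mat \<Rightarrow> complex mat \<Rightarrow> bool" where
  "modular_data n S T \<longleftrightarrow>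
     n > 0 \<and> is_unitary n S \<and> S\<^sup>T = S \<and> positive_real (S $$ (0, 0)) \<and>
     T \<in> carrier_mat n n \<and> diagonal_mat T \<and> T $$ (0, 0) = 1 \<and> (\<exists>m>0. T ^\<^sub>m m = 1\<^sub>m n) \<and>
     (\<exists>c::real. (S * T) ^\<^sub>m 3 = exp (2 * of_real pi * \<i> * of_real c / 8) \<cdot>\<^sub>m (S * S)) \<and>
     (\<exists>p. p permutes {..<n} \<and> S * S = mat n n (\<lambda>(i, j). if j = p i then 1 else 0)) \<and>
     verlinde_integral n S"

definition kron :: "complex mat \<Rightarrow> complex mat \<Rightarrow> complex mat" where
  "kron A B = mat (dim_row A * dim_row B) (dim_col A * dim_col B)
     (\<lambda>(i, j). A $$ (i div dim_row B, j div dim_col B) * B $$ (i mod dim_row B, j mod dim_col B))"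

definition equal_up_to_relabelling ::
  "nat \<Rightarrow> complex mat \<Rightarrow> complex mat \<Rightarrow> complex mat \<Rightarrow> complex mat \<Rightarrow> bool" where
  "equal_up_to_relabelling n S T2 S' T2' \<longleftrightarrow>
     S \<in> carrier_mat n n \<and> T2 \<in> carrier_mat n n \<and> S' \<in> carrier_mat n n \<and> T2' \<in> carrier_mat n n \<and>
     (\<exists>p. p permutes {..<n} \<and> p 0 = 0 \<and>
        (\<forall>i<n. \<forall>j<n. S $$ (i, j) = S' $$ (p i, p j) \<and> T2 $$ (i, j) = T2' $$ (p i, p j)))"

(* The unit for stacking is the rank-2 theory with n = 1, so a product of two super-modular
   theories has two other factors only if both have n > 1; with a modular factor (n > 1) the
   super-modular factor may have n = 1, the case of a split theory. On fermionic quotients both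
   kinds of stacking are tensor products. *)
definition stack_of_two :: "nat \<Rightarrow> complex mat \<Rightarrow> complex mat \<Rightarrow> bool" where
  "stack_of_two n S T2 \<longleftrightarrow>
     (\<exists>n1 S1 T1 c1 n2 S2 T2' c2. n1 > 1 \<and> n2 > 1 \<and>
        valid_fermionic_data n1 S1 T1 c1 \<and> valid_fermionic_data n2 S2 T2' c2 \<and>
        equal_up_to_relabelling n S T2 (kron S1 S2) (kron T1 T2')) \<or>
     (\<exists>n1 S1 T1 c1 n2 S2 T. n2 > 1 \<and>
        valid_fermionic_data n1 S1 T1 c1 \<and> modular_data n2 S2 T \<and>
        equal_up_to_relabelling n S T2 (kron S1 S2) (kron T1 (T * T)))"

definition primitive_theory :: "nat \<Rightarrow> complex mat \<Rightarrow> complex mat \<Rightarrow> bool" where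
  "primitive_theory n S T2 \<longleftrightarrow> \<not> stack_of_two n S T2"

definition abelian_theory :: "nat \<Rightarrow> complex mat \<Rightarrow> bool" where
  "abelian_theory n S \<longleftrightarrow> (\<forall>i<n. \<forall>j<n. (\<Sum>k<n. verlinde n S i j k) = 1)"


subsection \<open>Full fusion rules\<close>

definition fusion_rules :: "nat \<Rightarrow> (nat \<Rightarrow> nat \<Rightarrow> nat \<Rightarrow> nat) \<Rightarrow> (nat \<Rightarrow> nat) \<Rightarrow> bool" where
  "fusion_rules r N dual \<longleftrightarrow>
     (\<forall>i<r. dual i < r \<and> dual (dual i) = i) \<and>
     (\<forall>i<r. \<forall>j<r. N 0 i j = (if i = j then 1 else 0)) \<and>
     (\<forall>i<r. \<forall>j<r. N i j 0 = (if j = dual i then 1 else 0)) \<and>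
     (\<forall>i<r. \<forall>j<r. \<forall>k<r. N i j k = N j i k) \<and>
     (\<forall>i<r. \<forall>j<r. \<forall>k<r. N (dual i) (dual j) (dual k) = N i j k) \<and>
     (\<forall>i<r. \<forall>j<r. \<forall>k<r. \<forall>l<r. (\<Sum>m<r. N i j m * N m k l) = (\<Sum>m<r. N j k m * N i m l))"

(* The 2n labels are 0, ..., n-1 followed by their partners f x 0 = f, ..., f x (n-1). *)
definition partner :: "nat \<Rightarrow> nat \<Rightarrow> nat" where
  "partner n i = (if i < n then i + n else i - n)"

definition full_S :: "complex mat \<Rightarrow> complex mat" where
  "full_S S = kron ((1 / of_real (sqrt 2)) \<cdot>\<^sub>m mat_of_rows_list 2 [[1, 1], [1, 1]]) S"

definition full_spin :: "nat \<Rightarrow> (nat \<Rightarrow> complex) \<Rightarrow> nat \<Rightarrow> complex" where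
  "full_spin n \<theta> i = (if i < n then \<theta> i else - \<theta> (i - n))"

definition full_qdim :: "nat \<Rightarrow> complex mat \<Rightarrow> nat \<Rightarrow> complex" where
  "full_qdim n S i = qdim S (i mod n)"

definition balanced_full_fusion ::
  "nat \<Rightarrow> complex mat \<Rightarrow> (nat \<Rightarrow> complex) \<Rightarrow> (nat \<Rightarrow> nat \<Rightarrow> nat \<Rightarrow> nat) \<Rightarrow> (nat \<Rightarrow> nat) \<Rightarrow> bool" where
  "balanced_full_fusion n S \<theta> N dual \<longleftrightarrow>
     fusion_rules (2 * n) N dual \<and>
     (\<forall>i<2*n. \<forall>j<2*n. N n i j = (if j = partner n i then 1 else 0)) \<and>
     (\<forall>i<n. \<forall>j<n. \<forall>k<n. verlinde n S i j k = of_nat (N i j k + N i j (partner n k))) \<and>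
     (\<forall>i<2*n. \<forall>j<2*n. full_S S $$ (i, j) =
        1 / csqrt (Dsq n S) * inverse (full_spin n \<theta> i) * inverse (full_spin n \<theta> j) *
        (\<Sum>k<2*n. of_nat (N (dual i) j k) * full_spin n \<theta> k * full_qdim n S k))"

(* The choice of the roots \<theta> is a choice of fermionic quotient, hence arbitrary except that the
   vacuum, and not the fermion, represents its pair. *)
definition has_full_fusion_rules :: "nat \<Rightarrow> complex mat \<Rightarrow> complex mat \<Rightarrow> bool" where
  "has_full_fusion_rules n S T2 \<longleftrightarrow>
     (\<forall>\<theta>. \<theta> 0 = 1 \<and> (\<forall>i<n. (\<theta> i)\<^sup>2 = T2 $$ (i, i)) \<longrightarrow>
        (\<exists>N dual. balanced_full_fusion n S \<theta> N dual))"


subsection \<open>The two sets of data\<close>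

definition chi :: "nat \<Rightarrow> nat \<Rightarrow> real" where
  "chi m n = real m + sqrt (real n)"

definition S_A :: "complex mat" where
  "S_A = of_real (1 / sqrt (30 * chi 4 15)) \<cdot>\<^sub>m map_mat of_real (mat_of_rows_list 5
     [[1,        chi 4 15,  chi 5 15,  chi 3 15,  chi 3 15],
      [chi 4 15, 1,         chi 5 15,  - chi 3 15, - chi 3 15],
      [chi 5 15, chi 5 15,  - chi 5 15, 0,         0],
      [chi 3 15, - chi 3 15, 0, 1/2 * chi 1 5 * chi 3 15, - (2 * sqrt (30 * chi 4 15) / chi 5 5)],
      [chi 3 15, - chi 3 15, 0, - (2 * sqrt (30 * chi 4 15) / chi 5 5), 1/2 * chi 1 5 * chi 3 15]])"

definition T2_A :: "complex mat" where
  "T2_A = mat_diag 5 (\<lambda>i. [1, 1, exp (2 * of_real pi * \<i> / 3),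
     exp (4 * of_real pi * \<i> / 5), exp (- (4 * of_real pi * \<i> / 5))] ! i)"

definition S_B :: "complex mat" where
  "S_B = (let x = complex_of_real (chi 5 24); y = complex_of_real (chi 3 6);
              z = complex_of_real (chi 4 24); w = \<i> * complex_of_real (sqrt (6 * chi 5 24)) in
     of_real (1 / (2 * sqrt (6 * chi 5 24))) \<cdot>\<^sub>m mat_of_rows_list 5
     [[1, x,   y,       y,       z],
      [x, 1,   y,       y,       - z],
      [y, y,   - y - w, - y + w, 0],
      [y, y,   - y + w, - y - w, 0],
      [z, - z, 0,       0,       z]])"

definition T2_B :: "complex mat" where
  "T2_B = mat_diag 5 (\<lambda>i. [1, 1, -1, -1, exp (2 * of_real pi * \<i> / 3)] ! i)"

end

(* Both pairs are members of families S(p, q), T(w, z) and S(p, r), T(w), defined over a cyclotomic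
   field, where w and z are primitive third and fifth roots of unity and p^2 = 1/3, q^2 = 1/5,
   r^2 = 1/2. For all choices of roots of unity the family gives a sum of tensor products of small
   representations of Gamma_theta of levels 3, 4, 5 and 8, whose vectors are given by explicit
   functions of the bottom row (c, d) of a group element; this yields the level (60 or 24), and
   the matrices H(a), being the images of elements congruent to diag(a, 1/a), act on these
   functions by rescaling (c, d). The fusion coefficients do not depend on the roots of unity,
   and another choice of q or p yields the non-unitary realisations.
   The twists of a congruence representation by characters t^2 -> x are congruence representations
   only for x^24 = 1, which determines the central charge. As 5 is prime, a factorisation could
   only be one into a trivial theory and a modular theory of rank 5; the relation (ST)^3 = l S^2
   for its spins has no solution. *)
theory Submission
  imports Defs "HOL-Number_Theory.Cong"
begin

subsection \<open>The theta subgroup\<close>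

text \<open>Modulo its centre Gamma_theta is a free product of Z/2 and Z, so that S and T2 extend to
  a homomorphism almost for free. The obstacle is the congruence property: membership in Gamma(n) is
  a condition on matrix entries and cannot be read off from words in s and t^2. The representation
  is therefore not built from words. It starts from functions of the entries that visibly depend on
  residues only, and all that is checked is how they change under right multiplication by s and t^2,
  a finite matter. The pieces of levels 3 and 5 are even parts of Weil representations. Their
  S-matrices contain the quadratic Gauss sums 1 + 2w and 1 + 2(z + z^4), and this is where p and q
  come from. Labels with equal squared spin are sums and differences of coordinates of different
  summands. This accounts for entries such as (p - q)/2, and it is the reason why quadratic
  characters of different moduli, each of which only changes a sign on its own summand, permute the
  labels.\<close>

definition mat2 :: "int \<Rightarrow> int \<Rightarrow> int \<Rightarrow> int \<Rightarrow> int mat" where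
  "mat2 a b c d = mat_of_rows_list 2 [[a, b], [c, d]]"

lemma mat2_carrier [simp]: "mat2 a b c d \<in> carrier_mat 2 2"
  unfolding mat2_def mat_of_rows_list_def by (rule carrier_matI) simp_all

lemma mat2_dim [simp]: "dim_row (mat2 a b c d) = 2" "dim_col (mat2 a b c d) = 2"
  by (simp_all add: mat2_def mat_of_rows_list_def)

lemma mat2_index [simp]:
  "mat2 a b c d $$ (0, 0) = a" "mat2 a b c d $$ (0, Suc 0) = b"
  "mat2 a b c d $$ (Suc 0, 0) = c" "mat2 a b c d $$ (Suc 0, Suc 0) = d"
  by (simp_all add: mat2_def mat_of_rows_list_def)

lemma mat2_eta: "A \<in> carrier_mat 2 2 \<Longrightarrow> mat2 (A $$ (0, 0)) (A $$ (0, 1)) (A $$ (1, 0)) (A $$ (1, 1)) = A"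
  by (rule eq_matI) (auto dest!: less_2_cases)

lemma mat2_eq_iff [simp]: "mat2 a b c d = mat2 a' b' c' d' \<longleftrightarrow> a = a' \<and> b = b' \<and> c = c' \<and> d = d'"
  by (metis mat2_index)

lemma mat2_mult [simp]:
  "mat2 a b c d * mat2 a' b' c' d' =
     mat2 (a * a' + b * c') (a * b' + b * d') (c * a' + d * c') (c * b' + d * d')"
proof (rule eq_matI)
  fix i j
  assume "i < dim_row (mat2 (a * a' + b * c') (a * b' + b * d') (c * a' + d * c') (c * b' + d * d'))"
    "j < dim_col (mat2 (a * a' + b * c') (a * b' + b * d') (c * a' + d * c') (c * b' + d * d'))"
  then have "i = 0 \<or> i = Suc 0" "j = 0 \<or> j = Suc 0" by auto
  then show "(mat2 a b c d * mat2 a' b' c' d') $$ (i, j) =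
      mat2 (a * a' + b * c') (a * b' + b * d') (c * a' + d * c') (c * b' + d * d') $$ (i, j)"
    by (elim disjE) (simp_all add: scalar_prod_def numeral_2_eq_2)
qed simp_all

lemma one_mat2: "1\<^sub>m 2 = mat2 1 0 0 1"
  by (rule eq_matI) (auto dest!: less_2_cases)

lemma det_mat2 [simp]: "det (mat2 a b c d) = a * d - b * c"
proof -
  have "det (mat2 a b c d) = (\<Sum>j<2. mat2 a b c d $$ (0, j) * cofactor (mat2 a b c d) 0 j)"
    by (rule laplace_expansion_row) auto
  also have "\<dots> = a * d - b * c"
    by (simp add: numeral_2_eq_2 cofactor_def det_single mat_delete_def)
  finally show ?thesis .
qed

lemma s_gen_mat2: "s_gen = mat2 0 (-1) 1 0" and t2_gen_mat2: "t2_gen = mat2 1 2 0 1"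
  by (simp_all add: s_gen_def t2_gen_def mat2_def)

lemma mat2_in_SL2Z [simp]: "mat2 a b c d \<in> carrier SL2Z \<longleftrightarrow> a * d - b * c = 1"
  by (simp add: SL2Z_def)

lemma SL2Z_cases:
  assumes "A \<in> carrier SL2Z"
  obtains a b c d where "A = mat2 a b c d" "a * d - b * c = 1"
proof -
  have A: "A \<in> carrier_mat 2 2" "det A = 1" using assms by (simp_all add: SL2Z_def)
  show ?thesis
  proof (rule that)
    show "A = mat2 (A $$ (0, 0)) (A $$ (0, 1)) (A $$ (1, 0)) (A $$ (1, 1))"
      using mat2_eta[OF A(1)] by simp
    then show "A $$ (0, 0) * A $$ (1, 1) - A $$ (0, 1) * A $$ (1, 0) = 1"
      using A(2) det_mat2 by metis
  qed
qed

lemma SL2Z_sel [simp]: "x \<otimes>\<^bsub>SL2Z\<^esub> y = x * y" "\<one>\<^bsub>SL2Z\<^esub> = mat2 1 0 0 1"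
  by (simp_all add: SL2Z_def one_mat2)

lemma group_SL2Z: "group SL2Z"
proof (rule groupI)
  fix x y assume xy: "x \<in> carrier SL2Z" "y \<in> carrier SL2Z"
  have "det (x * y) = det x * det y"
    by (rule det_mult) (use xy in \<open>auto simp: SL2Z_def\<close>)
  then show "x \<otimes>\<^bsub>SL2Z\<^esub> y \<in> carrier SL2Z"
    using xy by (auto simp: SL2Z_def intro: mult_carrier_mat)
next
  fix x y z assume "x \<in> carrier SL2Z" "y \<in> carrier SL2Z" "z \<in> carrier SL2Z"
  then show "x \<otimes>\<^bsub>SL2Z\<^esub> y \<otimes>\<^bsub>SL2Z\<^esub> z = x \<otimes>\<^bsub>SL2Z\<^esub> (y \<otimes>\<^bsub>SL2Z\<^esub> z)"
    by (auto elim!: SL2Z_cases simp: algebra_simps)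
next
  fix x assume "x \<in> carrier SL2Z"
  then obtain a b c d where x: "x = mat2 a b c d" "a * d - b * c = 1"
    by (rule SL2Z_cases)
  show "\<exists>y\<in>carrier SL2Z. y \<otimes>\<^bsub>SL2Z\<^esub> x = \<one>\<^bsub>SL2Z\<^esub>"
    using x(2) by (intro bexI[of _ "mat2 d (- b) (- c) a"]) (auto simp: x(1) algebra_simps)
qed (auto elim!: SL2Z_cases)

lemma inv_SL2Z: "a * d - b * c = 1 \<Longrightarrow> inv\<^bsub>SL2Z\<^esub> (mat2 a b c d) = mat2 d (- b) (- c) a"
  by (intro group.inv_equality group_SL2Z) (auto simp: algebra_simps)

lemma Gamma_theta_sel [simp]: "x \<otimes>\<^bsub>Gamma_theta\<^esub> y = x * y" "\<one>\<^bsub>Gamma_theta\<^esub> = mat2 1 0 0 1"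
  by (simp_all add: Gamma_theta_def)

lemma group_Gamma_theta: "group Gamma_theta"
  unfolding Gamma_theta_def by (rule group.group_subgroup_generated[OF group_SL2Z])

lemma carrier_Gamma_theta_eq: "carrier Gamma_theta = generate SL2Z {s_gen, t2_gen}"
proof -
  have "carrier SL2Z \<inter> {s_gen, t2_gen} = {s_gen, t2_gen}"
    by (auto simp: s_gen_mat2 t2_gen_mat2)
  then show ?thesis by (simp add: Gamma_theta_def carrier_subgroup_generated)
qed

lemma s_gen_in [simp]: "s_gen \<in> carrier Gamma_theta" and t2_gen_in [simp]: "t2_gen \<in> carrier Gamma_theta"
  by (auto simp: carrier_Gamma_theta_eq intro: generate.incl)

lemma inv_Gamma_theta: "g \<in> carrier Gamma_theta \<Longrightarrow> inv\<^bsub>Gamma_theta\<^esub> g = inv\<^bsub>SL2Z\<^esub> g"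
  unfolding Gamma_theta_def by (rule group.inv_subgroup_generated[OF group_SL2Z])

text \<open>The reduction modulo 2 is the identity or the image of s. These two elements form a
  subgroup of order 2 in SL_2(Z/2), so for determinant 1 the condition cuts out a subgroup of index
  3.\<close>

abbreviation theta_parity :: "int \<Rightarrow> int \<Rightarrow> int \<Rightarrow> int \<Rightarrow> bool" where
  "theta_parity a b c d \<equiv>
     even b \<and> even c \<and> odd a \<and> odd d \<or> odd b \<and> odd c \<and> even a \<and> even d"

lemma Gamma_theta_parity:
  assumes "g \<in> carrier Gamma_theta"
  shows "\<exists>a b c d. g = mat2 a b c d \<and> a * d - b * c = 1 \<and>
           theta_parity a b c d"
  using assms unfolding carrier_Gamma_theta_eq
proof (induction rule: generate.induct)
  case one
  then show ?case by force
next
  case (incl h)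
  then show ?case by (force simp: s_gen_mat2 t2_gen_mat2)
next
  case (inv h)
  then show ?case by (force simp: s_gen_mat2 t2_gen_mat2 inv_SL2Z)
next
  case (eng h1 h2)
  then obtain a b c d a' b' c' d' where
    1: "h1 = mat2 a b c d" "a * d - b * c = 1"
       "theta_parity a b c d" and
    2: "h2 = mat2 a' b' c' d'" "a' * d' - b' * c' = 1"
       "theta_parity a' b' c' d'"
    by blast
  have "(a * a' + b * c') * (c * b' + d * d') - (a * b' + b * d') * (c * a' + d * c') =
      (a * d - b * c) * (a' * d' - b' * c')"
    by (simp add: algebra_simps)
  then show ?case using 1 2 by auto
qed

lemma t2_power_in: "mat2 1 (2 * k) 0 1 \<in> carrier Gamma_theta"
proof -
  have *: "mat2 1 (2 * int m) 0 1 \<in> carrier Gamma_theta" for m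
  proof (induction m)
    case 0
    then show ?case using group.is_monoid[OF group_Gamma_theta, THEN monoid.one_closed] by simp
  next
    case (Suc m)
    then show ?case
      using monoid.m_closed[OF group.is_monoid[OF group_Gamma_theta] Suc t2_gen_in]
      by (simp add: t2_gen_mat2 algebra_simps)
  qed
  show ?thesis
  proof (cases "k \<ge> 0")
    case True
    then show ?thesis using *[of "nat k"] by simp
  next
    case False
    then show ?thesis
      using group.inv_closed[OF group_Gamma_theta *[of "nat (- k)"]]
        inv_Gamma_theta[OF *[of "nat (- k)"]]
      by (simp add: inv_SL2Z)
  qed
qed

text \<open>Euclidean division by 2c: the centred remainder lies between -|c| (included) and |c|
  (excluded), and the parity of c + d rules out -|c|. The decrease is therefore strict although only
  even multiples of c may be added.\<close>

lemma reduce_even: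
  fixes c d :: int
  assumes "c \<noteq> 0" "odd (c + d)"
  shows "\<exists>k. \<bar>d + 2 * k * c\<bar> < \<bar>c\<bar>"
proof -
  define m where "m = 2 * \<bar>c\<bar>"
  define r where "r = (d + \<bar>c\<bar>) mod m - \<bar>c\<bar>"
  have m: "m > 0" using assms by (simp add: m_def)
  have r: "- \<bar>c\<bar> \<le> r" "r < \<bar>c\<bar>"
    using pos_mod_bound[OF m, of "d + \<bar>c\<bar>"] pos_mod_sign[OF m, of "d + \<bar>c\<bar>"]
    unfolding r_def m_def by linarith+
  have "r = d + 2 * (- sgn c * ((d + \<bar>c\<bar>) div m)) * c"
    using minus_div_mult_eq_mod[of "d + \<bar>c\<bar>" m] unfolding r_def m_def
    by (simp add: abs_sgn algebra_simps)
  then obtain k where k: "r = d + 2 * k * c" by blast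
  have "odd (c + r)" using assms k by simp
  then have "r \<noteq> - \<bar>c\<bar>" by (auto simp: abs_if split: if_splits)
  then show ?thesis using r k by (intro exI[of _ k]) auto
qed

text \<open>Descent on |c|: a power of t^2 followed by s makes the lower left entry smaller in
  absolute value, and a matrix with c = 0 is plus or minus a power of t^2. Membership is thereby
  decided by parities, for concrete matrices as well as for whole congruence subgroups.\<close>

lemma Gamma_thetaI:
  assumes "a * d - b * c = 1"
    "theta_parity a b c d"
  shows "mat2 a b c d \<in> carrier Gamma_theta"
  using assms
proof (induction "nat \<bar>c\<bar>" arbitrary: a b c d rule: less_induct)
  case less
  interpret group Gamma_theta by (rule group_Gamma_theta)
  have neg: "mat2 (-1) 0 0 (-1) \<in> carrier Gamma_theta"
    using m_closed[OF s_gen_in s_gen_in] by (simp add: s_gen_mat2)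
  show ?case
  proof (cases "c = 0")
    case True
    then have "a = 1 \<and> d = 1 \<or> a = -1 \<and> d = -1"
      using less.prems by (simp add: zmult_eq_1_iff)
    moreover obtain k where "b = 2 * k" using less.prems True by auto
    ultimately show ?thesis
      using t2_power_in[of k] m_closed[OF neg t2_power_in[of "- k"]] True by auto
  next
    case False
    then obtain k where k: "\<bar>d + 2 * k * c\<bar> < \<bar>c\<bar>"
      using reduce_even[of c d] less.prems by auto
    define e where "e = d + 2 * k * c"
    define f where "f = b + 2 * k * a"
    \<comment> \<open>This is the given matrix times t^(2k) times s, with lower left entry
      e.\<close>
    have "mat2 f (- a) e (- c) \<in> carrier Gamma_theta"
    proof (rule less.hyps)
      show "nat \<bar>e\<bar> < nat \<bar>c\<bar>" using k by (simp add: e_def)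
      show "f * (- c) - (- a) * e = 1" using less.prems(1) by (simp add: e_def f_def algebra_simps)
      show "theta_parity f (- a) e (- c)"
        using less.prems(2) by (auto simp: e_def f_def)
    qed
    from m_closed[OF m_closed[OF this inv_closed[OF s_gen_in]] t2_power_in[of "- k"]]
    show ?thesis
      by (simp add: inv_Gamma_theta s_gen_mat2 inv_SL2Z e_def f_def s_gen_in[unfolded s_gen_mat2] algebra_simps)
  qed
qed

lemma Gamma_theta_cases:
  assumes "g \<in> carrier Gamma_theta"
  obtains a b c d where "g = mat2 a b c d" "a * d - b * c = 1" "even b" "even c" "odd a" "odd d"
    | a b c d where "g = mat2 a b c d" "a * d - b * c = 1" "odd b" "odd c" "even a" "even d"
  using Gamma_theta_parity[OF assms] by blast

lemma Gamma_cases: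
  assumes "g \<in> Gamma m"
  obtains a b c d where "g = mat2 a b c d" "a * d - b * c = 1"
    "[a = 1] (mod int m)" "[b = 0] (mod int m)" "[c = 0] (mod int m)" "[d = 1] (mod int m)"
proof -
  from assms have "g \<in> carrier SL2Z" by (simp add: Gamma_def)
  then obtain a b c d where g: "g = mat2 a b c d" "a * d - b * c = 1" by (rule SL2Z_cases)
  moreover have "g $$ (i, j) mod int m = 1\<^sub>m 2 $$ (i, j) mod int m" if "i < 2" "j < 2" for i j
    using assms that by (auto simp: Gamma_def)
  from this[of 0 0] this[of 0 1] this[of 1 0] this[of 1 1]
  have "[a = 1] (mod int m)" "[b = 0] (mod int m)" "[c = 0] (mod int m)" "[d = 1] (mod int m)"
    by (auto simp: g cong_def)
  ultimately show ?thesis using that by blast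
qed

lemma mat2_in_Gamma:
  "mat2 a b c d \<in> Gamma m \<longleftrightarrow> a * d - b * c = 1 \<and>
    [a = 1] (mod int m) \<and> [b = 0] (mod int m) \<and> [c = 0] (mod int m) \<and> [d = 1] (mod int m)"
  by (auto simp: Gamma_def less_2_cases_iff cong_def)

lemma Gamma_subset_Gamma_theta:
  assumes "even m"
  shows "Gamma m \<subseteq> carrier Gamma_theta"
proof
  fix g assume "g \<in> Gamma m"
  then obtain a b c d where g: "g = mat2 a b c d" "a * d - b * c = 1"
    "[a = 1] (mod int m)" "[b = 0] (mod int m)" "[c = 0] (mod int m)" "[d = 1] (mod int m)"
    by (rule Gamma_cases)
  have m: "2 dvd int m" using assms by simp
  have "[a = 1] (mod 2)" "[b = 0] (mod 2)" "[c = 0] (mod 2)" "[d = 1] (mod 2)"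
    by (rule cong_dvd_modulus[OF _ m]; fact)+
  then have "odd a" "even b" "even c" "odd d" by (simp_all add: cong_iff_dvd_diff)
  then show "g \<in> carrier Gamma_theta" using g by (simp add: Gamma_thetaI)
qed

subsection \<open>Linear representations of the theta subgroup\<close>

lemma GL_sel [simp]: "x \<otimes>\<^bsub>GL n\<^esub> y = x * y" "\<one>\<^bsub>GL n\<^esub> = 1\<^sub>m n"
  by (simp_all add: GL_def units_of_def ring_mat_simps)

lemma group_GL: "group (GL n)"
  unfolding GL_def
  by (intro monoid.units_group ring.axioms(2)[OF ring_mat])

lemma GL_carrier_iff:
  "A \<in> carrier (GL n) \<longleftrightarrow> A \<in> carrier_mat n n \<and> (\<exists>B\<in>carrier_mat n n. B * A = 1\<^sub>m n \<and> A * B = 1\<^sub>m n)"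
  by (auto simp: GL_def units_of_carrier Units_def ring_mat_simps)

lemma GL_carrierI:
  assumes "A \<in> carrier_mat n n" "B \<in> carrier_mat n n" "A * B = 1\<^sub>m n"
  shows "A \<in> carrier (GL n)"
  using assms mat_mult_left_right_inverse[OF assms] by (auto simp: GL_carrier_iff)

lemma smult_smult_mat: "x \<cdot>\<^sub>m (y \<cdot>\<^sub>m A) = (x * y) \<cdot>\<^sub>m (A :: complex mat)"
  by (rule eq_matI) auto

lemma one_smult_mat [simp]: "1 \<cdot>\<^sub>m A = (A :: complex mat)"
  by (rule eq_matI) auto

lemma smult_in_GL: "A \<in> carrier (GL n) \<Longrightarrow> x \<noteq> 0 \<Longrightarrow> x \<cdot>\<^sub>m A \<in> carrier (GL n)"
proof -
  assume A: "A \<in> carrier (GL n)" and x: "x \<noteq> 0"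
  then obtain B where B: "A \<in> carrier_mat n n" "B \<in> carrier_mat n n" "A * B = 1\<^sub>m n"
    by (auto simp: GL_carrier_iff)
  have "(x \<cdot>\<^sub>m A) * (inverse x \<cdot>\<^sub>m B) = 1\<^sub>m n"
    using B x by (simp add: mult_smult_assoc_mat[of _ n n _ n] mult_smult_distrib[of _ n n _ n] smult_smult_mat)
  then show ?thesis using B by (intro GL_carrierI[of _ _ "inverse x \<cdot>\<^sub>m B"]) auto
qed

lemma scalar_mult_left: "A \<in> carrier_mat n n \<Longrightarrow> (x \<cdot>\<^sub>m 1\<^sub>m n) * A = x \<cdot>\<^sub>m (A :: complex mat)"
  by (simp add: mult_smult_assoc_mat[of _ n n _ n])

lemma scalar_mult_right: "A \<in> carrier_mat n n \<Longrightarrow> A * (x \<cdot>\<^sub>m 1\<^sub>m n) = x \<cdot>\<^sub>m (A :: complex mat)"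
  by (simp add: mult_smult_distrib[of _ n n _ n])

lemma GL_one_carrier: "1\<^sub>m n \<in> carrier (GL n)"
  by (rule GL_carrierI[of _ _ "1\<^sub>m n"]) auto

lemma normal_scalars: "scalars n \<lhd> GL n"
proof -
  interpret group "GL n" by (rule group_GL)
  have sub: "subgroup (scalars n) (GL n)"
  proof (rule subgroupI)
    show "scalars n \<subseteq> carrier (GL n)"
      by (auto simp: scalars_def intro!: smult_in_GL GL_one_carrier)
    show "scalars n \<noteq> {}" by (auto simp: scalars_def intro: exI[of _ 1])
    fix a assume "a \<in> scalars n"
    then obtain x where x: "a = x \<cdot>\<^sub>m 1\<^sub>m n" "x \<noteq> 0" by (auto simp: scalars_def)
    then have "inv\<^bsub>GL n\<^esub> a = inverse x \<cdot>\<^sub>m 1\<^sub>m n"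
      by (intro inv_equality)
        (auto simp: scalar_mult_left smult_smult_mat intro!: smult_in_GL GL_one_carrier)
    then show "inv\<^bsub>GL n\<^esub> a \<in> scalars n" using x by (auto simp: scalars_def)
    fix b assume "b \<in> scalars n"
    then obtain y where "b = y \<cdot>\<^sub>m 1\<^sub>m n" "y \<noteq> 0" by (auto simp: scalars_def)
    then show "a \<otimes>\<^bsub>GL n\<^esub> b \<in> scalars n"
      using x by (auto simp: scalars_def scalar_mult_left smult_smult_mat intro!: exI[of _ "x * y"])
  qed
  show ?thesis
  proof (rule normal_inv_iff[THEN iffD2], intro conjI ballI sub)
    fix A h assume A: "A \<in> carrier (GL n)" and "h \<in> scalars n"
    then obtain x where x: "h = x \<cdot>\<^sub>m 1\<^sub>m n" "x \<noteq> 0" by (auto simp: scalars_def)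
    have Ac: "A \<in> carrier_mat n n" "inv\<^bsub>GL n\<^esub> A \<in> carrier_mat n n"
      using A inv_closed[OF A] by (auto simp: GL_carrier_iff)
    have "A * h * inv\<^bsub>GL n\<^esub> A = x \<cdot>\<^sub>m (A * inv\<^bsub>GL n\<^esub> A)"
      using Ac x by (simp add: scalar_mult_right mult_smult_assoc_mat[of _ n n _ n])
    also have "A * inv\<^bsub>GL n\<^esub> A = 1\<^sub>m n" using r_inv[OF A] by simp
    finally show "A \<otimes>\<^bsub>GL n\<^esub> h \<otimes>\<^bsub>GL n\<^esub> inv\<^bsub>GL n\<^esub> A \<in> scalars n"
      using x by (auto simp: scalars_def)
  qed
qed

text \<open>A closed formula for powers has to satisfy the upward recursion only; cancelling x runs
  it downwards through the negative exponents.\<close>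

lemma (in group) int_pow_eqI:
  assumes "x \<in> carrier G" "\<And>k. f k \<in> carrier G" "f 0 = \<one>" "\<And>k. f (k + 1) = f k \<otimes> x"
  shows "x [^] (k::int) = f k"
proof (induction k rule: int_induct[where k = 0])
  case base
  then show ?case using assms by simp
next
  case (step1 i)
  then show ?case using assms by (simp add: int_pow_mult)
next
  case (step2 i)
  have "x [^] (i - 1) \<otimes> x = x [^] ((i - 1) + 1)"
    using assms(1) by (subst int_pow_mult) simp_all
  also have "\<dots> = f (i - 1) \<otimes> x" using step2 assms(4)[of "i - 1"] by simp
  finally show ?case using assms by simp
qed

text \<open>F is required to follow right multiplication by the two generators, and multiplicativity
  is derived. A function given by a formula in the matrix entries can be tested against this without
  a presentation of the group.\<close>

locale theta_rep =
  fixes n :: nat and S T2 :: "complex mat" and F :: "int mat \<Rightarrow> complex mat"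
  assumes n: "n > 0"
    and S: "S \<in> carrier_mat n n" and T2: "T2 \<in> carrier_mat n n"
    and F_carrier: "F g \<in> carrier_mat n n"
    and F_one: "F (mat2 1 0 0 1) = 1\<^sub>m n"
    and F_mult_s: "g \<in> carrier Gamma_theta \<Longrightarrow> F (g * s_gen) = F g * S"
    and F_mult_t2: "g \<in> carrier Gamma_theta \<Longrightarrow> F (g * t2_gen) = F g * T2"
begin

sublocale \<Gamma>: group Gamma_theta by (rule group_Gamma_theta)
sublocale GL: group "GL n" by (rule group_GL)

text \<open>Induction over the generation of h, with g arbitrary throughout. For the inverse y of a
  generator x the assumption gives F y times X = F 1 = 1, so F y is the inverse of the matrix X
  belonging to x.\<close>

lemma F_mult:
  assumes "h \<in> carrier Gamma_theta" "g \<in> carrier Gamma_theta"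
  shows "F (g * h) = F g * F h"
proof -
  have one: "mat2 1 0 0 1 * h = h" if "h \<in> carrier Gamma_theta" for h
    using \<Gamma>.l_one[OF that] by simp
  have gen: "\<exists>X\<in>carrier_mat n n. \<forall>g\<in>carrier Gamma_theta. F (g * x) = F g * X" if "x \<in> {s_gen, t2_gen}" for x
    using that S T2 F_mult_s F_mult_t2 by blast
  have h: "h \<in> generate SL2Z {s_gen, t2_gen}"
    using assms by (simp add: carrier_Gamma_theta_eq)
  then have "\<forall>g\<in>carrier Gamma_theta. F (g * h) = F g * F h"
  proof (induction rule: generate.induct)
    case one
    show ?case using \<Gamma>.r_one F_one right_mult_one_mat[OF F_carrier] by simp
  next
    case (incl x)
    then obtain X where X: "X \<in> carrier_mat n n" "\<And>g. g \<in> carrier Gamma_theta \<Longrightarrow> F (g * x) = F g * X"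
      using gen by metis
    have "F x = X"
      using X(2)[OF \<Gamma>.one_closed] X(1) F_one incl one[of x] by auto
    then show ?case using X by simp
  next
    case (inv x)
    then obtain X where X: "X \<in> carrier_mat n n" "\<And>g. g \<in> carrier Gamma_theta \<Longrightarrow> F (g * x) = F g * X"
      using gen by metis
    have x: "x \<in> carrier Gamma_theta" using inv by auto
    define y where "y = inv\<^bsub>SL2Z\<^esub> x"
    have y: "y \<in> carrier Gamma_theta" and yx: "y * x = mat2 1 0 0 1"
      using \<Gamma>.inv_closed[OF x] \<Gamma>.l_inv[OF x] inv_Gamma_theta[OF x] by (auto simp: y_def)
    have "F y * X = 1\<^sub>m n" using X(2)[OF y] yx F_one by simp
    then have XY: "X * F y = 1\<^sub>m n"
      by (rule mat_mult_left_right_inverse[OF F_carrier X(1)])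
    show ?case
    proof
      fix g assume g: "g \<in> carrier Gamma_theta"
      have gy: "g * y \<in> carrier Gamma_theta" using \<Gamma>.m_closed[OF g y] by simp
      have "g * y * x = g" using \<Gamma>.m_assoc[OF g y x] yx \<Gamma>.r_one[OF g] by simp
      then have "F g = F (g * y) * X" using X(2)[OF gy] by simp
      then have "F g * F y = F (g * y) * (X * F y)"
        using assoc_mult_mat[OF F_carrier X(1) F_carrier] by simp
      then show "F (g * inv\<^bsub>SL2Z\<^esub> x) = F g * F (inv\<^bsub>SL2Z\<^esub> x)"
        using XY F_carrier[of "g * y"] by (simp add: y_def)
    qed
  next
    case (eng h1 h2)
    have h: "h1 \<in> carrier Gamma_theta" "h2 \<in> carrier Gamma_theta"
      using eng.hyps by (simp_all add: carrier_Gamma_theta_eq)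
    show ?case
    proof
      fix g assume g: "g \<in> carrier Gamma_theta"
      have gh: "g * h1 \<in> carrier Gamma_theta" using \<Gamma>.m_closed[OF g h(1)] by simp
      have "F (g * h1 * h2) = F g * F h1 * F h2" using eng.IH g gh by simp
      then show "F (g * (h1 \<otimes>\<^bsub>SL2Z\<^esub> h2)) = F g * F (h1 \<otimes>\<^bsub>SL2Z\<^esub> h2)"
        using \<Gamma>.m_assoc[OF g h] eng.IH h assoc_mult_mat[OF F_carrier F_carrier F_carrier] by simp
    qed
  qed
  then show ?thesis using assms by blast
qed

lemma F_GL:
  assumes "g \<in> carrier Gamma_theta"
  shows "F g \<in> carrier (GL n)"
proof -
  have "F g * F (inv\<^bsub>Gamma_theta\<^esub> g) = F (g * inv\<^bsub>Gamma_theta\<^esub> g)"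
    by (rule F_mult[OF \<Gamma>.inv_closed[OF assms] assms, symmetric])
  also have "g * inv\<^bsub>Gamma_theta\<^esub> g = mat2 1 0 0 1"
    using \<Gamma>.r_inv[OF assms] unfolding Gamma_theta_sel .
  finally show ?thesis
    unfolding F_one by (rule GL_carrierI[OF F_carrier F_carrier])
qed

lemma F_hom: "F \<in> hom Gamma_theta (GL n)"
  using F_GL F_mult by (auto simp: hom_def)

sublocale F: group_hom Gamma_theta "GL n" F
  by unfold_locales (rule F_hom)

lemma F_s: "F s_gen = S" and F_t2: "F t2_gen = T2"
  using F_mult_s[OF \<Gamma>.one_closed] F_mult_t2[OF \<Gamma>.one_closed] F_one S T2
    \<Gamma>.l_one[OF s_gen_in] \<Gamma>.l_one[OF t2_gen_in] by auto

lemma S_GL: "S \<in> carrier (GL n)" and T2_GL: "T2 \<in> carrier (GL n)"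
  using F_GL[OF s_gen_in] F_GL[OF t2_gen_in] by (simp_all add: F_s F_t2)

lemma F_kernel: "kernel Gamma_theta (GL n) F = {g \<in> carrier Gamma_theta. F g = 1\<^sub>m n}"
  by (simp add: kernel_def)

lemma Gamma_sub_kernel:
  assumes "even m" "\<And>g. g \<in> Gamma m \<Longrightarrow> F g = 1\<^sub>m n"
  shows "Gamma m \<subseteq> kernel Gamma_theta (GL n) F"
  using assms Gamma_subset_Gamma_theta by (auto simp: F_kernel)

lemma projective_congruence:
  assumes "congruence_hom (GL n) F"
  shows "projective_congruence n S T2"
proof -
  interpret N: normal "scalars n" "GL n" by (rule normal_scalars)
  define \<pi> where "\<pi> = (\<lambda>a. scalars n #>\<^bsub>GL n\<^esub> a) \<circ> F"
  have hom: "\<pi> \<in> hom Gamma_theta (PGL n)"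
    unfolding \<pi>_def PGL_def by (rule hom_compose[OF F_hom N.r_coset_hom_Mod])
  obtain m where m: "m > 0" "Gamma m \<subseteq> kernel Gamma_theta (GL n) F"
    using assms by (auto simp: congruence_hom_def)
  have "scalars n #>\<^bsub>GL n\<^esub> \<one>\<^bsub>GL n\<^esub> = scalars n"
    by (rule GL.coset_mult_one[OF N.subset])
  then have "\<pi> g = \<one>\<^bsub>PGL n\<^esub>" if "F g = \<one>\<^bsub>GL n\<^esub>" for g
    unfolding \<pi>_def comp_def that by (simp add: PGL_def FactGroup_def)
  then have "kernel Gamma_theta (GL n) F \<subseteq> kernel Gamma_theta (PGL n) \<pi>"
    unfolding kernel_def by blast
  then have "congruence_hom (PGL n) \<pi>"
    unfolding congruence_hom_def using hom m by blast
  moreover have "\<pi> s_gen = scalars n #>\<^bsub>GL n\<^esub> S" "\<pi> t2_gen = scalars n #>\<^bsub>GL n\<^esub> T2"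
    by (simp_all only: \<pi>_def comp_def F_s F_t2)
  ultimately show ?thesis
    unfolding projective_congruence_def using S_GL T2_GL by blast
qed

lemma linear_lift_zero:
  assumes "congruence_hom (GL n) F"
  shows "linear_lift n S T2 0 F"
  using assms by (simp add: linear_lift_def F_s F_t2)

lemma F_t2_power: "F (mat2 1 (2 * int k) 0 1) = T2 ^\<^sub>m k"
proof (induction k)
  case 0
  then show ?case using F_one T2 by simp
next
  case (Suc k)
  have "F (mat2 1 (2 * int k) 0 1 * t2_gen) = F (mat2 1 (2 * int k) 0 1) * T2"
    by (rule F_mult_t2[OF t2_power_in])
  then show ?case using Suc by (simp add: t2_gen_mat2 algebra_simps)
qed

text \<open>The unipotent matrix with upper right entry m lies in Gamma(m). Being in Gamma_theta it
  forces m to be even, and then it is the (m/2)-th power of t^2.\<close>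

lemma Gamma_in_kernelD:
  assumes "Gamma m \<subseteq> kernel Gamma_theta (GL n) F"
  shows "even m" "T2 ^\<^sub>m (m div 2) = 1\<^sub>m n"
proof -
  have g: "mat2 1 (int m) 0 1 \<in> Gamma m" by (simp add: mat2_in_Gamma cong_def)
  then have k: "mat2 1 (int m) 0 1 \<in> carrier Gamma_theta" "F (mat2 1 (int m) 0 1) = 1\<^sub>m n"
    using assms by (auto simp: F_kernel)
  show m: "even m" using k(1) by (auto elim!: Gamma_theta_cases)
  have "2 * int (m div 2) = int m" using m by auto
  then show "T2 ^\<^sub>m (m div 2) = 1\<^sub>m n" using k(2) F_t2_power[of "m div 2"] by simp
qed

text \<open>The order of T2 already excludes most m below N; each remaining one has to be refuted by
  an element of Gamma(m) that acts nontrivially.\<close>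

lemma level_eqI:
  assumes "N > 0" "Gamma N \<subseteq> kernel Gamma_theta (GL n) F"
    "\<And>m. 0 < m \<Longrightarrow> m < N \<Longrightarrow> even m \<Longrightarrow> T2 ^\<^sub>m (m div 2) = 1\<^sub>m n \<Longrightarrow> \<exists>g\<in>Gamma m. F g \<noteq> 1\<^sub>m n"
  shows "level (GL n) F = N"
  unfolding level_def
proof (rule Least_equality)
  show "N > 0 \<and> Gamma N \<subseteq> kernel Gamma_theta (GL n) F" using assms by simp
  fix m assume m: "m > 0 \<and> Gamma m \<subseteq> kernel Gamma_theta (GL n) F"
  then show "N \<le> m"
    using assms(3)[of m] Gamma_in_kernelD[of m] by (force simp: F_kernel)
qed

lemma s_in' [simp]: "mat2 0 (-1) 1 0 \<in> carrier Gamma_theta"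
  using s_gen_in by (simp add: s_gen_mat2)

text \<open>The matrix t^2 s has trace 2, hence is unipotent, and its powers are affine in the
  exponent. The whole word collapses to one matrix, which is congruent to diag(a, a') modulo every n
  dividing a a' - 1.\<close>

lemma H_mat_eq:
  fixes a a' :: int
  assumes "odd a" "odd a'"
  shows "H_mat n S T2 a a' = F (mat2 (a * (2 - a * a')) (1 - a * a') (a * a' - 1) a')"
proof -
  have t2: "t2_gen [^]\<^bsub>Gamma_theta\<^esub> k = mat2 1 (2 * k) 0 1" for k :: int
    by (rule \<Gamma>.int_pow_eqI) (simp_all add: t2_power_in t2_gen_mat2 t2_gen_in[unfolded t2_gen_mat2])
  have ts: "mat2 2 (-1) 1 0 [^]\<^bsub>Gamma_theta\<^esub> k = mat2 (1 + k) (- k) k (1 - k)" for k :: int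
    by (rule \<Gamma>.int_pow_eqI) (auto simp: algebra_simps intro!: Gamma_thetaI)
  have tsF: "T2 * S = F (mat2 2 (-1) 1 0)"
    using F_mult[OF s_gen_in t2_gen_in] unfolding F_s F_t2 by (simp add: t2_gen_mat2 s_gen_mat2)
  have ts_in: "mat2 2 (-1) 1 0 \<in> carrier Gamma_theta" by (auto intro!: Gamma_thetaI)
  have ts_pow: "F (mat2 2 (-1) 1 0) [^]\<^bsub>GL n\<^esub> k = F (mat2 (1 + k) (- k) k (1 - k))" for k :: int
    using F.hom_int_pow[OF ts_in, of k] by (simp add: ts)
  have t2_pow: "T2 [^]\<^bsub>GL n\<^esub> k = F (mat2 1 (2 * k) 0 1)" for k :: int
    using F.hom_int_pow[OF t2_gen_in, of k] by (simp add: t2 F_t2)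
  have ss: "s_gen [^]\<^bsub>Gamma_theta\<^esub> (2::int) = mat2 (-1) 0 0 (-1)"
    using \<Gamma>.int_pow_mult[OF s_gen_in, of 1 1] by (simp add: s_gen_mat2)
  have s_pow: "S [^]\<^bsub>GL n\<^esub> (2::int) = F (mat2 (-1) 0 0 (-1))"
    using F.hom_int_pow[OF s_gen_in, of 2] by (simp add: ss F_s)
  have S_F: "S = F (mat2 0 (-1) 1 0)" by (simp add: F_s[symmetric] s_gen_mat2)
  have a: "2 * - ((a - 1) div 2) = 1 - a" using assms by (auto elim!: oddE)
  have [simp]: "mat2 (-1) 0 0 (-1) \<in> carrier Gamma_theta" "mat2 1 (1 - a) 0 1 \<in> carrier Gamma_theta"
    "mat2 a' (1 - a') (a' - 1) (2 - a') \<in> carrier Gamma_theta"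
    using assms by (auto intro!: Gamma_thetaI simp: algebra_simps)
  have "H_mat n S T2 a a' = F (mat2 (-1) 0 0 (-1)) * F (mat2 1 (1 - a) 0 1) * F (mat2 0 (-1) 1 0) *
      F (mat2 a' (1 - a') (a' - 1) (2 - a')) * F (mat2 1 (1 - a) 0 1) * F (mat2 0 (-1) 1 0)"
    unfolding H_mat_def GL_sel s_pow tsF ts_pow t2_pow a by (simp add: S_F)
  also have "\<dots> = F (mat2 (-1) 0 0 (-1) * mat2 1 (1 - a) 0 1 * mat2 0 (-1) 1 0 *
      mat2 a' (1 - a') (a' - 1) (2 - a') * mat2 1 (1 - a) 0 1 * mat2 0 (-1) 1 0)"
    by (simp only: F_mult[symmetric] \<Gamma>.m_closed[simplified Gamma_theta_sel] s_in'
        \<open>mat2 (-1) 0 0 (-1) \<in> carrier Gamma_theta\<close> \<open>mat2 1 (1 - a) 0 1 \<in> carrier Gamma_theta\<close>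
        \<open>mat2 a' (1 - a') (a' - 1) (2 - a') \<in> carrier Gamma_theta\<close>)
  also have "mat2 (-1) 0 0 (-1) * mat2 1 (1 - a) 0 1 * mat2 0 (-1) 1 0 *
      mat2 a' (1 - a') (a' - 1) (2 - a') * mat2 1 (1 - a) 0 1 * mat2 0 (-1) 1 0 =
      mat2 (a * (2 - a * a')) (1 - a * a') (a * a' - 1) a'"
    by (simp add: algebra_simps)
  finally show ?thesis .
qed

lemma signed_permutation_condition:
  assumes "congruence_hom (GL n) F" "even (level (GL n) F)"
    and "\<And>a a' :: nat. odd a \<Longrightarrow> odd a' \<Longrightarrow> [int a * int a' = 1] (mod int (level (GL n) F)) \<Longrightarrow>
      signed_permutation_mat n
        (F (mat2 (int a * (2 - int a * int a')) (1 - int a * int a') (int a * int a' - 1) (int a')))"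
  shows "signed_permutation_condition n S T2 0"
  unfolding signed_permutation_condition_def
proof (intro exI[of _ F] conjI allI impI)
  fix \<theta> and a a' :: nat
  assume *: "degenerate_eigenvalue (F t2_gen) \<theta> \<and> odd a \<and> odd a' \<and>
    a * a' mod level (GL n) F = 1 mod level (GL n) F \<and> \<theta> ^ a\<^sup>2 = \<theta>"
  then have "[int (a * a') = int 1] (mod int (level (GL n) F))"
    unfolding cong_int_iff by (simp add: cong_def)
  then show "signed_permutation_mat n (H_mat n (F s_gen) (F t2_gen) (int a) (int a'))"
    using assms(3)[of a a'] H_mat_eq[of "int a" "int a'"] * by (simp add: F_s F_t2)
qed (use assms linear_lift_zero in auto)

end

subsection \<open>Twists by characters and the central charge\<close>

(* Gamma_theta has a homomorphism to Z/24 with s to 0 and t^2 to 1. It is glued from homomorphisms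
   to Z/8 and Z/3 by the idempotents 9 and 16 = -8 of Z/24. *)
definition theta_exp :: "int mat \<Rightarrow> int" where
  "theta_exp g = (let a = g $$ (0, 0); b = g $$ (0, 1); c = g $$ (1, 0); d = g $$ (1, 1) in
     9 * (if even b then (a * b - c * d) div 2 + b * c else (c * d - a * b) div 2 - a * d) +
     8 * (b * d * (1 - c\<^sup>2) + c * (a + d)))"

lemma theta_exp_mat2:
  "theta_exp (mat2 a b c d) =
     9 * (if even b then (a * b - c * d) div 2 + b * c else (c * d - a * b) div 2 - a * d) +
     8 * (b * d * (1 - c\<^sup>2) + c * (a + d))"
  by (simp add: theta_exp_def)

text \<open>9 is 1 modulo 8 and 0 modulo 3, whereas 8 is 0 modulo 8 and -1 modulo 3: for the sum to
  rise by one, the component modulo 3 has to fall by one.\<close>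

lemma cong_24_combine:
  fixes u v w t :: int
  assumes "[u = v + 1] (mod 8)" "[w = t - 1] (mod 3)"
  shows "[9 * u + 8 * w = 9 * v + 8 * t + 1] (mod 24)"
proof -
  obtain i j where "u - (v + 1) = 8 * i" "w - (t - 1) = 3 * j"
    using assms by (auto simp: cong_iff_dvd_diff elim!: dvdE)
  then have "(9 * u + 8 * w) - (9 * v + 8 * t + 1) = 24 * (3 * i + j)" by simp
  then show ?thesis by (simp add: cong_iff_dvd_diff)
qed

text \<open>Multiplication by s exchanges the two branches of the component modulo 8 and preserves
  its value. The component modulo 3 changes by -3cd, by ad - bc = 1, and the factor 8 in front makes
  this a multiple of 24.\<close>

lemma theta_exp_s:
  assumes "g \<in> carrier Gamma_theta"
  shows "[theta_exp (g * s_gen) = theta_exp g] (mod 24)"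
proof -
  obtain a b c d where g: "g = mat2 a b c d" and det: "a * d - b * c = 1" and
    par: "theta_parity a b c d"
    using Gamma_theta_parity[OF assms] by blast
  have "a * c * (1 - d\<^sup>2) + d * (b - c) = b * d * (1 - c\<^sup>2) + c * (a + d) - c * d * (a * d - b * c) - 2 * c * d"
    by (simp add: algebra_simps power2_eq_square)
  then have e3: "a * c * (1 - d\<^sup>2) + d * (b - c) = b * d * (1 - c\<^sup>2) + c * (a + d) - 3 * (c * d)"
    using det by simp
  have "g * s_gen = mat2 b (- a) d (- c)" by (simp add: g s_gen_mat2)
  moreover have "theta_exp (mat2 b (- a) d (- c)) = theta_exp (mat2 a b c d) - 24 * (c * d)"
    using par e3 unfolding theta_exp_mat2 by (auto simp: algebra_simps)
  ultimately show ?thesis by (simp add: g cong_iff_dvd_diff)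
qed

lemma theta_exp_t2:
  assumes "g \<in> carrier Gamma_theta"
  shows "[theta_exp (g * t2_gen) = theta_exp g + 1] (mod 24)"
proof -
  obtain a b c d where g: "g = mat2 a b c d" and det: "a * d - b * c = 1" and
    par: "theta_parity a b c d"
    using Gamma_theta_parity[OF assms] by blast
  define e8 where "e8 = (\<lambda>a b c d::int. if even b then (a * b - c * d) div 2 + b * c else (c * d - a * b) div 2 - a * d)"
  define e3 where "e3 = (\<lambda>a b c d::int. b * d * (1 - c\<^sup>2) + c * (a + d))"
  have E: "theta_exp (mat2 a b c d) = 9 * e8 a b c d + 8 * e3 a b c d" for a b c d
    by (simp add: theta_exp_mat2 e8_def e3_def)
  have gt: "g * t2_gen = mat2 a (2 * a + b) c (2 * c + d)" by (simp add: g t2_gen_mat2 algebra_simps)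
  \<comment> \<open>This is the increment of the component modulo 8, where u is the odd and v, up to
    sign, the even entry of the first column. It is 1 modulo 8 because x (x + 1) and y (1 - y) are
    even.\<close>
  have sq: "[u\<^sup>2 - v\<^sup>2 + 2 * u * v = 1] (mod 8)" if "odd u" "even v" for u v :: int
  proof -
    obtain x y where uv: "u = 2 * x + 1" "v = 2 * y" using \<open>odd u\<close> \<open>even v\<close> by (auto elim!: oddE evenE)
    have "u\<^sup>2 - v\<^sup>2 + 2 * u * v - 1 = 4 * (x * (x + 1)) + 4 * (y * (1 - y)) + 8 * (x * y)"
      by (simp add: uv power2_eq_square algebra_simps)
    moreover have e: "even (x * (x + 1))" "even (y * (1 - y))" by auto
    have "4 * 2 dvd 4 * (x * (x + 1))" "4 * 2 dvd 4 * (y * (1 - y))"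
      using mult_dvd_mono[OF dvd_refl e(1), of 4] mult_dvd_mono[OF dvd_refl e(2), of 4] .
    then have "8 dvd 4 * (x * (x + 1))" "8 dvd 4 * (y * (1 - y))" by simp_all
    ultimately show ?thesis unfolding cong_iff_dvd_diff by (simp only: dvd_add dvd_triv_left)
  qed
  have "[e8 a (2 * a + b) c (2 * c + d) = e8 a b c d + 1] (mod 8)"
  proof (cases "even b")
    case True
    then have par: "even c" "odd a" "odd d" using par by auto
    have "a * (2 * a + b) - c * (2 * c + d) = (a * b - c * d) + 2 * (a\<^sup>2 - c\<^sup>2)"
      by (simp add: algebra_simps power2_eq_square)
    then have "(a * (2 * a + b) - c * (2 * c + d)) div 2 = (a * b - c * d) div 2 + (a\<^sup>2 - c\<^sup>2)"
      by simp
    then have "e8 a (2 * a + b) c (2 * c + d) = e8 a b c d + (a\<^sup>2 - c\<^sup>2 + 2 * a * c)"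
      using True by (simp add: e8_def algebra_simps)
    then show ?thesis using cong_add[OF cong_refl sq[OF par(2,1)], of "e8 a b c d"] by simp
  next
    case False
    then have par: "odd c" "even a" "even d" using par by auto
    have "c * (2 * c + d) - a * (2 * a + b) = (c * d - a * b) + 2 * (c\<^sup>2 - a\<^sup>2)"
      by (simp add: algebra_simps power2_eq_square)
    then have "(c * (2 * c + d) - a * (2 * a + b)) div 2 = (c * d - a * b) div 2 + (c\<^sup>2 - a\<^sup>2)"
      by simp
    then have "e8 a (2 * a + b) c (2 * c + d) = e8 a b c d + (c\<^sup>2 - (- a)\<^sup>2 + 2 * c * (- a))"
      using False by (simp add: e8_def algebra_simps)
    then show ?thesis using cong_add[OF cong_refl sq[of c "- a"], of "e8 a b c d"] par by simp
  qed
  moreover have "[e3 a (2 * a + b) c (2 * c + d) = e3 a b c d - 1] (mod 3)"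
  proof -
    have "e3 a (2 * a + b) c (2 * c + d) - e3 a b c d + 1 =
        3 + 4 * (a + b) * (c * (1 - c\<^sup>2)) + 2 * (a * d - b * c - 1) * (1 - c\<^sup>2)"
      by (simp add: e3_def algebra_simps power2_eq_square)
    moreover have "3 dvd c * (1 - c\<^sup>2)"
    proof -
      have "[c = 0] (mod 3) \<or> [c = 1] (mod 3) \<or> [c = -1] (mod 3)"
        by (simp add: cong_def) presburger
      then have "[c * (1 - c\<^sup>2) = 0 * (1 - 0\<^sup>2)] (mod 3) \<or> [c * (1 - c\<^sup>2) = 1 * (1 - 1\<^sup>2)] (mod 3) \<or>
          [c * (1 - c\<^sup>2) = (-1) * (1 - (-1)\<^sup>2)] (mod 3)"
        by (meson cong_mult cong_diff cong_pow cong_refl)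
      then show ?thesis by (auto simp: cong_0_iff)
    qed
    ultimately have "3 dvd e3 a (2 * a + b) c (2 * c + d) - e3 a b c d + 1"
      using det by (simp only: diff_self mult_zero_right mult_zero_left add_0_right dvd_add dvd_refl dvd_mult)
    then show ?thesis by (simp add: cong_iff_dvd_diff algebra_simps)
  qed
  moreover have "theta_exp (g * t2_gen) = 9 * e8 a (2 * a + b) c (2 * c + d) + 8 * e3 a (2 * a + b) c (2 * c + d)"
    "theta_exp g = 9 * e8 a b c d + 8 * e3 a b c d"
    unfolding gt unfolding g by (rule E)+
  ultimately show ?thesis using cong_24_combine by metis
qed

lemma theta_exp_one [simp]: "theta_exp (mat2 1 0 0 1) = 0"
  by (simp add: theta_exp_mat2)

text \<open>The modulus is 48 rather than 24 in order to survive the halving of ab - cd in the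
  component modulo 8.\<close>

lemma theta_exp_Gamma:
  assumes "g \<in> Gamma 48"
  shows "[theta_exp g = 0] (mod 24)"
proof -
  obtain a b c d where g: "g = mat2 a b c d" "[b = 0] (mod 48)" "[c = 0] (mod 48)"
    using assms by (auto elim!: Gamma_cases)
  then obtain x y where xy: "b = 48 * x" "c = 48 * y" by (auto simp: cong_0_iff elim!: dvdE)
  have "a * (48 * x) - 48 * y * d = 2 * (24 * (a * x - y * d))" by (simp add: algebra_simps)
  then have "(a * (48 * x) - 48 * y * d) div 2 = 24 * (a * x - y * d)" by simp
  then show ?thesis
    unfolding g(1) theta_exp_mat2 xy cong_0_iff by (simp add: algebra_simps)
qed

lemma power_int_cong:
  fixes x :: complex
  assumes "x ^ m = 1" "m > 0" "[k = l] (mod int m)"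
  shows "x powi k = x powi l"
proof -
  have x: "x \<noteq> 0" using assms(1,2) by (auto simp: power_0_left)
  obtain j where "k - l = int m * j" using assms(3) by (auto simp: cong_iff_dvd_diff)
  then have k: "k = l + int m * j" by simp
  have "x powi (int m * j) = 1" using assms(1) by (simp add: power_int_mult)
  then show ?thesis using x by (simp add: k power_int_add)
qed

lemma power2_odd_decomposition:
  fixes m :: nat
  assumes "m > 0"
  shows "\<exists>k j. m = 2 ^ k * j \<and> odd j"
  using assms
proof (induction m rule: less_induct)
  case (less m)
  show ?case
  proof (cases "even m")
    case True
    then obtain l where l: "m = 2 * l" by blast
    then obtain k j where "l = 2 ^ k * j" "odd j" using less.IH[of l] less.prems by auto
    then show ?thesis using l by (intro exI[of _ "Suc k"] exI[of _ j]) simp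
  qed (auto intro: exI[of _ 0])
qed

context theta_rep
begin

lemma twist:
  assumes x: "x ^ 24 = 1"
  shows "theta_rep n S (x \<cdot>\<^sub>m T2) (\<lambda>g. x powi theta_exp g \<cdot>\<^sub>m F g)"
proof
  have x0: "x \<noteq> 0" using x by auto
  fix g
  show "x powi theta_exp g \<cdot>\<^sub>m F g \<in> carrier_mat n n" using F_carrier by simp
  assume g: "g \<in> carrier Gamma_theta"
  show "x powi theta_exp (g * s_gen) \<cdot>\<^sub>m F (g * s_gen) = (x powi theta_exp g \<cdot>\<^sub>m F g) * S"
    using power_int_cong[OF x _ , of "theta_exp (g * s_gen)" "theta_exp g"] theta_exp_s[OF g]
      F_mult_s[OF g] F_carrier S by (simp add: mult_smult_assoc_mat[of _ n n _ n])
  have "x powi theta_exp (g * t2_gen) = x powi theta_exp g * x"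
    using power_int_cong[OF x _ , of "theta_exp (g * t2_gen)" "theta_exp g + 1"] theta_exp_t2[OF g] x0
    by (simp add: power_int_add)
  then show "x powi theta_exp (g * t2_gen) \<cdot>\<^sub>m F (g * t2_gen) = (x powi theta_exp g \<cdot>\<^sub>m F g) * (x \<cdot>\<^sub>m T2)"
    using F_mult_t2[OF g] F_carrier T2
    by (simp add: mult_smult_assoc_mat[of _ n n _ n] mult_smult_distrib[of _ n n _ n] smult_smult_mat mult.commute)
qed (use n S T2 F_one in auto)

text \<open>Proportionality holds on s and t^2 and passes to products and inverses. The scalar y
  remains unknown, but it cancels when the images of a conjugation are compared.\<close>

lemma proportional:
  assumes \<rho>: "theta_rep n S (x \<cdot>\<^sub>m T2) \<rho>" and "x \<noteq> 0" and g: "g \<in> carrier Gamma_theta"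
  shows "\<exists>y. y \<noteq> 0 \<and> \<rho> g = y \<cdot>\<^sub>m F g"
proof -
  interpret \<rho>: theta_rep n S "x \<cdot>\<^sub>m T2" \<rho> by (rule \<rho>)
  have inv_prop: "\<exists>y. y \<noteq> 0 \<and> \<rho> (inv\<^bsub>SL2Z\<^esub> h) = y \<cdot>\<^sub>m F (inv\<^bsub>SL2Z\<^esub> h)"
    if h: "h \<in> carrier Gamma_theta" and y: "y \<noteq> 0" "\<rho> h = y \<cdot>\<^sub>m F h" for h y
  proof -
    have "F (inv\<^bsub>Gamma_theta\<^esub> h) * F h = 1\<^sub>m n"
      using F_mult[OF h \<Gamma>.inv_closed[OF h]] \<Gamma>.l_inv[OF h] F_one by (metis Gamma_theta_sel)
    then have "(inverse y \<cdot>\<^sub>m F (inv\<^bsub>Gamma_theta\<^esub> h)) * \<rho> h = 1\<^sub>m n"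
      using F_carrier y
      by (simp add: mult_smult_assoc_mat[of _ n n _ n] mult_smult_distrib[of _ n n _ n] smult_smult_mat)
    then have "inv\<^bsub>GL n\<^esub> (\<rho> h) = inverse y \<cdot>\<^sub>m F (inv\<^bsub>Gamma_theta\<^esub> h)"
      using y by (intro GL.inv_equality \<rho>.F_GL[OF h] smult_in_GL F_GL \<Gamma>.inv_closed h) simp_all
    then have "\<rho> (inv\<^bsub>Gamma_theta\<^esub> h) = inverse y \<cdot>\<^sub>m F (inv\<^bsub>Gamma_theta\<^esub> h)"
      using \<rho>.F.hom_inv[OF h] by simp
    then show ?thesis using y(1) by (intro exI[of _ "inverse y"]) (simp add: inv_Gamma_theta[OF h])
  qed
  have gen: "\<exists>y. y \<noteq> 0 \<and> \<rho> h = y \<cdot>\<^sub>m F h" if "h \<in> {s_gen, t2_gen}" for h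
  proof -
    have "\<rho> s_gen = 1 \<cdot>\<^sub>m F s_gen" "\<rho> t2_gen = x \<cdot>\<^sub>m F t2_gen"
      by (simp_all only: F_s F_t2 \<rho>.F_s \<rho>.F_t2 one_smult_mat)
    then show ?thesis using that assms(2) by (metis insertE one_neq_zero singletonD)
  qed
  from g have "g \<in> generate SL2Z {s_gen, t2_gen}" by (simp add: carrier_Gamma_theta_eq)
  then show ?thesis
  proof (induction rule: generate.induct)
    case one
    have "\<rho> \<one>\<^bsub>SL2Z\<^esub> = 1 \<cdot>\<^sub>m F \<one>\<^bsub>SL2Z\<^esub>"
      by (simp only: SL2Z_sel F_one \<rho>.F_one one_smult_mat)
    then show ?case by (metis one_neq_zero)
  next
    case (incl h)
    then show ?case by (rule gen)
  next
    case (inv h)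
    then have "h \<in> carrier Gamma_theta" by auto
    then show ?case using gen[OF inv] inv_prop by metis
  next
    case (eng h1 h2)
    then obtain y1 y2 where y: "y1 \<noteq> 0" "\<rho> h1 = y1 \<cdot>\<^sub>m F h1" "y2 \<noteq> 0" "\<rho> h2 = y2 \<cdot>\<^sub>m F h2"
      by blast
    have h: "h1 \<in> carrier Gamma_theta" "h2 \<in> carrier Gamma_theta"
      using eng.hyps by (simp_all add: carrier_Gamma_theta_eq)
    have "\<rho> (h1 * h2) = (y2 * y1) \<cdot>\<^sub>m F (h1 * h2)"
      unfolding \<rho>.F_mult[OF h(2,1)] F_mult[OF h(2,1)] y using F_carrier
      by (simp add: mult_smult_assoc_mat[of _ n n _ n] mult_smult_distrib[of _ n n _ n] smult_smult_mat)
    then show ?case using y by (intro exI[of _ "y2 * y1"]) simp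
  qed
qed

lemma smult_GL_cancel:
  assumes "A \<in> carrier (GL n)" "x \<cdot>\<^sub>m A = y \<cdot>\<^sub>m A"
  shows "x = y"
proof -
  obtain B where B: "A \<in> carrier_mat n n" "B \<in> carrier_mat n n" "A * B = 1\<^sub>m n"
    using assms(1) by (auto simp: GL_carrier_iff)
  have "(x \<cdot>\<^sub>m A) * B = (y \<cdot>\<^sub>m A) * B" using assms(2) by simp
  then have "x \<cdot>\<^sub>m 1\<^sub>m n = y \<cdot>\<^sub>m (1\<^sub>m n :: complex mat)"
    using B by (simp add: mult_smult_assoc_mat[of _ n n _ n])
  then have "(x \<cdot>\<^sub>m 1\<^sub>m n) $$ (0, 0) = (y \<cdot>\<^sub>m (1\<^sub>m n :: complex mat)) $$ (0, 0)" by simp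
  then show ?thesis using n by simp
qed

lemma smult_pow_mat: "(x \<cdot>\<^sub>m T2) ^\<^sub>m k = (x ^ k) \<cdot>\<^sub>m (T2 ^\<^sub>m k)"
proof (induction k)
  case 0
  then show ?case using T2 by simp
next
  case (Suc k)
  then show ?case
    using T2 pow_carrier_mat[OF T2, of k]
    by (simp add: mult_smult_assoc_mat[of _ n n _ n] mult_smult_distrib[of _ n n _ n] smult_smult_mat mult.commute)
qed

(* Modulo Gamma M, conjugation by diag(a, 1/a) maps t^2 to its a^2-th power; as both
   representations are trivial on Gamma M, this forces x ^ (a^2) = x. *)
lemma twist_root_of_unity:
  assumes \<rho>: "theta_rep n S (x \<cdot>\<^sub>m T2) \<rho>" and x: "x \<noteq> 0"
    and M: "M > 0" "even M" "Gamma M \<subseteq> kernel Gamma_theta (GL n) F" "Gamma M \<subseteq> kernel Gamma_theta (GL n) \<rho>"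
  shows "x ^ 24 = 1"
proof -
  interpret \<rho>: theta_rep n S "x \<cdot>\<^sub>m T2" \<rho> by (rule \<rho>)
  have xM: "x ^ M = 1"
  proof -
    have "(x ^ (M div 2)) \<cdot>\<^sub>m 1\<^sub>m n = 1\<^sub>m n"
      using \<rho>.Gamma_in_kernelD(2)[OF M(4)] Gamma_in_kernelD(2)[OF M(3)] by (simp add: smult_pow_mat)
    then have "x ^ (M div 2) = 1"
      using smult_GL_cancel[OF GL_one_carrier, of "x ^ (M div 2)" 1] by simp
    moreover have "x ^ M = (x ^ (M div 2))\<^sup>2"
      using M(2) by (simp add: power_mult[symmetric])
    ultimately show ?thesis by simp
  qed
  have key: "x ^ (a\<^sup>2) = x" if "coprime a M" for a :: nat
  proof -
    define A where "A = int a"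
    \<comment> \<open>A Bezout identity with M^2 instead of M leaves a factor M for each
      off-diagonal entry of D, so that D is diagonal modulo M.\<close>
    have "coprime A ((int M)\<^sup>2)" using that by (simp add: A_def)
    then obtain b k where bk: "A * b + (int M)\<^sup>2 * k = 1"
      by (metis bezout_int coprime_imp_gcd_eq_1 mult.commute)
    define D where "D = mat2 A (- int M * k) (int M) b"
    \<comment> \<open>N is D t^2 D^(-1) t^(-2 a^2) multiplied out. Its off-diagonal entries and the
      differences of its diagonal entries from 1 all carry a factor M.\<close>
    define N where "N = mat2 (1 - 2 * A * int M) (4 * A ^ 3 * int M) (- 2 * (int M)\<^sup>2)
      (1 + 2 * A * int M + 4 * A\<^sup>2 * (int M)\<^sup>2)"
    have "odd A" using that M(2) by (auto simp: A_def)
    moreover have det: "A * b + int M * (int M * k) = 1" using bk by (simp add: power2_eq_square algebra_simps)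
    moreover have "odd b"
    proof
      assume "even b"
      then have "even (A * b + int M * (int M * k))" using M(2) by simp
      then show False using det by simp
    qed
    ultimately have D: "D \<in> carrier Gamma_theta"
      using M(2) unfolding D_def by (intro Gamma_thetaI) (simp_all add: algebra_simps)
    have N: "N \<in> Gamma M"
      unfolding N_def mat2_in_Gamma
      by (auto simp: cong_iff_dvd_diff power2_eq_square power3_eq_cube algebra_simps)
    then have NG: "N \<in> carrier Gamma_theta" "F N = 1\<^sub>m n" "\<rho> N = 1\<^sub>m n"
      using M(3,4) by (auto simp: F_kernel \<rho>.F_kernel)
    define U where "U = mat2 1 (2 * int (a\<^sup>2)) 0 1"
    have U: "U \<in> carrier Gamma_theta" unfolding U_def by (rule t2_power_in)
    have UD: "U * D \<in> carrier Gamma_theta" using \<Gamma>.m_closed[OF U D] by simp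
    have e1: "(1 - 2 * A * int M) * (- int M * k + 2 * A\<^sup>2 * b) + 4 * A ^ 3 * int M * b =
        - int M * k + 2 * A * (A * b + int M * (int M * k))"
      by (simp add: power2_eq_square power3_eq_cube algebra_simps)
    have e2: "- 2 * (int M)\<^sup>2 * (- int M * k + 2 * A\<^sup>2 * b) + (1 + 2 * A * int M + 4 * A\<^sup>2 * (int M)\<^sup>2) * b =
        b + 2 * int M * (A * b + int M * (int M * k))"
      by (simp add: power2_eq_square power3_eq_cube algebra_simps)
    have U_D: "U * D = mat2 (A + 2 * A\<^sup>2 * int M) (- int M * k + 2 * A\<^sup>2 * b) (int M) b"
      by (simp add: U_def D_def A_def)
    have eq: "D * t2_gen = N * (U * D)"
      unfolding U_D N_def mat2_mult e1 e2 det
      by (simp add: D_def t2_gen_mat2 power2_eq_square power3_eq_cube algebra_simps)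
    obtain y where y: "y \<noteq> 0" "\<rho> D = y \<cdot>\<^sub>m F D" using proportional[OF \<rho> x D] by blast
    have F_eq: "F D * T2 = T2 ^\<^sub>m (a\<^sup>2) * F D"
    proof -
      have "F D * T2 = F N * (F U * F D)"
        using F_mult_t2[OF D] F_mult[OF UD NG(1)] F_mult[OF D U] by (simp add: eq)
      then show ?thesis using F_t2_power[of "a\<^sup>2"] NG(2)
          left_mult_one_mat[OF mult_carrier_mat[OF pow_carrier_mat[OF T2, of "a\<^sup>2"] F_carrier[of D]]]
        by (simp add: U_def)
    qed
    have "\<rho> D * (x \<cdot>\<^sub>m T2) = \<rho> N * (\<rho> U * \<rho> D)"
      using \<rho>.F_mult_t2[OF D] \<rho>.F_mult[OF UD NG(1)] \<rho>.F_mult[OF D U] by (simp add: eq)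
    then have "\<rho> D * (x \<cdot>\<^sub>m T2) = (x \<cdot>\<^sub>m T2) ^\<^sub>m (a\<^sup>2) * \<rho> D"
      using \<rho>.F_t2_power[of "a\<^sup>2"] NG(3)
        left_mult_one_mat[OF mult_carrier_mat[OF pow_carrier_mat[OF \<rho>.T2, of "a\<^sup>2"] \<rho>.F_carrier[of D]]]
      by (simp add: U_def)
    then have "(y * x) \<cdot>\<^sub>m (F D * T2) = (y * x ^ (a\<^sup>2)) \<cdot>\<^sub>m (T2 ^\<^sub>m (a\<^sup>2) * F D)"
      using pow_carrier_mat[OF T2, of "a\<^sup>2"] F_carrier T2 unfolding y smult_pow_mat
      by (simp add: mult_smult_assoc_mat[of _ n n _ n] mult_smult_distrib[of _ n n _ n] smult_smult_mat mult.commute)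
    then have "(y * x) \<cdot>\<^sub>m (F D * T2) = (y * x ^ (a\<^sup>2)) \<cdot>\<^sub>m (F D * T2)" by (simp add: F_eq)
    moreover have "F D * T2 \<in> carrier (GL n)"
      using GL.m_closed[OF F_GL[OF D] T2_GL] by simp
    ultimately have "y * x = y * x ^ (a\<^sup>2)" using smult_GL_cancel by blast
    then show ?thesis using y(1) by simp
  qed
  obtain k o' where ko: "M = 2 ^ k * o'" "odd o'"
    using power2_odd_decomposition[OF M(1)] by blast
  have k: "k > 0" using ko M(2) by (cases k) auto
  have co: "coprime (2 ^ k) o'" using ko(2) by simp
  \<comment> \<open>Then a^2 - 1 is 8 modulo the 2-part of M and 3 modulo its odd part, and 8 times
    3 is the 24 of the claim.\<close>
  from binary_chinese_remainder_nat[OF co] obtain a where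
    a: "[a = 3] (mod 2 ^ k)" "[a = 2] (mod o')" by blast
  have "coprime a (2 ^ k)" using a(1) by (metis cong_imp_coprime cong_sym coprime_power_right_iff odd_numeral coprime_right_2_iff_odd)
  moreover have "coprime a o'" using a(2) ko(2) by (metis cong_imp_coprime cong_sym coprime_left_2_iff_odd)
  ultimately have "coprime a M" by (simp add: ko)
  then have xa: "x ^ (a\<^sup>2) = x" by (rule key)
  define B where "B = (int a)\<^sup>2 - 1"
  have "x powi (int (a\<^sup>2)) = x powi 1" using xa by (simp only: power_int_of_nat power_int_1_right)
  then have xB: "x powi B = 1" using x by (simp add: B_def power_int_diff)
  have "[(int a)\<^sup>2 = 3\<^sup>2] (mod int (2 ^ k))" "[(int a)\<^sup>2 = 2\<^sup>2] (mod int o')"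
    using a unfolding cong_int_iff[symmetric] by (metis cong_pow of_nat_numeral)+
  then have "int (2 ^ k) dvd B - 8" "int o' dvd B - 3"
    by (simp_all add: cong_iff_dvd_diff B_def)
  then have "int M dvd (B - 8) * (B - 3)" using mult_dvd_mono unfolding ko(1) of_nat_mult by blast
  then obtain j where "(B - 8) * (B - 3) = int M * j" by blast
  \<comment> \<open>(B - 8)(B - 3) + B (11 - B) = 24 holds for every B, so 24 lies in the ideal of
    exponents killing x, which contains M and B.\<close>
  then have "24 = int M * j + B * (11 - B)" by (simp add: algebra_simps)
  moreover have "x powi (int M * j + B * (11 - B)) = 1"
    using x xM xB by (simp add: power_int_add power_int_mult)
  ultimately have "x powi 24 = 1" by simp
  then show ?thesis by simp
qed

text \<open>A lift is constrained on Gamma_theta only, whereas \<open>theta_rep\<close> asks for an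
  n x n matrix at every argument; the identity serves as a default value off the group.\<close>

lemma theta_rep_of_linear_lift:
  assumes "linear_lift n S T2 c \<rho>"
  defines "x \<equiv> exp (- 2 * of_real pi * \<i> * of_real c / 12)"
  shows "theta_rep n S (x \<cdot>\<^sub>m T2) (\<lambda>g. if g \<in> carrier Gamma_theta then \<rho> g else 1\<^sub>m n)"
proof -
  have hom: "\<rho> \<in> hom Gamma_theta (GL n)" and gens: "\<rho> s_gen = S" "\<rho> t2_gen = x \<cdot>\<^sub>m T2"
    using assms by (simp_all add: linear_lift_def congruence_hom_def)
  interpret \<rho>: group_hom Gamma_theta "GL n" \<rho> by unfold_locales (rule hom)
  show ?thesis
  proof
    fix g
    show "(if g \<in> carrier Gamma_theta then \<rho> g else 1\<^sub>m n) \<in> carrier_mat n n"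
      using \<rho>.hom_closed[of g] by (auto simp: GL_carrier_iff)
    assume g: "g \<in> carrier Gamma_theta"
    show "(if g * s_gen \<in> carrier Gamma_theta then \<rho> (g * s_gen) else 1\<^sub>m n) =
        (if g \<in> carrier Gamma_theta then \<rho> g else 1\<^sub>m n) * S"
      using \<rho>.hom_mult[OF g s_gen_in] \<Gamma>.m_closed[OF g s_gen_in] g by (simp add: gens)
    show "(if g * t2_gen \<in> carrier Gamma_theta then \<rho> (g * t2_gen) else 1\<^sub>m n) =
        (if g \<in> carrier Gamma_theta then \<rho> g else 1\<^sub>m n) * (x \<cdot>\<^sub>m T2)"
      using \<rho>.hom_mult[OF g t2_gen_in] \<Gamma>.m_closed[OF g t2_gen_in] g by (simp add: gens)
  qed (use n S T2 \<rho>.hom_one in auto)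
qed

lemma Gamma_mono: "m dvd m' \<Longrightarrow> Gamma m' \<subseteq> Gamma m"
  using cong_dvd_modulus[of _ _ "int m'" "int m"] unfolding Gamma_def cong_def[symmetric] by auto

text \<open>The scalar x in front of T2 satisfies x^24 = exp(-4 pi i c), which is 1 exactly if 2c is
  an integer. If it is 1, the twist by the character of \<open>theta_exp\<close> is the required
  lift; conversely a lift and F are compared modulo a common level.\<close>

theorem central_charge_iff:
  assumes "congruence_hom (GL n) F"
  shows "central_charge n S T2 c \<longleftrightarrow> (\<exists>m::int. c = of_int m / 2)"
proof
  obtain m1 where m1: "m1 > 0" "Gamma m1 \<subseteq> kernel Gamma_theta (GL n) F"
    using assms by (auto simp: congruence_hom_def)
  define x where "x = exp (- 2 * of_real pi * \<i> * of_real c / 12)"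
  have "x = cis (- (pi * c / 6))" by (simp add: x_def cis_conv_exp algebra_simps)
  then have x24: "x ^ 24 = cis (- (4 * pi * c))" by (simp add: DeMoivre mult.assoc)
  {
    assume "central_charge n S T2 c"
    then obtain \<rho> where \<rho>: "linear_lift n S T2 c \<rho>" by (auto simp: central_charge_def)
    then obtain m2 where m2: "m2 > 0" "Gamma m2 \<subseteq> kernel Gamma_theta (GL n) \<rho>"
      by (auto simp: linear_lift_def congruence_hom_def)
    have "x ^ 24 = 1"
    proof (rule twist_root_of_unity)
      show "theta_rep n S (x \<cdot>\<^sub>m T2) (\<lambda>g. if g \<in> carrier Gamma_theta then \<rho> g else 1\<^sub>m n)"
        unfolding x_def by (rule theta_rep_of_linear_lift[OF \<rho>])
      \<comment> \<open>An even modulus for which both representations are trivial on the congruence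
        subgroup.\<close>
      show "2 * (m1 * m2) > 0" "even (2 * (m1 * m2))" "x \<noteq> 0" using m1 m2 by (auto simp: x_def)
      show "Gamma (2 * (m1 * m2)) \<subseteq> kernel Gamma_theta (GL n) F"
        using Gamma_mono[of m1 "2 * (m1 * m2)"] m1 by auto
      show "Gamma (2 * (m1 * m2)) \<subseteq>
          kernel Gamma_theta (GL n) (\<lambda>g. if g \<in> carrier Gamma_theta then \<rho> g else 1\<^sub>m n)"
        using Gamma_mono[of m2 "2 * (m1 * m2)"] m2 by (auto simp: kernel_def)
    qed
    then have "Re (cis (- (4 * pi * c))) = Re 1" unfolding x24 by (rule arg_cong)
    then have "cos (4 * pi * c) = 1" by simp
    then obtain m :: int where "4 * pi * c = of_int m * 2 * pi"
      unfolding cos_one_2pi_int by blast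
    then have "c = of_int m / 2" by simp
    then show "\<exists>m::int. c = of_int m / 2" by blast
  }
  assume "\<exists>m::int. c = of_int m / 2"
  then obtain m :: int where c: "c = of_int m / 2" by blast
  have "cis (- (4 * pi * c)) = cis (2 * pi * of_int (- m))" by (simp add: c mult.assoc)
  also have "\<dots> = 1" by (rule cis_multiple_2pi) simp
  finally have x: "x ^ 24 = 1" using x24 by simp
  interpret \<rho>: theta_rep n S "x \<cdot>\<^sub>m T2" "\<lambda>g. x powi theta_exp g \<cdot>\<^sub>m F g"
    by (rule twist[OF x])
  have "Gamma (48 * m1) \<subseteq> kernel Gamma_theta (GL n) (\<lambda>g. x powi theta_exp g \<cdot>\<^sub>m F g)"
  proof (rule \<rho>.Gamma_sub_kernel)
    fix g assume g: "g \<in> Gamma (48 * m1)"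
    then have "g \<in> Gamma 48" "g \<in> Gamma m1"
      using Gamma_mono[of 48 "48 * m1"] Gamma_mono[of m1 "48 * m1"] by auto
    then show "x powi theta_exp g \<cdot>\<^sub>m F g = 1\<^sub>m n"
      using power_int_cong[OF x, of "theta_exp g" 0] theta_exp_Gamma[of g] m1 by (auto simp: F_kernel)
  qed simp
  then have "congruence_hom (GL n) (\<lambda>g. x powi theta_exp g \<cdot>\<^sub>m F g)"
    unfolding congruence_hom_def using \<rho>.F_hom m1(1) by (intro conjI exI[of _ "48 * m1"]) auto
  then show "central_charge n S T2 c"
    unfolding central_charge_def linear_lift_def using \<rho>.F_s \<rho>.F_t2 by (auto simp: x_def)
qed

end

subsection \<open>Quadratic characters and Weil representations\<close>

lemmas expand_simps = algebra_simps add_divide_distrib diff_divide_distrib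

(* Quadratic characters, only meaningful at arguments coprime to the modulus. *)
definition jac3 :: "int \<Rightarrow> complex" where "jac3 x = (if x mod 3 = 1 then 1 else - 1)"
definition jac4 :: "int \<Rightarrow> complex" where "jac4 x = (if x mod 4 = 1 then 1 else - 1)"
definition jac5 :: "int \<Rightarrow> complex" where "jac5 x = (if x mod 5 \<in> {1, 4} then 1 else - 1)"
definition jac8 :: "int \<Rightarrow> complex" where "jac8 x = (if x mod 8 \<in> {1, 7} then 1 else - 1)"

lemma mod_cases:
  fixes x :: int
  shows "x mod 3 \<in> {0, 1, 2}" "x mod 4 \<in> {0, 1, 2, 3}" "x mod 5 \<in> {0, 1, 2, 3, 4}"
    "x mod 8 \<in> {0, 1, 2, 3, 4, 5, 6, 7}"
  by (simp_all, presburger+)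

lemma even_cong:
  "[x = y] (mod 4) \<Longrightarrow> even x \<longleftrightarrow> even (y::int)" "[x = y] (mod 8) \<Longrightarrow> even x \<longleftrightarrow> even (y::int)"
  by (meson cong_dvd_iff cong_dvd_modulus dvd_def even_numeral)+

(* The functions theta_char, weil3, weil5 and dih of the bottom row (c, d) of a group element are the
   coordinates of orbit vectors in representations of levels 4, 3, 5 and 8 and dimensions 1, 2, 3
   and 2, up to signs which cancel in the products used for the two sets of data. *)
definition theta_char :: "complex \<Rightarrow> int \<Rightarrow> int \<Rightarrow> complex" where
  "theta_char j c d = (if even c then jac4 d else j * jac4 c)"

lemma theta_char_cong:
  assumes "[c = c'] (mod 4)" "[d = d'] (mod 4)"
  shows "theta_char j c d = theta_char j c' d'"
  using assms even_cong(1)[OF assms(1)] by (simp add: theta_char_def jac4_def cong_def)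

lemma theta_char_s:
  assumes "j * j = -1" "odd (c + d)"
  shows "theta_char j d (- c) = j * theta_char j c d"
proof -
  define c' d' where c': "c' = c mod 4" and d': "d' = d mod 4"
  have eqs: "theta_char j d (- c) = theta_char j d' (- c')" "theta_char j c d = theta_char j c' d'"
    by (rule theta_char_cong; simp add: cong_def c' d' mod_minus_eq)+
  have "odd (c' + d')" using assms(2) by (simp add: c' d' even_add dvd_mod_iff)
  moreover have "c' \<in> {0, 1, 2, 3}" "d' \<in> {0, 1, 2, 3}" unfolding c' d' by (rule mod_cases)+
  ultimately show ?thesis
    unfolding eqs by (elim insertE emptyE) (simp_all add: theta_char_def jac4_def assms(1) flip: mult.assoc)
qed

lemma theta_char_t2:
  assumes "odd (c + d)"
  shows "theta_char j c (2 * c + d) = theta_char j c d"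
proof (cases "even c")
  case True
  then obtain k where "c = 2 * k" by blast
  then have "(2 * c + d) mod 4 = (4 * k + d) mod 4" by simp
  also have "\<dots> = d mod 4" by simp
  finally show ?thesis using True by (simp add: theta_char_def jac4_def)
qed (simp add: theta_char_def)

section \<open>Level 3: the even part of the Weil representation on functions on Z/3\<close>

definition weil3 :: "complex \<Rightarrow> int \<Rightarrow> int \<Rightarrow> complex" where
  "weil3 w c d = (if 3 dvd c then jac3 d else jac3 c * (1 + 2 * w) / 3)"

text \<open>The exponent is d/(2c) modulo 3, where 1/2 = -1 and 1/c = c; it rises by one when d
  becomes d + 2c. \<open>weil3\<close> and \<open>weil3'\<close> are the values at 0 and at the pair
  1, -1 of Z/3.\<close>

definition weil3' :: "complex \<Rightarrow> int \<Rightarrow> int \<Rightarrow> complex" where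
  "weil3' w c d = (if 3 dvd c then 0 else weil3 w c d * w ^ nat ((- (c * d)) mod 3))"

lemma weil3_cong:
  assumes "[c = c'] (mod 3)" "[d = d'] (mod 3)"
  shows "weil3 w c d = weil3 w c' d'" "weil3' w c d = weil3' w c' d'"
proof -
  show *: "weil3 w c d = weil3 w c' d'"
    using assms cong_dvd_iff[OF assms(1)] by (simp add: weil3_def jac3_def cong_def)
  have "[- (c * d) = - (c' * d')] (mod 3)"
    unfolding cong_minus_minus_iff by (rule cong_mult[OF assms])
  then show "weil3' w c d = weil3' w c' d'"
    using cong_dvd_iff[OF assms(1)] * by (simp add: weil3'_def cong_def)
qed

text \<open>Both sides depend on c and d modulo 3 only, which leaves eight pairs of residues. For
  each of them the claim is an identity modulo w^2 = -1 - w, so either primitive cube root is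
  allowed.\<close>

lemma weil3_s:
  assumes w: "w * w = - 1 - w" and cd: "\<not> (3 dvd c \<and> 3 dvd d)"
  shows "weil3 w d (- c) = (1 + 2 * w) / 3 * (weil3 w c d + 2 * weil3' w c d)"
    "weil3' w d (- c) = (1 + 2 * w) / 3 * (weil3 w c d - weil3' w c d)"
proof -
  have w': "w * (w * x) = - x - w * x" for x
    unfolding mult.assoc[symmetric] w by (simp add: algebra_simps)
  define c' d' where c': "c' = c mod 3" and d': "d' = d mod 3"
  have eqs: "weil3 w d (- c) = weil3 w d' (- c')" "weil3 w c d = weil3 w c' d'"
    "weil3' w d (- c) = weil3' w d' (- c')" "weil3' w c d = weil3' w c' d'"
    by (rule weil3_cong; simp add: cong_def c' d' mod_minus_eq)+
  have *: "\<not> (c' = 0 \<and> d' = 0)" using cd by (simp add: c' d' mod_eq_0_iff_dvd)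
  have r: "c' \<in> {0, 1, 2}" "d' \<in> {0, 1, 2}" unfolding c' d' by (rule mod_cases)+
  show "weil3 w d (- c) = (1 + 2 * w) / 3 * (weil3 w c d + 2 * weil3' w c d)"
    unfolding eqs using r * by (elim insertE emptyE) (simp_all add: weil3_def weil3'_def jac3_def w w' power2_eq_square expand_simps)
  show "weil3' w d (- c) = (1 + 2 * w) / 3 * (weil3 w c d - weil3' w c d)"
    unfolding eqs using r * by (elim insertE emptyE) (simp_all add: weil3_def weil3'_def jac3_def w w' power2_eq_square expand_simps)
qed

lemma weil3_t2:
  assumes w: "w * w = - 1 - w"
  shows "weil3 w c (2 * c + d) = weil3 w c d" "weil3' w c (2 * c + d) = w * weil3' w c d"
proof -
  have w': "w * (w * x) = - x - w * x" for x
    unfolding mult.assoc[symmetric] w by (simp add: algebra_simps)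
  define c' d' where c': "c' = c mod 3" and d': "d' = d mod 3"
  have cc: "[c = c'] (mod 3)" "[d = d'] (mod 3)" by (simp_all add: c' d' cong_def)
  have eqs: "weil3 w c (2 * c + d) = weil3 w c' (2 * c' + d')" "weil3 w c d = weil3 w c' d'"
    "weil3' w c (2 * c + d) = weil3' w c' (2 * c' + d')" "weil3' w c d = weil3' w c' d'"
    by (intro weil3_cong cong_add cong_mult cong_refl cc)+
  have r: "c' \<in> {0, 1, 2}" "d' \<in> {0, 1, 2}" unfolding c' d' by (rule mod_cases)+
  show "weil3 w c (2 * c + d) = weil3 w c d"
    unfolding eqs using r by (elim insertE emptyE) (simp_all add: weil3_def weil3'_def jac3_def)
  show "weil3' w c (2 * c + d) = w * weil3' w c d"
    unfolding eqs using r by (elim insertE emptyE)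
      (simp_all add: weil3_def weil3'_def jac3_def w w' power2_eq_square expand_simps)
qed

section \<open>Level 5: the even part of the Weil representation on functions on Z/5\<close>

definition weil5 :: "complex \<Rightarrow> int \<Rightarrow> int \<Rightarrow> complex" where
  "weil5 q c d = (if 5 dvd c then jac5 d else jac5 c * q)"

text \<open>The exponent is d/(2c) modulo 5, where 1/2 = 3 and 1/c = c^3. The coordinates at the
  pairs 1, -1 and 2, -2 of Z/5 arise from the arguments z and z^4, the exponents 1 and 4 being the
  squares.\<close>

definition weil5' :: "complex \<Rightarrow> complex \<Rightarrow> int \<Rightarrow> int \<Rightarrow> complex" where
  "weil5' q z c d = (if 5 dvd c then 0 else - weil5 q c d * z ^ nat ((3 * c ^ 3 * d) mod 5))"

lemma weil5_cong:
  assumes "[c = c'] (mod 5)" "[d = d'] (mod 5)"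
  shows "weil5 q c d = weil5 q c' d'" "weil5' q z c d = weil5' q z c' d'"
proof -
  show *: "weil5 q c d = weil5 q c' d'"
    using assms cong_dvd_iff[OF assms(1)] by (simp add: weil5_def jac5_def cong_def)
  have "[3 * c ^ 3 * d = 3 * c' ^ 3 * d'] (mod 5)"
    by (intro cong_mult cong_pow assms cong_refl)
  then show "weil5' q z c d = weil5' q z c' d'"
    using cong_dvd_iff[OF assms(1)] * by (simp add: weil5'_def cong_def)
qed

lemma weil5_s:
  assumes z: "z ^ 4 = - 1 - z - z\<^sup>2 - z ^ 3" and q: "q = - (1 + 2 * (z + z ^ 4)) / 5"
    and cd: "\<not> (5 dvd c \<and> 5 dvd d)"
  shows "weil5 q d (- c) = q * weil5 q c d - 2 * q * (weil5' q z c d + weil5' q (z ^ 4) c d)"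
    "weil5' q z d (- c) = - (q * weil5 q c d + (1 + q) / 2 * weil5' q z c d + (q - 1) / 2 * weil5' q (z ^ 4) c d)"
    "weil5' q (z ^ 4) d (- c) = - (q * weil5 q c d + (q - 1) / 2 * weil5' q z c d + (1 + q) / 2 * weil5' q (z ^ 4) c d)"
proof -
  \<comment> \<open>The powers of z become opaque, so that products are reduced by the table below
    instead of being merged into new powers.\<close>
  obtain e1 e2 e3 where e: "e1 = z" "e2 = z\<^sup>2" "e3 = z ^ 3" by blast
  have z4: "z ^ 4 = - 1 - e1 - e2 - e3" by (simp add: z e)
  have "q = - (1 + 2 * (e1 + (- 1 - e1 - e2 - e3))) / 5" by (simp only: q z4 e(1))
  then have q': "q = (1 + 2 * e2 + 2 * e3) / 5" by (simp add: algebra_simps)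
  have t: "e1 * e1 = e2" "e1 * e2 = e3" "e1 * e3 = - 1 - e1 - e2 - e3" "e2 * e2 = - 1 - e1 - e2 - e3"
    "e2 * e3 = 1" "e3 * e3 = e1"
  proof -
    show 1: "e1 * e1 = e2" "e1 * e2 = e3" by (simp_all add: e power2_eq_square power3_eq_cube)
    have "e1 * e3 = z ^ 4" unfolding e by (simp flip: power_Suc)
    then show 2: "e1 * e3 = - 1 - e1 - e2 - e3" by (simp only: z4)
    have "e2 * e2 = e1 * (e1 * e2)" by (simp only: 1[symmetric] mult.assoc)
    then show 3: "e2 * e2 = - 1 - e1 - e2 - e3" by (simp only: 1 2)
    have "e2 * e3 = e1 * (e1 * e3)" by (simp only: 1[symmetric] mult.assoc)
    also have "\<dots> = e1 * (- 1 - e1 - e2 - e3)" by (simp only: 2)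
    also have "\<dots> = - e1 - e1 * e1 - e1 * e2 - e1 * e3" by (simp add: algebra_simps)
    finally show 4: "e2 * e3 = 1" by (simp add: 1 2)
    have "e3 * e3 = e1 * (e2 * e3)" by (simp only: 1(2)[symmetric] mult.assoc)
    then show "e3 * e3 = e1" by (simp add: 4)
  qed
  have t': "e1 * (e1 * x) = e2 * x" "e1 * (e2 * x) = e3 * x" "e1 * (e3 * x) = (- 1 - e1 - e2 - e3) * x"
    "e2 * (e2 * x) = (- 1 - e1 - e2 - e3) * x" "e2 * (e3 * x) = x" "e3 * (e3 * x) = e1 * x" for x
    by (simp_all only: mult.assoc[symmetric] t mult_1)
  define c' d' where c': "c' = c mod 5" and d': "d' = d mod 5"
  have eqs: "weil5 q d (- c) = weil5 q d' (- c')" "weil5 q c d = weil5 q c' d'"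
    "weil5' q y d (- c) = weil5' q y d' (- c')" "weil5' q y c d = weil5' q y c' d'" for y
    by (rule weil5_cong; simp add: cong_def c' d' mod_minus_eq)+
  have *: "\<not> (c' = 0 \<and> d' = 0)" using cd by (simp add: c' d' mod_eq_0_iff_dvd)
  have r: "c' \<in> {0, 1, 2, 3, 4}" "d' \<in> {0, 1, 2, 3, 4}" unfolding c' d' by (rule mod_cases)+
  show "weil5 q d (- c) = q * weil5 q c d - 2 * q * (weil5' q z c d + weil5' q (z ^ 4) c d)"
    unfolding eqs z4 using r *
    by (elim insertE emptyE) (simp_all add: weil5_def weil5'_def jac5_def q' e(1)[symmetric] eval_nat_numeral t t' expand_simps)
  show "weil5' q z d (- c) = - (q * weil5 q c d + (1 + q) / 2 * weil5' q z c d + (q - 1) / 2 * weil5' q (z ^ 4) c d)"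
    unfolding eqs z4 using r *
    by (elim insertE emptyE) (simp_all add: weil5_def weil5'_def jac5_def q' e(1)[symmetric] eval_nat_numeral t t' expand_simps)
  show "weil5' q (z ^ 4) d (- c) = - (q * weil5 q c d + (q - 1) / 2 * weil5' q z c d + (1 + q) / 2 * weil5' q (z ^ 4) c d)"
    unfolding eqs z4 using r *
    by (elim insertE emptyE) (simp_all add: weil5_def weil5'_def jac5_def q' e(1)[symmetric] eval_nat_numeral t t' expand_simps)
qed

lemma power_nat_mod:
  fixes x :: complex
  assumes "x ^ m = 1" "m > 0"
  shows "x ^ nat (k mod int m) = x powi k"
proof -
  have "x ^ nat (k mod int m) = x powi (k mod int m)"
    using assms(2) by (simp flip: power_int_of_nat)
  also have "\<dots> = x powi k" by (rule power_int_cong[OF assms]) simp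
  finally show ?thesis .
qed

lemma weil5'_powi: "z ^ 5 = 1 \<Longrightarrow> weil5' q z c d = (if 5 dvd c then 0 else - weil5 q c d * z powi (3 * c ^ 3 * d))"
  using power_nat_mod[of z 5 "3 * c ^ 3 * d"] by (simp add: weil5'_def)

lemma fourth_power_cong_5: "\<not> 5 dvd c \<Longrightarrow> [c ^ 4 = (1::int)] (mod 5)"
proof -
  assume c: "\<not> 5 dvd c"
  define c' where "c' = c mod 5"
  have "[c ^ 4 = c' ^ 4] (mod 5)" by (intro cong_pow) (simp add: c'_def cong_def)
  moreover have "c' \<in> {0, 1, 2, 3, 4}" unfolding c'_def by (rule mod_cases)
  moreover have "c' \<noteq> 0" using c by (simp add: c'_def mod_eq_0_iff_dvd)
  ultimately show ?thesis by (elim insertE emptyE) (simp_all add: cong_def)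
qed

lemma weil5_t2:
  assumes "z ^ 5 = 1"
  shows "weil5 q c (2 * c + d) = weil5 q c d" "weil5' q z c (2 * c + d) = z * weil5' q z c d"
proof -
  show *: "weil5 q c (2 * c + d) = weil5 q c d"
  proof (cases "5 dvd c")
    case True
    then have "[2 * c + d = 0 + d] (mod 5)" by (intro cong_add cong_refl) (simp add: cong_0_iff)
    then show ?thesis using True by (simp add: weil5_def jac5_def cong_def)
  qed (simp add: weil5_def)
  show "weil5' q z c (2 * c + d) = z * weil5' q z c d"
  proof (cases "5 dvd c")
    case False
    have z: "z \<noteq> 0" using assms by auto
    have "[6 * c ^ 4 + 3 * c ^ 3 * d = 6 * 1 + 3 * c ^ 3 * d] (mod 5)"
      by (intro cong_add cong_mult cong_refl fourth_power_cong_5 False)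
    also have "[6 * 1 + 3 * c ^ 3 * d = 1 + 3 * c ^ 3 * d] (mod 5)"
      by (intro cong_add cong_refl) (simp add: cong_def)
    also have "6 * c ^ 4 + 3 * c ^ 3 * d = 3 * c ^ 3 * (2 * c + d)"
      by (simp add: algebra_simps eval_nat_numeral)
    finally have "[3 * c ^ 3 * (2 * c + d) = 1 + 3 * c ^ 3 * d] (mod 5)" .
    then have "z powi (3 * c ^ 3 * (2 * c + d)) = z powi (1 + 3 * c ^ 3 * d)"
      using power_int_cong[OF assms] by simp
    then show ?thesis using z * by (simp add: weil5'_powi[OF assms] power_int_add)
  qed (simp add: weil5'_def)
qed

section \<open>Level 8: a dihedral representation\<close>

definition dih0 :: "complex \<Rightarrow> int \<Rightarrow> int \<Rightarrow> complex" where
  "dih0 r c d = (if even c then (if 4 dvd c then jac8 d else 0) else jac8 c * r)"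

text \<open>On these coordinates s and t^2 act by r times the Hadamard matrix and by diag(1, -1),
  two reflections generating a dihedral group of order 16. The pair (\<open>dih0\<close>,
  \<open>dih1\<close>) runs through the orbit of (1, 0): signed unit vectors for even c, vectors
  with entries r or -r for odd c.\<close>

definition dih1 :: "complex \<Rightarrow> int \<Rightarrow> int \<Rightarrow> complex" where
  "dih1 r c d = (if even c then (if 4 dvd c then 0 else jac8 d) else jac8 c * r * (if 4 dvd d then 1 else - 1))"

lemma dih_cong:
  assumes "[c = c'] (mod 8)" "[d = d'] (mod 8)"
  shows "dih0 r c d = dih0 r c' d'" "dih1 r c d = dih1 r c' d'"
proof -
  have 4: "[c = c'] (mod 4)" "[d = d'] (mod 4)"
    by (rule cong_dvd_modulus[OF assms(1)], simp, rule cong_dvd_modulus[OF assms(2)], simp)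
  show "dih0 r c d = dih0 r c' d'" "dih1 r c d = dih1 r c' d'"
    using assms even_cong(2)[OF assms(1)] cong_dvd_iff[OF 4(1)] cong_dvd_iff[OF 4(2)]
    by (simp_all add: dih0_def dih1_def jac8_def cong_def)
qed

lemma dih_s:
  assumes r: "r * r = 1 / 2" and cd: "odd (c + d)"
  shows "dih0 r d (- c) = r * (dih0 r c d + dih1 r c d)" "dih1 r d (- c) = r * (dih0 r c d - dih1 r c d)"
proof -
  have j: "jac8 (- c) = jac8 c" if "odd c"
  proof -
    have "c mod 8 = 1 \<or> c mod 8 = 3 \<or> c mod 8 = 5 \<or> c mod 8 = 7" using that by presburger
    moreover have "(- c) mod 8 = (- (c mod 8)) mod 8" by (simp add: mod_minus_eq)
    ultimately show ?thesis by (elim disjE) (simp_all add: jac8_def)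
  qed
  have r': "r * (r * x) = x / 2" for x
    unfolding mult.assoc[symmetric] r by simp
  show "dih0 r d (- c) = r * (dih0 r c d + dih1 r c d)" "dih1 r d (- c) = r * (dih0 r c d - dih1 r c d)"
  proof (atomize (full), cases "even c")
    case True
    then show "dih0 r d (- c) = r * (dih0 r c d + dih1 r c d) \<and> dih1 r d (- c) = r * (dih0 r c d - dih1 r c d)"
      using cd by (simp add: dih0_def dih1_def)
  next
    case False
    have e: "dih0 r c d = r * jac8 c" "dih1 r c d = r * (if 4 dvd d then jac8 c else - jac8 c)"
      using False by (simp_all add: dih0_def dih1_def)
    show "dih0 r d (- c) = r * (dih0 r c d + dih1 r c d) \<and> dih1 r d (- c) = r * (dih0 r c d - dih1 r c d)"
      unfolding e distrib_left right_diff_distrib r' using False cd j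
      by (simp add: dih0_def dih1_def)
  qed
qed

lemma dih_t2:
  assumes cd: "odd (c + d)"
  shows "dih0 r c (2 * c + d) = dih0 r c d" "dih1 r c (2 * c + d) = - dih1 r c d"
proof -
  define c' d' where c': "c' = c mod 8" and d': "d' = d mod 8"
  have cc: "[c = c'] (mod 8)" "[d = d'] (mod 8)" by (simp_all add: c' d' cong_def)
  have eqs: "dih0 r c (2 * c + d) = dih0 r c' (2 * c' + d')" "dih0 r c d = dih0 r c' d'"
    "dih1 r c (2 * c + d) = dih1 r c' (2 * c' + d')" "dih1 r c d = dih1 r c' d'"
    by (intro dih_cong cong_add cong_mult cong_refl cc)+
  have *: "odd (c' + d')" using cd by (simp add: c' d' even_add dvd_mod_iff)
  have m: "c' \<in> {0, 1, 2, 3, 4, 5, 6, 7}" "d' \<in> {0, 1, 2, 3, 4, 5, 6, 7}" unfolding c' d' by (rule mod_cases)+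
  show "dih0 r c (2 * c + d) = dih0 r c d"
    unfolding eqs using m * by (elim insertE emptyE) (simp_all add: dih0_def dih1_def jac8_def)
  show "dih1 r c (2 * c + d) = - dih1 r c d"
    unfolding eqs using m * by (elim insertE emptyE) (simp_all add: dih0_def dih1_def jac8_def)
qed

lemma jac_mult:
  "\<not> 3 dvd x \<Longrightarrow> \<not> 3 dvd a \<Longrightarrow> jac3 (x * a) = jac3 x * jac3 a"
  "odd x \<Longrightarrow> odd a \<Longrightarrow> jac4 (x * a) = jac4 x * jac4 a"
  "\<not> 5 dvd x \<Longrightarrow> \<not> 5 dvd a \<Longrightarrow> jac5 (x * a) = jac5 x * jac5 a"
  "odd x \<Longrightarrow> odd a \<Longrightarrow> jac8 (x * a) = jac8 x * jac8 a"
proof -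
  have e: "(x * a) mod m = ((x mod m) * (a mod m)) mod m" for m by (rule mod_mult_eq[symmetric])
  show "jac3 (x * a) = jac3 x * jac3 a" if "\<not> 3 dvd x" "\<not> 3 dvd a"
    using mod_cases(1)[of x] mod_cases(1)[of a] that e[of 3] unfolding dvd_eq_mod_eq_0 jac3_def by (elim insertE emptyE) simp_all
  show "jac5 (x * a) = jac5 x * jac5 a" if "\<not> 5 dvd x" "\<not> 5 dvd a"
    using mod_cases(3)[of x] mod_cases(3)[of a] that e[of 5] unfolding dvd_eq_mod_eq_0 jac5_def by (elim insertE emptyE) simp_all
  have 4: "x mod 4 = 1 \<or> x mod 4 = 3" if "odd x" for x :: int using that by presburger
  have 8: "x mod 8 = 1 \<or> x mod 8 = 3 \<or> x mod 8 = 5 \<or> x mod 8 = 7" if "odd x" for x :: int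
    using that by presburger
  show "jac4 (x * a) = jac4 x * jac4 a" if "odd x" "odd a"
    using 4[OF that(1)] 4[OF that(2)] e[of 4] unfolding jac4_def by (elim disjE) simp_all
  show "jac8 (x * a) = jac8 x * jac8 a" if "odd x" "odd a"
    using 8[OF that(1)] 8[OF that(2)] e[of 8] unfolding jac8_def by (elim disjE) simp_all
qed

(* A representation F is recovered from explicit vectors v g = v 1 * F g: if the vectors v (h k) form
   a basis, then F g is the matrix taking each of them to v (h k * g). *)
locale theta_orbit =
  fixes n :: nat and S T2 :: "complex mat" and v :: "int mat \<Rightarrow> nat \<Rightarrow> complex"
    and h :: "nat \<Rightarrow> int mat" and A :: "complex mat"
  assumes n: "n > 0"
    and S: "S \<in> carrier_mat n n" and T2: "T2 \<in> carrier_mat n n" and A: "A \<in> carrier_mat n n"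
    and h: "k < n \<Longrightarrow> h k \<in> carrier Gamma_theta"
    and v_s: "g \<in> carrier Gamma_theta \<Longrightarrow> j < n \<Longrightarrow> v (g * s_gen) j = (\<Sum>i<n. v g i * S $$ (i, j))"
    and v_t2: "g \<in> carrier Gamma_theta \<Longrightarrow> j < n \<Longrightarrow> v (g * t2_gen) j = (\<Sum>i<n. v g i * T2 $$ (i, j))"
    and A_inv: "A * mat n n (\<lambda>(k, j). v (h k) j) = 1\<^sub>m n"
begin

definition M :: "int mat \<Rightarrow> complex mat" where
  "M g = mat n n (\<lambda>(k, j). v (h k * g) j)"

definition F :: "int mat \<Rightarrow> complex mat" where
  "F g = A * M g"

lemma M_carrier [simp]: "M g \<in> carrier_mat n n"
  by (simp add: M_def)

lemma h_mult_one: "k < n \<Longrightarrow> h k * mat2 1 0 0 1 = h k"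
  using monoid.r_one[OF group.is_monoid[OF group_Gamma_theta] h] by simp

lemma M_one: "M (mat2 1 0 0 1) = mat n n (\<lambda>(k, j). v (h k) j)"
  unfolding M_def by (rule eq_matI) (auto simp: h_mult_one)

lemma M_mult:
  assumes "X \<in> carrier_mat n n" "g \<in> carrier Gamma_theta" "x \<in> carrier Gamma_theta"
    and "\<And>g j. g \<in> carrier Gamma_theta \<Longrightarrow> j < n \<Longrightarrow> v (g * x) j = (\<Sum>i<n. v g i * X $$ (i, j))"
  shows "M (g * x) = M g * X"
proof (rule eq_matI)
  fix k j assume "k < dim_row (M g * X)" "j < dim_col (M g * X)"
  then have kj: "k < n" "j < n" using assms(1) by (simp_all add: M_def)
  interpret group Gamma_theta by (rule group_Gamma_theta)
  have hg: "h k * g \<in> carrier Gamma_theta" using m_closed[OF h assms(2)] kj by simp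
  have "h k * (g * x) = h k * g * x" using m_assoc[OF h[OF kj(1)] assms(2,3)] by simp
  then show "M (g * x) $$ (k, j) = (M g * X) $$ (k, j)"
    using kj assms(1) assms(4)[OF hg kj(2)]
    by (simp add: M_def scalar_prod_def atLeast0LessThan)
qed (use assms(1) in \<open>simp_all add: M_def\<close>)

lemma F_one: "F (mat2 1 0 0 1) = 1\<^sub>m n"
  by (simp only: F_def M_one A_inv)

text \<open>The matrix of basis vectors is invertible, so M g is recovered from F g and a kernel
  element fixes every basis vector. In contraposition this bounds the level from below.\<close>

lemma F_eq_one_imp: "F g = 1\<^sub>m n \<Longrightarrow> k < n \<Longrightarrow> j < n \<Longrightarrow> v (h k * g) j = v (h k) j"
proof -
  assume F: "F g = 1\<^sub>m n" and kj: "k < n" "j < n"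
  have 1: "M (mat2 1 0 0 1) * A = 1\<^sub>m n"
    by (rule mat_mult_left_right_inverse[OF A]) (simp_all add: M_one A_inv)
  have "M g = (M (mat2 1 0 0 1) * A) * M g" by (simp add: 1 left_mult_one_mat[OF M_carrier])
  also have "\<dots> = M (mat2 1 0 0 1) * F g" using A by (simp add: F_def assoc_mult_mat[of _ n n _ n _ n])
  also have "\<dots> = M (mat2 1 0 0 1)" by (simp add: F right_mult_one_mat[OF M_carrier])
  finally have "M g $$ (k, j) = M (mat2 1 0 0 1) $$ (k, j)" by simp
  then show ?thesis using kj unfolding M_one by (simp add: M_def)
qed

text \<open>F x is determined by its effect on the n basis vectors, so a conjectured value P need
  only be compared with it there.\<close>

lemma F_eqI:
  assumes "P \<in> carrier_mat n n"
    and "\<And>k j. k < n \<Longrightarrow> j < n \<Longrightarrow> v (h k * x) j = (\<Sum>i<n. v (h k) i * P $$ (i, j))"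
  shows "F x = P"
proof -
  have "M x = M (mat2 1 0 0 1) * P"
    unfolding M_one by (rule eq_matI) (use assms in \<open>auto simp: M_def scalar_prod_def atLeast0LessThan\<close>)
  then have "F x = (A * M (mat2 1 0 0 1)) * P"
    using A assms(1) by (simp add: F_def assoc_mult_mat[of _ n n _ n _ n])
  then show ?thesis using assms(1) by (simp add: M_one A_inv)
qed

sublocale theta_rep n S T2 F
proof
  fix g
  show "F g \<in> carrier_mat n n" using A by (simp add: F_def)
  assume g: "g \<in> carrier Gamma_theta"
  have "M (g * s_gen) = M g * S"
    by (rule M_mult[OF S g s_gen_in]) (rule v_s)
  then show "F (g * s_gen) = F g * S"
    using A S by (simp add: F_def assoc_mult_mat[of _ n n _ n _ n])
  have "M (g * t2_gen) = M g * T2"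
    by (rule M_mult[OF T2 g t2_gen_in]) (rule v_t2)
  then show "F (g * t2_gen) = F g * T2"
    using A T2 by (simp add: F_def assoc_mult_mat[of _ n n _ n _ n])
qed (use n S T2 F_one in auto)

end

subsection \<open>Scaling by diagonal matrices\<close>

lemma jac_inverse:
  assumes "[a * a' = 1] (mod 3)" shows "jac3 a' = jac3 a" "\<not> 3 dvd a" "\<not> 3 dvd a'" "jac3 a * jac3 a = 1"
proof -
  have "\<not> 3 dvd a * a'" using cong_dvd_iff[OF assms] by simp
  then show *: "\<not> 3 dvd a" "\<not> 3 dvd a'" by (auto intro: dvd_mult dvd_mult2)
  have "jac3 a * jac3 a' = jac3 1" using jac_mult(1)[OF *] assms by (simp add: jac3_def cong_def)
  then show "jac3 a' = jac3 a" by (simp add: jac3_def split: if_splits)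
  show "jac3 a * jac3 a = 1" by (simp add: jac3_def)
qed

lemma jac4_inverse:
  assumes "[a * a' = 1] (mod 4)" shows "jac4 a' = jac4 a" "odd a" "odd a'"
proof -
  have "odd (a * a')" using even_cong(1)[OF assms] by simp
  then show *: "odd a" "odd a'" by auto
  have "jac4 a * jac4 a' = jac4 1" using jac_mult(2)[OF *] assms by (simp add: jac4_def cong_def)
  then show "jac4 a' = jac4 a" by (simp add: jac4_def split: if_splits)
qed

lemma jac5_inverse:
  assumes "[a * a' = 1] (mod 5)" shows "jac5 a' = jac5 a" "\<not> 5 dvd a" "\<not> 5 dvd a'"
proof -
  have "\<not> 5 dvd a * a'" using cong_dvd_iff[OF assms] by simp
  then show *: "\<not> 5 dvd a" "\<not> 5 dvd a'" by (auto intro: dvd_mult dvd_mult2)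
  have "jac5 a * jac5 a' = jac5 1" using jac_mult(3)[OF *] assms by (simp add: jac5_def cong_def)
  then show "jac5 a' = jac5 a" by (auto simp: jac5_def split: if_splits)
qed

lemma jac8_inverse:
  assumes "[a * a' = 1] (mod 8)" shows "jac8 a' = jac8 a" "odd a" "odd a'"
proof -
  have "odd (a * a')" using even_cong(2)[OF assms] by simp
  then show *: "odd a" "odd a'" by auto
  have "jac8 a * jac8 a' = jac8 1" using jac_mult(4)[OF *] assms by (simp add: jac8_def cong_def)
  then show "jac8 a' = jac8 a" by (auto simp: jac8_def split: if_splits)
qed

lemma theta_char_diag:
  assumes "[a * a' = 1] (mod 4)" "odd (c + d)"
  shows "theta_char j (c * a) (d * a') = jac4 a * theta_char j c d"
  using assms(2) jac4_inverse[OF assms(1)] by (auto simp: theta_char_def jac_mult(2))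

lemma weil3_diag:
  assumes a: "[a * a' = 1] (mod 3)" and cd: "\<not> (3 dvd c \<and> 3 dvd d)"
  shows "weil3 w (c * a) (d * a') = jac3 a * weil3 w c d" "weil3' w (c * a) (d * a') = jac3 a * weil3' w c d"
proof -
  note a' = jac_inverse[OF a]
  have p: "prime (3::int)" by simp
  have dv: "3 dvd c * a \<longleftrightarrow> 3 dvd c" using a'(2) prime_dvd_mult_iff[OF p] by blast
  show *: "weil3 w (c * a) (d * a') = jac3 a * weil3 w c d"
    using dv cd a' by (simp add: weil3_def jac_mult(1))
  have "[(c * d) * (a * a') = (c * d) * 1] (mod 3)" by (rule cong_mult[OF cong_refl a])
  then have "[- (c * a * (d * a')) = - (c * d)] (mod 3)"
    unfolding cong_minus_minus_iff by (simp add: mult.commute mult.left_commute)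
  then show "weil3' w (c * a) (d * a') = jac3 a * weil3' w c d"
    using dv * by (simp add: weil3'_def cong_def)
qed

text \<open>The scaling multiplies d/(2c) by a^(-2), which modulo 5 equals a^2 and is 1 or -1
  according to the quadratic character of a. For a nonresidue z is thus replaced by its inverse
  z^4.\<close>

lemma weil5_diag:
  assumes a: "[a * a' = 1] (mod 5)" and cd: "\<not> (5 dvd c \<and> 5 dvd d)" and z: "z ^ 5 = 1"
  shows "weil5 q (c * a) (d * a') = jac5 a * weil5 q c d"
    "weil5' q z (c * a) (d * a') = jac5 a * weil5' q (if jac5 a = 1 then z else z ^ 4) c d"
proof -
  note a' = jac5_inverse[OF a]
  have p: "prime (5::int)" by simp
  have dv: "5 dvd c * a \<longleftrightarrow> 5 dvd c" using a'(2) prime_dvd_mult_iff[OF p] by blast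
  show *: "weil5 q (c * a) (d * a') = jac5 a * weil5 q c d"
    using dv cd a' by (simp add: weil5_def jac_mult(3))
  have z': "(if jac5 a = 1 then z else z ^ 4) ^ 5 = 1"
    using z power_mult[of z 5 4] by (simp flip: power_mult)
  have sq: "[a\<^sup>2 = (if jac5 a = 1 then 1 else 4)] (mod 5)"
  proof -
    have "[a\<^sup>2 = (a mod 5)\<^sup>2] (mod 5)" by (intro cong_pow) (simp add: cong_def)
    moreover have "a mod 5 \<noteq> 0" using a'(2) by (simp add: mod_eq_0_iff_dvd)
    ultimately show ?thesis
      using mod_cases(3)[of a] by (elim insertE emptyE) (simp_all add: jac5_def cong_def)
  qed
  have "[3 * c ^ 3 * d * a\<^sup>2 * (a * a') = 3 * c ^ 3 * d * (if jac5 a = 1 then 1 else 4) * 1] (mod 5)"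
    by (intro cong_mult cong_refl a sq)
  then have "[3 * (c * a) ^ 3 * (d * a') = (if jac5 a = 1 then 1 else 4) * (3 * c ^ 3 * d)] (mod 5)"
    by (simp add: power_mult_distrib power2_eq_square power3_eq_cube algebra_simps)
  then have "z powi (3 * (c * a) ^ 3 * (d * a')) = z powi ((if jac5 a = 1 then 1 else 4) * (3 * c ^ 3 * d))"
    using power_int_cong[OF z] by simp
  also have "\<dots> = (if jac5 a = 1 then z else z ^ 4) powi (3 * c ^ 3 * d)"
    by (simp add: power_int_mult)
  finally show "weil5' q z (c * a) (d * a') = jac5 a * weil5' q (if jac5 a = 1 then z else z ^ 4) c d"
    unfolding weil5'_powi[OF z] weil5'_powi[OF z'] using dv * by simp
qed

lemma dih_diag:
  assumes a: "[a * a' = 1] (mod 8)" and cd: "odd (c + d)"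
  shows "dih0 r (c * a) (d * a') = jac8 a * dih0 r c d" "dih1 r (c * a) (d * a') = jac8 a * dih1 r c d"
proof -
  note a' = jac8_inverse[OF a]
  have four_eq: "(2::int) ^ 2 = 4" by simp
  have "coprime ((2::int) ^ 2) a" "coprime ((2::int) ^ 2) a'"
    unfolding coprime_power_left_iff using a'(2,3) by simp_all
  then have "coprime 4 a" "coprime 4 a'" by (simp_all only: four_eq)
  then have dv: "4 dvd c * a \<longleftrightarrow> 4 dvd c" "4 dvd d * a' \<longleftrightarrow> 4 dvd d"
    by (simp_all add: coprime_dvd_mult_left_iff)
  show "dih0 r (c * a) (d * a') = jac8 a * dih0 r c d" "dih1 r (c * a) (d * a') = jac8 a * dih1 r c d"
    using dv cd a' by (auto simp: dih0_def dih1_def jac_mult(4))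
qed

subsection \<open>The representation of data (A)\<close>

lemma sum5: "(\<Sum>i<(5::nat). f i) = f 0 + f 1 + f 2 + f 3 + (f 4 :: 'a::comm_monoid_add)"
proof -
  have "{..<5} = {0, 1, 2, 3, 4::nat}" by auto
  then show ?thesis by (simp add: add.assoc)
qed

lemma less5_cases: "k < (5::nat) \<Longrightarrow> k = 0 \<or> k = 1 \<or> k = 2 \<or> k = 3 \<or> k = 4"
  by arith

lemma nth5 [simp]: "[a, b, c, d, e] ! 0 = a" "[a, b, c, d, e] ! Suc 0 = b" "[a, b, c, d, e] ! 2 = c"
    "[a, b, c, d, e] ! 3 = d" "[a, b, c, d, e] ! 4 = e"
  by (simp_all add: eval_nat_numeral)

definition mat5 :: "'a list list \<Rightarrow> 'a mat" where
  "mat5 xss = mat 5 5 (\<lambda>(i, j). xss ! i ! j)"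

lemma mat5_carrier [simp]: "mat5 xss \<in> carrier_mat 5 5"
  by (simp add: mat5_def)

lemma mat5_index [simp]: "i < 5 \<Longrightarrow> j < 5 \<Longrightarrow> mat5 xss $$ (i, j) = xss ! i ! j"
  by (simp add: mat5_def)

lemma mat5_dim [simp]: "dim_row (mat5 xss) = 5" "dim_col (mat5 xss) = 5"
  by (simp_all add: mat5_def)

lemma mat_diag_index [simp]: "i < n \<Longrightarrow> j < n \<Longrightarrow> mat_diag n f $$ (i, j) = (if i = j then f j else 0)"
  by (simp add: mat_diag_def)

lemma mat_diag_pow: "mat_diag n f ^\<^sub>m k = mat_diag n (\<lambda>i. (f i :: complex) ^ k)"
proof (induction k)
  case (Suc k)
  then show ?case by (simp add: mat_diag_diag mult.commute)
qed (simp add: mat_diag_def)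

lemma prime_order_dvd:
  fixes x :: complex
  assumes "x ^ p = 1" "x \<noteq> 1" "prime p" "x ^ k = 1"
  shows "p dvd k"
proof (rule ccontr)
  assume "\<not> p dvd k"
  then have "coprime (int p) (int k)" using assms(3) by (simp add: prime_imp_coprime)
  then obtain u l where "int p * u + int k * l = 1"
    by (metis bezout_int coprime_imp_gcd_eq_1 mult.commute)
  moreover have "x \<noteq> 0" using assms(1,3) using prime_gt_0_nat[of p] by (auto simp: power_0_left split: if_splits)
  then have "x powi (int p * u + int k * l) = 1"
    using assms(1,4) by (simp add: power_int_add power_int_mult)
  ultimately show False using assms(2) by simp
qed

lemma bottom_row_coprime:
  assumes "a * d - b * c = 1" shows "\<not> (3 dvd c \<and> 3 dvd d)" "\<not> (5 dvd c \<and> 5 dvd (d::int))"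
proof -
  have "m dvd 1" if "m dvd c" "m dvd d" for m
    using that assms by (metis dvd_diff dvd_mult)
  from this[of 3] this[of 5] show "\<not> (3 dvd c \<and> 3 dvd d)" "\<not> (5 dvd c \<and> 5 dvd d)" by auto
qed

text \<open>Inversion of a block lower triangular matrix with diagonal blocks 2, 2, m and a 2 x 2
  block, the last being inverted by \<alpha>, \<beta>, \<gamma>, \<delta>.\<close>

lemma left_inverse_pattern:
  fixes k m x y a a' b b' \<alpha> \<beta> \<gamma> \<delta> s t s' t' :: complex
  assumes "k * m = 1" "\<alpha> * a + \<beta> * b = 1" "\<alpha> * a' + \<beta> * b' = 0" "\<gamma> * a + \<delta> * b = 0" "\<gamma> * a' + \<delta> * b' = 1"
  shows "mat5 [[1 / 2, 0, 0, 0, 0], [0, 1 / 2, 0, 0, 0], [- k * x / 2, - k * y / 2, k, 0, 0],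
      [- (\<alpha> * s + \<beta> * s') / 2, - (\<alpha> * t + \<beta> * t') / 2, 0, \<alpha>, \<beta>],
      [- (\<gamma> * s + \<delta> * s') / 2, - (\<gamma> * t + \<delta> * t') / 2, 0, \<gamma>, \<delta>]] *
    mat5 [[2, 0, 0, 0, 0], [0, 2, 0, 0, 0], [x, y, m, 0, 0], [s, t, 0, a, a'], [s', t', 0, b, b']] = 1\<^sub>m 5"
    (is "?A * ?B = _")
proof (rule eq_matI)
  fix i l assume "i < dim_row (1\<^sub>m 5 :: complex mat)" "l < dim_col (1\<^sub>m 5 :: complex mat)"
  then have il: "i < 5" "l < 5" by simp_all
  have "(?A * ?B) $$ (i, l) = (\<Sum>k<5. ?A $$ (i, k) * ?B $$ (k, l))"
    using il by (simp add: scalar_prod_def atLeast0LessThan)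
  also have "\<dots> = (if i = l then 1 else 0)"
    unfolding sum5 using less5_cases[OF il(1)] less5_cases[OF il(2)]
    by (elim disjE) (simp_all add: assms assms(4,5)[simplified add.commute[of "\<gamma> * _"]] field_simps)
  finally show "(?A * ?B) $$ (i, l) = (1\<^sub>m 5 :: complex mat) $$ (i, l)"
    using il by simp
qed simp_all

text \<open>In the coordinates P + Q, P - Q, 2P', 2Q', 2Q'' this is the direct sum of a block on (P,
  P'), with entries proportional to p, and a block on (Q, Q', Q''). The halves of p - q and p + q
  come from mixing P and Q.\<close>

definition S5_A :: "complex \<Rightarrow> complex \<Rightarrow> complex mat" where
  "S5_A p q = mat5
     [[(p - q) / 2, (p + q) / 2, p, q, q],
      [(p + q) / 2, (p - q) / 2, p, - q, - q],
      [p, p, - p, 0, 0],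
      [q, - q, 0, (q + 1) / 2, (q - 1) / 2],
      [q, - q, 0, (q - 1) / 2, (q + 1) / 2]]"

definition T5_A :: "complex \<Rightarrow> complex \<Rightarrow> complex mat" where
  "T5_A w z = mat_diag 5 (\<lambda>i. [1, 1, w, z, z ^ 4] ! i)"

definition sgn2 :: "int \<Rightarrow> complex" where "sgn2 c = (if even c then 1 else - 1)"

definition perm_A :: "complex \<Rightarrow> complex \<Rightarrow> nat \<Rightarrow> nat" where
  "perm_A x y = (if x = y then id else transpose 0 1) \<circ> (if y = 1 then id else transpose 3 4)"

definition P_A :: "complex \<Rightarrow> complex \<Rightarrow> complex mat" where
  "P_A x y = mat 5 5 (\<lambda>(i, k). if k = perm_A x y i then (if i < 3 then x else y) else 0)"

lemma signed_permutation_P_A: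
  assumes "x \<in> {1, -1}" "y \<in> {1, -1}"
  shows "signed_permutation_mat 5 (P_A x y)"
  unfolding signed_permutation_mat_def
proof (intro exI conjI allI impI)
  have t: "transpose 0 (1::nat) permutes {..<5}" "transpose 3 (4::nat) permutes {..<5}"
    by (rule permutes_swap_id; simp)+
  show "perm_A x y permutes {..<5}"
    unfolding perm_A_def using t by (auto intro: permutes_compose permutes_id)
  show "(if i < 3 then x else y) \<in> {1, -1}" for i :: nat using assms by simp
  show "P_A x y = mat 5 5 (\<lambda>(i, k). if k = perm_A x y i then (if i < 3 then x else y) else 0)"
    by (rule P_A_def)
qed

text \<open>The sign x acts on the level 12 summand (P, P') and y on the level 5 summand (Q, Q',
  Q''). Equal signs keep P + Q and P - Q up to sign, different signs exchange them; y = -1 also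
  exchanges Q' and Q''.\<close>

lemma P_A_action:
  assumes "x \<in> {1, -1}" "y \<in> {1, -1}" "k < 5"
  shows "[x * P + y * Q, x * P - y * Q, 2 * (x * P'),
      2 * (y * (if y = 1 then Q' else Q'')), 2 * (y * (if y = 1 then Q'' else Q'))] ! k =
    (\<Sum>i<5. [P + Q, P - Q, 2 * P', 2 * Q', 2 * Q''] ! i * P_A x y $$ (i, k))"
  unfolding sum5 using assms(1,2) less5_cases[OF assms(3)]
  by (elim insertE emptyE disjE) (simp_all add: P_A_def perm_A_def transpose_def)

lemma P_A_one: "P_A 1 1 = 1\<^sub>m 5"
  by (rule eq_matI) (auto simp: P_A_def perm_A_def)

text \<open>\<open>1 + 2 * w\<close> and \<open>1 + 2 * (z + z ^ 4)\<close> are the quadratic Gauss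
  sums modulo 3 and 5. The first is imaginary; the factor j, contributed by
  \<open>theta_char\<close>, makes p real.\<close>

locale data_A =
  fixes j w z p q :: complex
  assumes j: "j * j = -1" and w: "w * w = - 1 - w"
    and z: "z ^ 4 = - 1 - z - z\<^sup>2 - z ^ 3"
    and p: "p = j * (1 + 2 * w) / 3" and q: "q = - (1 + 2 * (z + z ^ 4)) / 5"
begin

lemma z5: "z ^ 5 = 1"
proof -
  have "z ^ 5 = z * z ^ 4" by (simp flip: power_Suc)
  also have "\<dots> = z * (- 1 - z - z\<^sup>2 - z ^ 3)" by (simp only: z)
  also have "\<dots> = - z - z\<^sup>2 - z ^ 3 - z ^ 4" by (simp add: algebra_simps eval_nat_numeral)
  also have "\<dots> = 1" unfolding z by simp
  finally show ?thesis .
qed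

lemma z_ne: "z \<noteq> 1" "z \<noteq> 0"
  using z by auto

lemma w3: "w ^ 3 = 1" "w * (w * x) = - x - w * x" "w \<noteq> 1"
proof -
  show *: "w * (w * x) = - x - w * x" for x
    unfolding mult.assoc[symmetric] w by (simp add: algebra_simps)
  have "w ^ 3 = w * (w * w)" by (simp add: power3_eq_cube)
  also have "\<dots> = 1" by (simp only: *) (simp add: w)
  finally show "w ^ 3 = 1" .
  show "w \<noteq> 1" using w by auto
qed

lemma p_sq: "p * p = 1 / 3"
proof -
  have "p * p = (j * j) * ((1 + 2 * w) * (1 + 2 * w)) / 9" unfolding p by simp
  also have "\<dots> = 1 / 3" unfolding j by (simp add: algebra_simps w w3(2))
  finally show ?thesis .
qed

lemma z_table:
  "z * z\<^sup>2 = z ^ 3" "z * z ^ 3 = z ^ 4" "z * z ^ 4 = 1" "z\<^sup>2 * z\<^sup>2 = z ^ 4" "z\<^sup>2 * z ^ 3 = 1" "z ^ 3 * z ^ 3 = z"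
  "z\<^sup>2 * z ^ 4 = z" "z ^ 3 * z ^ 4 = z\<^sup>2" "z ^ 4 * z ^ 4 = z ^ 3"
proof -
  have r: "z ^ 6 = z" "z ^ 7 = z\<^sup>2" "z ^ 8 = z ^ 3"
    using power_add[of z 5 1] power_add[of z 5 2] power_add[of z 5 3] z5 by simp_all
  show "z * z\<^sup>2 = z ^ 3" "z * z ^ 3 = z ^ 4" "z * z ^ 4 = 1" "z\<^sup>2 * z\<^sup>2 = z ^ 4" "z\<^sup>2 * z ^ 3 = 1" "z ^ 3 * z ^ 3 = z"
    "z\<^sup>2 * z ^ 4 = z" "z ^ 3 * z ^ 4 = z\<^sup>2" "z ^ 4 * z ^ 4 = z ^ 3"
    using z5 r by (simp_all flip: power_Suc power_add)
qed

lemma q_sq: "q * q = 1 / 5"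
proof -
  have zz: "z * z = z\<^sup>2" by (simp add: power2_eq_square)
  have "q * q = (1 + 4 * z + 4 * z ^ 4 + 4 * (z * z) + 8 * (z * z ^ 4) + 4 * (z ^ 4 * z ^ 4)) / 25"
    unfolding q by (simp add: algebra_simps)
  also have "\<dots> = (1 + 4 * z + 4 * z ^ 4 + 4 * z\<^sup>2 + 8 * 1 + 4 * z ^ 3) / 25"
    by (simp only: z_table zz)
  also have "\<dots> = 1 / 5" unfolding z by simp
  finally show ?thesis .
qed

lemma pq_ne: "p \<noteq> 0" "q \<noteq> 0"
  using p_sq q_sq by auto

(* The representation splits as (theta_char * weil3) + (sgn2 * weil5), of dimensions 2 and 3. *)
definition v :: "int mat \<Rightarrow> nat \<Rightarrow> complex" where
  "v g = (let c = g $$ (1, 0); d = g $$ (1, 1);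
      P = theta_char j c d * weil3 w c d; P' = theta_char j c d * weil3' w c d;
      Q = sgn2 c * weil5 q c d; Q' = sgn2 c * weil5' q z c d; Q'' = sgn2 c * weil5' q (z ^ 4) c d
    in (!) [P + Q, P - Q, 2 * P', 2 * Q', 2 * Q''])"

lemma v_mat2: "v (mat2 a b c d) = (let P = theta_char j c d * weil3 w c d; P' = theta_char j c d * weil3' w c d;
      Q = sgn2 c * weil5 q c d; Q' = sgn2 c * weil5' q z c d; Q'' = sgn2 c * weil5' q (z ^ 4) c d
    in (!) [P + Q, P - Q, 2 * P', 2 * Q', 2 * Q''])"
  by (simp add: v_def)

text \<open>The bottom rows make the matrix of vectors block triangular. The row (60, 13) is 1
  modulo 12 in d but a nonresidue modulo 5, so it changes the sign of Q alone; c = 10 is divisible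
  by 5 and gives P' without Q' and Q''; c = 6 and c = 12 are divisible by 3 and give two different
  powers of z without P'.\<close>

definition h :: "nat \<Rightarrow> int mat" where
  "h k = [mat2 1 0 0 1, mat2 37 8 60 13, mat2 1 0 10 1, mat2 1 0 6 1, mat2 1 0 12 1] ! k"

lemma v_h:
  "v (h 0) = (!) [2, 0, 0, 0, 0]"
  "v (h 1) = (!) [0, 2, 0, 0, 0]"
  "v (h 2) = (!) [(1 + 2 * w) / 3 + 1, (1 + 2 * w) / 3 - 1, 2 * ((1 + 2 * w) / 3 * w\<^sup>2), 0, 0]"
  "v (h 3) = (!) [1 + q, 1 - q, 0, - 2 * q * z ^ 3, - 2 * q * z\<^sup>2]"
  "v (h 4) = (!) [1 - q, 1 + q, 0, 2 * q * z ^ 4, 2 * q * z]"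
proof -
  have r: "z ^ 12 = z\<^sup>2" "z ^ 16 = z"
  proof -
    have "z ^ 12 = (z ^ 5)\<^sup>2 * z\<^sup>2" "z ^ 16 = (z ^ 5) ^ 3 * z" by (simp_all flip: power_mult power_add power_Suc2)
    then show "z ^ 12 = z\<^sup>2" "z ^ 16 = z" by (simp_all add: z5)
  qed
  show "v (h 0) = (!) [2, 0, 0, 0, 0]" "v (h 1) = (!) [0, 2, 0, 0, 0]"
    "v (h 2) = (!) [(1 + 2 * w) / 3 + 1, (1 + 2 * w) / 3 - 1, 2 * ((1 + 2 * w) / 3 * w\<^sup>2), 0, 0]"
    "v (h 3) = (!) [1 + q, 1 - q, 0, - 2 * q * z ^ 3, - 2 * q * z\<^sup>2]"
    "v (h 4) = (!) [1 - q, 1 + q, 0, 2 * q * z ^ 4, 2 * q * z]"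
    by (simp_all add: h_def v_mat2 theta_char_def weil3_def weil3'_def weil5_def weil5'_def sgn2_def
        jac3_def jac4_def jac5_def r Let_def mult.assoc)
qed

lemma h_in: "k < 5 \<Longrightarrow> h k \<in> carrier Gamma_theta"
  by (drule less5_cases) (auto simp: h_def intro!: Gamma_thetaI)

text \<open>The factor j gained by \<open>theta_char\<close> completes (1 + 2w)/3 to p. As exactly
  one of c and d is odd, \<open>sgn2\<close> changes sign, which gives the level 5 block the signs
  of \<open>S5_A\<close>.\<close>

lemma v_s:
  assumes "g \<in> carrier Gamma_theta" "k < 5"
  shows "v (g * s_gen) k = (\<Sum>i<5. v g i * S5_A p q $$ (i, k))"
proof -
  obtain a b c d where g: "g = mat2 a b c d" and det: "a * d - b * c = 1" and
    par: "theta_parity a b c d"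
    using Gamma_theta_parity[OF assms(1)] by blast
  have cd: "odd (c + d)" using par by auto
  note co = bottom_row_coprime[OF det]
  define X where "X = theta_char j c d"
  have X: "theta_char j d (- c) = j * X" unfolding X_def by (rule theta_char_s[OF j cd])
  have sg: "sgn2 d = - sgn2 c" using cd by (simp add: sgn2_def)
  have gs: "mat2 a b c d * s_gen = mat2 b (- a) d (- c)" by (simp add: s_gen_mat2)
  have P: "j * X * weil3 w d (- c) = p * (X * weil3 w c d + 2 * (X * weil3' w c d))"
    "j * X * weil3' w d (- c) = p * (X * weil3 w c d - X * weil3' w c d)"
    unfolding weil3_s[OF w co(1)] p by (simp_all add: algebra_simps)
  show ?thesis
    unfolding g gs v_mat2 X P sg weil5_s[OF z q co(2)] X_def[symmetric] Let_def sum5 using less5_cases[OF assms(2)]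
    by (elim disjE) (simp_all add: S5_A_def, simp_all add: expand_simps)
qed

lemma v_t2:
  assumes "g \<in> carrier Gamma_theta" "k < 5"
  shows "v (g * t2_gen) k = (\<Sum>i<5. v g i * T5_A w z $$ (i, k))"
proof -
  obtain a b c d where g: "g = mat2 a b c d" and
    par: "theta_parity a b c d"
    using Gamma_theta_parity[OF assms(1)] by blast
  have cd: "odd (c + d)" using par by auto
  have gt: "mat2 a b c d * t2_gen = mat2 a (2 * a + b) c (2 * c + d)" by (simp add: t2_gen_mat2 algebra_simps)
  have z45: "(z ^ 4) ^ 5 = 1" using z5 power_mult[of z 5 4] by (simp flip: power_mult)
  show ?thesis
    unfolding g gt v_mat2 theta_char_t2[OF cd] weil3_t2[OF w] weil5_t2[OF z5] weil5_t2[OF z45] Let_def sum5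
    using less5_cases[OF assms(2)]
    by (elim disjE) (simp_all add: T5_A_def)
qed

lemma left_inverse: "\<exists>A\<in>carrier_mat 5 5. A * mat 5 5 (\<lambda>(k, i). v (h k) i) = 1\<^sub>m 5"
proof -
  have "z\<^sup>2 \<noteq> 1"
  proof
    assume "z\<^sup>2 = 1"
    then have "z ^ 5 = z" using power_add[of z 2 3] power_add[of z 2 1] by simp
    then show False using z5 z_ne by simp
  qed
  moreover have "z ^ 3 \<noteq> 1"
  proof
    assume "z ^ 3 = 1"
    then have "z ^ 6 = 1" using power_mult[of z 3 2] by simp
    then show False using z5 z_ne power_add[of z 5 1] by simp
  qed
  ultimately have ne: "1 - z ^ 3 \<noteq> 0" "1 - z\<^sup>2 \<noteq> 0" by auto
  \<comment> \<open>The last diagonal block has rows (-2q z^3, -2q z^2) and (2q z^4, 2q z); its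
    inverse has rows (\<alpha>, z \<alpha>) and (z \<beta>, \<beta>). The entry at P' is inverted by
    \<kappa>, because (1 + 2w)/3 has square -1/3.\<close>
  define \<alpha> \<beta> \<kappa> where "\<alpha> = 1 / (2 * q * (1 - z ^ 3))" and "\<beta> = 1 / (2 * q * (z - z ^ 3))"
    and "\<kappa> = - (3 * ((1 + 2 * w) / 3) * w / 2)"
  have z31: "z - z ^ 3 \<noteq> 0"
    using ne(2) z_ne(2) by (simp add: power3_eq_cube power2_eq_square)
  have k: "\<kappa> * (2 * ((1 + 2 * w) / 3 * w\<^sup>2)) = 1"
    by (simp add: \<kappa>_def power2_eq_square algebra_simps w w3(2) add_divide_distrib diff_divide_distrib)
  have a: "\<alpha> * (- 2 * q * z ^ 3) + z * \<alpha> * (2 * q * z ^ 4) = 1"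
    "\<alpha> * (- 2 * q * z\<^sup>2) + z * \<alpha> * (2 * q * z) = 0"
  proof -
    have "\<alpha> * (- 2 * q * z ^ 3) + z * \<alpha> * (2 * q * z ^ 4) = \<alpha> * (2 * q * (z * z ^ 4 - z ^ 3))"
      by (simp add: algebra_simps)
    then show "\<alpha> * (- 2 * q * z ^ 3) + z * \<alpha> * (2 * q * z ^ 4) = 1"
      using ne pq_ne by (simp add: \<alpha>_def z_table)
    show "\<alpha> * (- 2 * q * z\<^sup>2) + z * \<alpha> * (2 * q * z) = 0"
      by (simp add: power2_eq_square)
  qed
  have b: "z * \<beta> * (- 2 * q * z ^ 3) + \<beta> * (2 * q * z ^ 4) = 0"
    "z * \<beta> * (- 2 * q * z\<^sup>2) + \<beta> * (2 * q * z) = 1"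
  proof -
    have "z * \<beta> * (- 2 * q * z ^ 3) = - (2 * q * \<beta> * (z * z ^ 3))" by simp
    then show "z * \<beta> * (- 2 * q * z ^ 3) + \<beta> * (2 * q * z ^ 4) = 0" by (simp add: z_table)
    have "z * \<beta> * (- 2 * q * z\<^sup>2) + \<beta> * (2 * q * z) = \<beta> * (2 * q * (z - z * z\<^sup>2))"
      by (simp add: algebra_simps)
    then show "z * \<beta> * (- 2 * q * z\<^sup>2) + \<beta> * (2 * q * z) = 1"
      using z31 pq_ne by (simp add: \<beta>_def z_table)
  qed
  have "mat 5 5 (\<lambda>(k, i). v (h k) i) = mat5 [[2, 0, 0, 0, 0], [0, 2, 0, 0, 0],
      [(1 + 2 * w) / 3 + 1, (1 + 2 * w) / 3 - 1, 2 * ((1 + 2 * w) / 3 * w\<^sup>2), 0, 0],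
      [1 + q, 1 - q, 0, - 2 * q * z ^ 3, - 2 * q * z\<^sup>2],
      [1 - q, 1 + q, 0, 2 * q * z ^ 4, 2 * q * z]]"
    by (rule eq_matI) (auto dest!: less5_cases simp: v_h[simplified])
  then show ?thesis
    using left_inverse_pattern[OF k a b] by (metis mat5_carrier)
qed

definition A_inv :: "complex mat" where
  "A_inv = (SOME A. A \<in> carrier_mat 5 5 \<and> A * mat 5 5 (\<lambda>(k, i). v (h k) i) = 1\<^sub>m 5)"

sublocale theta_orbit 5 "S5_A p q" "T5_A w z" v h A_inv
proof
  from left_inverse obtain A where "A \<in> carrier_mat 5 5 \<and> A * mat 5 5 (\<lambda>(k, i). v (h k) i) = 1\<^sub>m 5"
    by blast
  then have "A_inv \<in> carrier_mat 5 5 \<and> A_inv * mat 5 5 (\<lambda>(k, i). v (h k) i) = 1\<^sub>m 5"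
    unfolding A_inv_def by (rule someI)
  then show "A_inv \<in> carrier_mat 5 5" "A_inv * mat 5 5 (\<lambda>(k, i). v (h k) i) = 1\<^sub>m 5" by blast+
  show "S5_A p q \<in> carrier_mat 5 5" "T5_A w z \<in> carrier_mat 5 5"
    by (simp_all add: S5_A_def T5_A_def mat_diag_def)
qed (rule h_in v_s v_t2; assumption | simp)+

text \<open>Modulo 60 the bottom row (c, d) becomes (ca, da'), and every factor of v responds with a
  quadratic character of a. Checking this on the five basis vectors identifies F.\<close>

lemma F_diag:
  assumes "[A = a] (mod 60)" "[B = 0] (mod 60)" "[C = 0] (mod 60)" "[D = a'] (mod 60)"
    and aa: "[a * a' = 1] (mod 60)"
  shows "F (mat2 A B C D) = P_A (jac4 a * jac3 a) (jac5 a)"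
proof (rule F_eqI)
  show "P_A (jac4 a * jac3 a) (jac5 a) \<in> carrier_mat 5 5" by (simp add: P_A_def)
  fix l k :: nat assume l: "l < 5" and k: "k < 5"
  obtain \<alpha> b c d where g: "h l = mat2 \<alpha> b c d" and det: "\<alpha> * d - b * c = 1" and
    par: "theta_parity \<alpha> b c d"
    using Gamma_theta_parity[OF h_in[OF l]] by blast
  have cd: "odd (c + d)" using par by auto
  note co = bottom_row_coprime[OF det]
  have row: "[c * A + d * C = c * a] (mod 60)" "[c * B + d * D = d * a'] (mod 60)"
    using cong_add[OF cong_mult[OF cong_refl assms(1), of c] cong_mult[OF cong_refl assms(3), of d]]
      cong_add[OF cong_mult[OF cong_refl assms(2), of c] cong_mult[OF cong_refl assms(4), of d]] by simp_all
  note dv = row[THEN cong_dvd_modulus] aa[THEN cong_dvd_modulus]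
  have a3: "[a * a' = 1] (mod 3)" and a4: "[a * a' = 1] (mod 4)" and a5: "[a * a' = 1] (mod 5)"
    by (rule dv(3); simp)+
  have X: "theta_char j (c * A + d * C) (c * B + d * D) = jac4 a * theta_char j c d"
    using theta_char_cong[OF dv(1) dv(2), of j] theta_char_diag[OF a4 cd] by simp
  have W: "weil3 w (c * A + d * C) (c * B + d * D) = jac3 a * weil3 w c d"
    "weil3' w (c * A + d * C) (c * B + d * D) = jac3 a * weil3' w c d"
    using weil3_cong[OF dv(1) dv(2), of w] weil3_diag[OF a3 co(1)] by simp_all
  have V: "weil5 q (c * A + d * C) (c * B + d * D) = jac5 a * weil5 q c d"
    "weil5' q y (c * A + d * C) (c * B + d * D) = jac5 a * weil5' q (if jac5 a = 1 then y else y ^ 4) c d"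
    if "y ^ 5 = 1" for y
    using weil5_cong[OF dv(1) dv(2)] weil5_diag[OF a5 co(2) that] by simp_all
  have z4: "(z ^ 4) ^ 5 = 1" "(z ^ 4) ^ 4 = z"
  proof -
    have "(z ^ 4) ^ 5 = (z ^ 5) ^ 4" "(z ^ 4) ^ 4 = (z ^ 5) ^ 3 * z"
      by (simp_all flip: power_mult power_Suc2)
    then show "(z ^ 4) ^ 5 = 1" "(z ^ 4) ^ 4 = z" by (simp_all add: z5)
  qed
  have "even (c * A + d * C) = even (c * a)" using cong_dvd_iff[OF dv(1), of 2] by simp
  then have sg: "sgn2 (c * A + d * C) = sgn2 c"
    using jac4_inverse[OF a4] by (simp add: sgn2_def)
  have J: "jac4 a * jac3 a \<in> {1, -1}" "jac5 a \<in> {1, -1}"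
    by (auto simp: jac3_def jac4_def jac5_def)
  have e: "weil5' q (if jac5 a = 1 then z else z ^ 4) c d = (if jac5 a = 1 then weil5' q z c d else weil5' q (z ^ 4) c d)"
    "weil5' q (if jac5 a = 1 then z ^ 4 else z) c d = (if jac5 a = 1 then weil5' q (z ^ 4) c d else weil5' q z c d)"
    by simp_all
  have v: "v (h l * mat2 A B C D) = (let x = jac4 a * jac3 a; y = jac5 a;
      P = theta_char j c d * weil3 w c d; P' = theta_char j c d * weil3' w c d;
      Q = sgn2 c * weil5 q c d; Q' = sgn2 c * weil5' q z c d; Q'' = sgn2 c * weil5' q (z ^ 4) c d
    in (!) [x * P + y * Q, x * P - y * Q, 2 * (x * P'), 2 * (y * (if y = 1 then Q' else Q'')),
      2 * (y * (if y = 1 then Q'' else Q'))])"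
    unfolding g mat2_mult v_mat2 X W V[OF z5] V[OF z4(1)] sg z4(2) e Let_def
    by (simp add: mult.assoc mult.left_commute)
  show "v (h l * mat2 A B C D) k = (\<Sum>i<5. v (h l) i * P_A (jac4 a * jac3 a) (jac5 a) $$ (i, k))"
    unfolding v Let_def P_A_action[OF J k] unfolding g v_mat2 Let_def ..
qed

lemma Gamma_kernel: "Gamma 60 \<subseteq> kernel Gamma_theta (GL 5) F"
proof (rule Gamma_sub_kernel)
  fix g assume "g \<in> Gamma 60"
  then show "F g = 1\<^sub>m 5"
    using F_diag[of _ 1 _ _ _ 1] P_A_one by (auto elim!: Gamma_cases simp: jac3_def jac4_def jac5_def)
qed simp

lemma congruence: "congruence_hom (GL 5) F"
  unfolding congruence_hom_def using F_hom Gamma_kernel by (auto intro!: exI[of _ 60])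

lemma level: "level (GL 5) F = 60"
proof (rule level_eqI[OF _ Gamma_kernel])
  fix m :: nat
  assume m: "0 < m" "m < 60" "even m" and T: "T5_A w z ^\<^sub>m (m div 2) = 1\<^sub>m 5"
  have "(T5_A w z ^\<^sub>m (m div 2)) $$ (2, 2) = 1" "(T5_A w z ^\<^sub>m (m div 2)) $$ (3, 3) = 1"
    unfolding T by simp_all
  then have "w ^ (m div 2) = 1" "z ^ (m div 2) = 1"
    by (simp_all add: T5_A_def mat_diag_pow)
  then have "3 dvd m div 2" "5 dvd m div 2"
    using prime_order_dvd[of w 3] prime_order_dvd[of z 5] w3 z5 z_ne by simp_all
  then have "m = 30" using m by presburger
  \<comment> \<open>Here d = -29 is 3 modulo 4 and 1 modulo 15, so the level 4 character changes the
    sign of P while Q stays.\<close>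
  moreover have "F (mat2 31 30 (-30) (-29)) \<noteq> 1\<^sub>m 5"
  proof
    assume "F (mat2 31 30 (-30) (-29)) = 1\<^sub>m 5"
    from F_eq_one_imp[OF this, of 0 0] show False
      unfolding v_h by (simp add: h_def v_mat2 theta_char_def weil3_def weil5_def sgn2_def
        jac3_def jac4_def jac5_def Let_def)
  qed
  moreover have "mat2 31 30 (-30) (-29) \<in> Gamma 30"
    by (simp add: mat2_in_Gamma cong_def)
  ultimately show "\<exists>g\<in>Gamma m. F g \<noteq> 1\<^sub>m 5" by blast
qed simp

lemma signed_permutation: "signed_permutation_condition 5 (S5_A p q) (T5_A w z) 0"
proof (rule signed_permutation_condition[OF congruence])
  show "even (level (GL 5) F)" by (simp add: level)
  fix a a' :: nat
  assume "[int a * int a' = 1] (mod int (level (GL 5) F))"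
  then have aa: "[int a * int a' = 1] (mod 60)" by (simp add: level)
  have "F (mat2 (int a * (2 - int a * int a')) (1 - int a * int a') (int a * int a' - 1) (int a')) = P_A (jac4 (int a) * jac3 (int a)) (jac5 (int a))"
  proof (rule F_diag[OF _ _ _ cong_refl aa])
    show "[int a * (2 - int a * int a') = int a] (mod 60)"
      using cong_mult[OF cong_refl cong_diff[OF cong_refl aa], of "int a" 2] by simp
    show "[1 - int a * int a' = 0] (mod 60)" using cong_diff[OF cong_refl aa, of 1] by simp
    show "[int a * int a' - 1 = 0] (mod 60)" using cong_diff[OF aa cong_refl, of 1] by simp
  qed
  then show "signed_permutation_mat 5
      (F (mat2 (int a * (2 - int a * int a')) (1 - int a * int a') (int a * int a' - 1) (int a')))"
    by (simp add: signed_permutation_P_A jac3_def jac4_def jac5_def)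
qed

(* The powers of z are replaced by free variables since the simplifier would normalise
   the products z * z ^ k. *)
lemma z_rules:
  assumes e: "e1 = z" "e2 = z\<^sup>2" "e3 = z ^ 3" "e4 = z ^ 4"
  shows "e4 = - 1 - e1 - e2 - e3" "q = (1 + 2 * e2 + 2 * e3) / 5"
    "e1 * e1 = e2" "e1 * e2 = e3" "e1 * e3 = e4" "e1 * e4 = 1" "e2 * e2 = e4" "e2 * e3 = 1" "e2 * e4 = e1"
    "e3 * e3 = e1" "e3 * e4 = e2" "e4 * e4 = e3"
    "e1 * (e1 * x) = e2 * x" "e1 * (e2 * x) = e3 * x" "e1 * (e3 * x) = e4 * x" "e1 * (e4 * x) = x"
    "e2 * (e2 * x) = e4 * x" "e2 * (e3 * x) = x" "e2 * (e4 * x) = e1 * x" "e3 * (e3 * x) = e1 * x"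
    "e3 * (e4 * x) = e2 * x" "e4 * (e4 * x) = e3 * x"
    "q * e1 = (e1 + 2 * e3 + 2 * e4) / 5" "q * e2 = (e2 + 2 * e4 + 2) / 5" "q * e3 = (e3 + 2 + 2 * e1) / 5"
    "q * e4 = (e4 + 2 * e1 + 2 * e2) / 5"
    "q * (e1 * x) = (e1 + 2 * e3 + 2 * e4) / 5 * x" "q * (e2 * x) = (e2 + 2 * e4 + 2) / 5 * x"
    "q * (e3 * x) = (e3 + 2 + 2 * e1) / 5 * x" "q * (e4 * x) = (e4 + 2 * e1 + 2 * e2) / 5 * x"
proof -
  show e4: "e4 = - 1 - e1 - e2 - e3" by (simp add: e z)
  show tab: "e1 * e1 = e2" "e1 * e2 = e3" "e1 * e3 = e4" "e1 * e4 = 1" "e2 * e2 = e4" "e2 * e3 = 1" "e2 * e4 = e1"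
    "e3 * e3 = e1" "e3 * e4 = e2" "e4 * e4 = e3"
    unfolding e by (simp_all only: z_table power2_eq_square[of z, symmetric])
  have "q = - (1 + 2 * (e1 + e4)) / 5" by (simp only: q e)
  then show q': "q = (1 + 2 * e2 + 2 * e3) / 5" by (simp add: e4 algebra_simps)
  show ext: "e1 * (e1 * x) = e2 * x" "e1 * (e2 * x) = e3 * x" "e1 * (e3 * x) = e4 * x" "e1 * (e4 * x) = x"
    "e2 * (e2 * x) = e4 * x" "e2 * (e3 * x) = x" "e2 * (e4 * x) = e1 * x" "e3 * (e3 * x) = e1 * x"
    "e3 * (e4 * x) = e2 * x" "e4 * (e4 * x) = e3 * x" for x
    by (simp_all only: mult.assoc[symmetric] tab mult_1)
  show qe: "q * e1 = (e1 + 2 * e3 + 2 * e4) / 5" "q * e2 = (e2 + 2 * e4 + 2) / 5" "q * e3 = (e3 + 2 + 2 * e1) / 5"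
    "q * e4 = (e4 + 2 * e1 + 2 * e2) / 5"
    unfolding q' by (simp_all add: algebra_simps tab ext)
  show "q * (e1 * x) = (e1 + 2 * e3 + 2 * e4) / 5 * x" "q * (e2 * x) = (e2 + 2 * e4 + 2) / 5 * x"
    "q * (e3 * x) = (e3 + 2 + 2 * e1) / 5 * x" "q * (e4 * x) = (e4 + 2 * e1 + 2 * e2) / 5 * x"
    by (simp_all only: mult.assoc[symmetric] qe)
qed

end

subsection \<open>The representation of data (B)\<close>

definition S5_B :: "complex \<Rightarrow> complex \<Rightarrow> complex mat" where
  "S5_B p r = mat5
     [[(r - p) / 2, (r + p) / 2, r / 2, r / 2, p],
      [(r + p) / 2, (r - p) / 2, r / 2, r / 2, - p],
      [r / 2, r / 2, (- r - \<i>) / 2, (- r + \<i>) / 2, 0],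
      [r / 2, r / 2, (- r + \<i>) / 2, (- r - \<i>) / 2, 0],
      [p, - p, 0, 0, p]]"

definition T5_B :: "complex \<Rightarrow> complex mat" where
  "T5_B w = mat_diag 5 (\<lambda>i. [1, 1, -1, -1, w] ! i)"

text \<open>The character with s -> 1 and t^2 -> -1. It is not a function of the bottom row, as t^2
  itself shows, so the vectors of (B) depend on the whole matrix.\<close>

definition sgn_exp :: "int mat \<Rightarrow> complex" where
  "sgn_exp g = (if even (theta_exp g) then 1 else -1)"

lemma sgn_exp_s: "g \<in> carrier Gamma_theta \<Longrightarrow> sgn_exp (g * s_gen) = sgn_exp g"
  using theta_exp_s[THEN cong_dvd_modulus, of g 2] cong_dvd_iff[of "theta_exp (g * s_gen)" "theta_exp g" 2]
  by (simp add: sgn_exp_def)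

lemma sgn_exp_t2: "g \<in> carrier Gamma_theta \<Longrightarrow> sgn_exp (g * t2_gen) = - sgn_exp g"
  using theta_exp_t2[THEN cong_dvd_modulus, of g 2] cong_dvd_iff[of "theta_exp (g * t2_gen)" "theta_exp g + 1" 2]
  by (simp add: sgn_exp_def)

lemma sgn_exp_mat2:
  assumes "theta_parity a b c d"
  shows "sgn_exp (mat2 a b c d) = (if 4 dvd a * b - c * d then 1 else - 1)"
proof -
  have half: "even (x div 2) \<longleftrightarrow> 4 dvd x" if "even x" for x :: int using that by presburger
  have "even (theta_exp (mat2 a b c d)) \<longleftrightarrow> 4 dvd a * b - c * d"
  proof (cases "even b")
    case True
    then show ?thesis using assms half[of "a * b - c * d"] by (auto simp: theta_exp_mat2)
  next
    case False
    then show ?thesis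
      using assms half[of "c * d - a * b"] dvd_diff_commute[of 4 "c * d" "a * b"] by (auto simp: theta_exp_mat2)
  qed
  then show ?thesis by (simp add: sgn_exp_def)
qed

definition perm_B :: "complex \<Rightarrow> complex \<Rightarrow> complex \<Rightarrow> nat \<Rightarrow> nat" where
  "perm_B x y u = (if x = y then id else transpose 0 1) \<circ> (if x = u then id else transpose 2 3)"

definition P_B :: "complex \<Rightarrow> complex \<Rightarrow> complex \<Rightarrow> complex mat" where
  "P_B x y u = mat 5 5 (\<lambda>(i, k). if k = perm_B x y u i then (if i < 4 then x else y) else 0)"

lemma signed_permutation_P_B:
  assumes "x \<in> {1, -1}" "y \<in> {1, -1}"
  shows "signed_permutation_mat 5 (P_B x y u)"
  unfolding signed_permutation_mat_def
proof (intro exI conjI allI impI)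
  have t: "transpose 0 (1::nat) permutes {..<5}" "transpose 2 (3::nat) permutes {..<5}"
    by (rule permutes_swap_id; simp)+
  show "perm_B x y u permutes {..<5}"
    unfolding perm_B_def using t by (auto intro: permutes_compose permutes_id)
  show "(if i < 4 then x else y) \<in> {1, -1}" for i :: nat using assms by simp
  show "P_B x y u = mat 5 5 (\<lambda>(i, k). if k = perm_B x y u i then (if i < 4 then x else y) else 0)"
    by (rule P_B_def)
qed

text \<open>There are three independent signs: x on the dihedral summand, y on the level 12 summand
  and u on the one-dimensional one. If x and y differ, the labels 0 and 1 are exchanged; if x and u
  differ, the labels 2 and 3.\<close>

lemma P_B_action:
  assumes "x \<in> {1, -1}" "y \<in> {1, -1}" "u \<in> {1, -1}" "k < 5"
  shows "[x * R + y * P, x * R - y * P, x * R' + u * K, x * R' - u * K, - 2 * (y * P')] ! k =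
    (\<Sum>i<5. [R + P, R - P, R' + K, R' - K, - 2 * P'] ! i * P_B x y u $$ (i, k))"
  unfolding sum5 using assms(1-3) less5_cases[OF assms(4)]
  by (elim insertE emptyE disjE) (simp_all add: P_B_def perm_B_def transpose_def)

lemma P_B_one: "P_B 1 1 1 = 1\<^sub>m 5"
  by (rule eq_matI) (auto simp: P_B_def perm_B_def)

lemma left_inverse_pattern_B:
  fixes g k m :: complex
  assumes "k * m = 1"
  shows "mat5 [[1/4, 1/4, 0, 0, 0], [-1/4, 1/4, 1/2, 0, 0], [1/4, -1/2, 1/4, 1/2, 0], [-1/4, 0, 1/4, 1/2, 0],
      [k * (- 1/2 + g / 2), 0, - k * (1 + g) / 2, 0, k]] *
    mat5 [[2, 0, 1, -1, 0], [2, 0, -1, 1, 0], [0, 2, 1, -1, 0], [1, -1, 0, 2, 0], [1 - g, 1 + g, 1, -1, m]] = 1\<^sub>m 5"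
    (is "?A * ?B = _")
proof (rule eq_matI)
  fix i l assume "i < dim_row (1\<^sub>m 5 :: complex mat)" "l < dim_col (1\<^sub>m 5 :: complex mat)"
  then have il: "i < 5" "l < 5" by simp_all
  have "(?A * ?B) $$ (i, l) = (\<Sum>k<5. ?A $$ (i, k) * ?B $$ (k, l))"
    using il by (simp add: scalar_prod_def atLeast0LessThan)
  also have "\<dots> = (if i = l then 1 else 0)"
    unfolding sum5 using less5_cases[OF il(1)] less5_cases[OF il(2)]
    by (elim disjE) (simp_all add: assms field_simps)
  finally show "(?A * ?B) $$ (i, l) = (1\<^sub>m 5 :: complex mat) $$ (i, l)"
    using il by simp
qed simp_all

text \<open>The vacuum entry is (r - p)/2, so the level 12 summand enters with -p. This accounts for
  the sign in p and for the coordinate -2P' below, which keeps the vacuum entry of label 4 equal to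
  p.\<close>

locale data_B =
  fixes w p r :: complex
  assumes w: "w * w = - 1 - w" and p: "p = - (\<i> * (1 + 2 * w) / 3)" and r: "r * r = 1 / 2"
begin

lemma w3: "w ^ 3 = 1" "w * (w * x) = - x - w * x" "w \<noteq> 1"
proof -
  show *: "w * (w * x) = - x - w * x" for x
    unfolding mult.assoc[symmetric] w by (simp add: algebra_simps)
  have "w ^ 3 = w * (w * w)" by (simp add: power3_eq_cube)
  also have "\<dots> = 1" by (simp only: *) (simp add: w)
  finally show "w ^ 3 = 1" .
  show "w \<noteq> 1" using w by auto
qed

lemma p_sq: "p * p = 1 / 3"
proof -
  have "p * p = - ((1 + 2 * w) * (1 + 2 * w)) / 9" unfolding p by (simp add: algebra_simps)
  also have "\<dots> = 1 / 3" by (simp add: algebra_simps w w3(2))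
  finally show ?thesis .
qed

(* The representation splits as (theta_char * weil3) + dih + (sgn_exp * theta_char), of dimensions
   2, 2 and 1. *)
definition v :: "int mat \<Rightarrow> nat \<Rightarrow> complex" where
  "v g = (let c = g $$ (1, 0); d = g $$ (1, 1);
      P = theta_char \<i> c d * weil3 w c d; P' = theta_char \<i> c d * weil3' w c d;
      R = dih0 r c d; R' = dih1 r c d; K = sgn_exp g * theta_char (- \<i>) c d
    in (!) [R + P, R - P, R' + K, R' - K, - 2 * P'])"

lemma v_mat2: "v (mat2 a b c d) = (let
      P = theta_char \<i> c d * weil3 w c d; P' = theta_char \<i> c d * weil3' w c d;
      R = dih0 r c d; R' = dih1 r c d; K = sgn_exp (mat2 a b c d) * theta_char (- \<i>) c d
    in (!) [R + P, R - P, R' + K, R' - K, - 2 * P'])"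
  by (simp add: v_def)

text \<open>Relative to the identity, t^2 changes the sign of K alone. The row (24, 7) changes that
  of P alone, two signs cancelling in K; c = 6 moves the dihedral vector from R to R', and c = 8,
  the one value not divisible by 3, produces P'.\<close>

definition h :: "nat \<Rightarrow> int mat" where
  "h k = [mat2 1 0 0 1, mat2 1 2 0 1, mat2 7 2 24 7, mat2 1 0 6 1, mat2 1 0 8 1] ! k"

lemma v_h:
  "v (h 0) = (!) [2, 0, 1, -1, 0]"
  "v (h 1) = (!) [2, 0, -1, 1, 0]"
  "v (h 2) = (!) [0, 2, 1, -1, 0]"
  "v (h 3) = (!) [1, -1, 0, 2, 0]"
  "v (h 4) = (!) [1 - (1 + 2 * w) / 3, 1 + (1 + 2 * w) / 3, 1, -1, 2 * ((1 + 2 * w) / 3 * w)]"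
proof -
  have n: "jac3 8 * (1 + 2 * w) / 3 = - ((1 + 2 * w) / 3)" by (simp add: jac3_def field_simps)
  show "v (h 0) = (!) [2, 0, 1, -1, 0]" "v (h 1) = (!) [2, 0, -1, 1, 0]" "v (h 2) = (!) [0, 2, 1, -1, 0]"
    "v (h 3) = (!) [1, -1, 0, 2, 0]"
    by (simp_all add: h_def v_mat2 theta_char_def weil3_def weil3'_def dih0_def dih1_def sgn_exp_mat2
        jac3_def jac4_def jac8_def Let_def)
  show "v (h 4) = (!) [1 - (1 + 2 * w) / 3, 1 + (1 + 2 * w) / 3, 1, -1, 2 * ((1 + 2 * w) / 3 * w)]"
    by (simp add: h_def v_mat2 theta_char_def weil3_def weil3'_def dih0_def dih1_def sgn_exp_mat2 n
        jac4_def jac8_def Let_def)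
qed

lemma h_in: "k < 5 \<Longrightarrow> h k \<in> carrier Gamma_theta"
  by (drule less5_cases) (auto simp: h_def intro!: Gamma_thetaI)

lemma v_s:
  assumes "g \<in> carrier Gamma_theta" "k < 5"
  shows "v (g * s_gen) k = (\<Sum>i<5. v g i * S5_B p r $$ (i, k))"
proof -
  obtain a b c d where g: "g = mat2 a b c d" and det: "a * d - b * c = 1" and
    par: "theta_parity a b c d"
    using Gamma_theta_parity[OF assms(1)] by blast
  have cd: "odd (c + d)" using par by auto
  note co = bottom_row_coprime[OF det]
  define X Y where "X = theta_char \<i> c d" and "Y = theta_char (- \<i>) c d"
  have X: "theta_char \<i> d (- c) = \<i> * X" "theta_char (- \<i>) d (- c) = - \<i> * Y"
    unfolding X_def Y_def by (rule theta_char_s[OF _ cd]; simp)+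
  have gs: "mat2 a b c d * s_gen = mat2 b (- a) d (- c)" by (simp add: s_gen_mat2)
  have sg: "sgn_exp (mat2 b (- a) d (- c)) = sgn_exp (mat2 a b c d)"
    using sgn_exp_s[OF assms(1)] unfolding g gs .
  have P: "\<i> * X * weil3 w d (- c) = - p * (X * weil3 w c d + 2 * (X * weil3' w c d))"
    "\<i> * X * weil3' w d (- c) = - p * (X * weil3 w c d - X * weil3' w c d)"
    unfolding weil3_s[OF w co(1)] p by (simp_all add: algebra_simps)
  show ?thesis
    unfolding g gs v_mat2 X P sg dih_s[OF r cd] X_def[symmetric] Y_def[symmetric] Let_def sum5
    using less5_cases[OF assms(2)]
    by (elim disjE) (simp_all add: S5_B_def, simp_all add: expand_simps)
qed

lemma v_t2:
  assumes "g \<in> carrier Gamma_theta" "k < 5"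
  shows "v (g * t2_gen) k = (\<Sum>i<5. v g i * T5_B w $$ (i, k))"
proof -
  obtain a b c d where g: "g = mat2 a b c d" and
    par: "theta_parity a b c d"
    using Gamma_theta_parity[OF assms(1)] by blast
  have cd: "odd (c + d)" using par by auto
  have gt: "mat2 a b c d * t2_gen = mat2 a (2 * a + b) c (2 * c + d)" by (simp add: t2_gen_mat2 algebra_simps)
  have sg: "sgn_exp (mat2 a (2 * a + b) c (2 * c + d)) = - sgn_exp (mat2 a b c d)"
    using sgn_exp_t2[OF assms(1)] unfolding g gt .
  show ?thesis
    unfolding g gt v_mat2 theta_char_t2[OF cd] weil3_t2[OF w] dih_t2[OF cd] sg Let_def sum5
    using less5_cases[OF assms(2)]
    by (elim disjE) (simp_all add: T5_B_def)
qed

lemma left_inverse: "\<exists>A\<in>carrier_mat 5 5. A * mat 5 5 (\<lambda>(k, i). v (h k) i) = 1\<^sub>m 5"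
proof -
  have k: "- (3 * ((1 + 2 * w) / 3) * (w * w) / 2) * (2 * ((1 + 2 * w) / 3 * w)) = 1"
    by (simp add: w, simp add: algebra_simps w w3(2) add_divide_distrib diff_divide_distrib)
  have "mat 5 5 (\<lambda>(k, i). v (h k) i) = mat5 [[2, 0, 1, -1, 0], [2, 0, -1, 1, 0], [0, 2, 1, -1, 0], [1, -1, 0, 2, 0],
      [1 - (1 + 2 * w) / 3, 1 + (1 + 2 * w) / 3, 1, -1, 2 * ((1 + 2 * w) / 3 * w)]]"
    by (rule eq_matI) (auto dest!: less5_cases simp: v_h[simplified])
  then show ?thesis
    using left_inverse_pattern_B[OF k] by (metis mat5_carrier)
qed

definition A_inv :: "complex mat" where
  "A_inv = (SOME A. A \<in> carrier_mat 5 5 \<and> A * mat 5 5 (\<lambda>(k, i). v (h k) i) = 1\<^sub>m 5)"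

sublocale theta_orbit 5 "S5_B p r" "T5_B w" v h A_inv
proof
  from left_inverse obtain A where "A \<in> carrier_mat 5 5 \<and> A * mat 5 5 (\<lambda>(k, i). v (h k) i) = 1\<^sub>m 5"
    by blast
  then have "A_inv \<in> carrier_mat 5 5 \<and> A_inv * mat 5 5 (\<lambda>(k, i). v (h k) i) = 1\<^sub>m 5"
    unfolding A_inv_def by (rule someI)
  then show "A_inv \<in> carrier_mat 5 5" "A_inv * mat 5 5 (\<lambda>(k, i). v (h k) i) = 1\<^sub>m 5" by blast+
  show "S5_B p r \<in> carrier_mat 5 5" "T5_B w \<in> carrier_mat 5 5"
    by (simp_all add: S5_B_def T5_B_def mat_diag_def)
qed (rule h_in v_s v_t2; assumption | simp)+

lemma F_diag:
  assumes "[A = a] (mod 24)" "[B = 0] (mod 24)" "[C = 0] (mod 24)" "[D = a'] (mod 24)"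
    and aa: "[a * a' = 1] (mod 24)"
  shows "F (mat2 A B C D) = P_B (jac8 a) (jac4 a * jac3 a) (jac4 a)"
proof (rule F_eqI)
  show "P_B (jac8 a) (jac4 a * jac3 a) (jac4 a) \<in> carrier_mat 5 5" by (simp add: P_B_def)
  fix l k :: nat assume l: "l < 5" and k: "k < 5"
  obtain \<alpha> b c d where g: "h l = mat2 \<alpha> b c d" and det: "\<alpha> * d - b * c = 1" and
    par: "theta_parity \<alpha> b c d"
    using Gamma_theta_parity[OF h_in[OF l]] by blast
  have cd: "odd (c + d)" using par by auto
  note co = bottom_row_coprime[OF det]
  have row: "[x * A + y * C = x * a] (mod 24)" "[x * B + y * D = y * a'] (mod 24)" for x y
    using cong_add[OF cong_mult[OF cong_refl assms(1), of x] cong_mult[OF cong_refl assms(3), of y]]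
      cong_add[OF cong_mult[OF cong_refl assms(2), of x] cong_mult[OF cong_refl assms(4), of y]] by simp_all
  have even_24: "even x \<longleftrightarrow> even y" if "[x = y] (mod 24)" for x y :: int
    using cong_dvd_iff[OF cong_dvd_modulus[OF that, of 2]] by simp
  note dv = row(1)[of c d, THEN cong_dvd_modulus] row(2)[of c d, THEN cong_dvd_modulus] aa[THEN cong_dvd_modulus]
  have a3: "[a * a' = 1] (mod 3)" and a4: "[a * a' = 1] (mod 4)" and a8: "[a * a' = 1] (mod 8)"
    by (rule dv(3); simp)+
  have X: "theta_char j (c * A + d * C) (c * B + d * D) = jac4 a * theta_char j c d" for j
    using theta_char_cong[OF dv(1) dv(2), of j] theta_char_diag[OF a4 cd] by simp
  have W: "weil3 w (c * A + d * C) (c * B + d * D) = jac3 a * weil3 w c d"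
    "weil3' w (c * A + d * C) (c * B + d * D) = jac3 a * weil3' w c d"
    using weil3_cong[OF dv(1) dv(2), of w] weil3_diag[OF a3 co(1)] by simp_all
  have V: "dih0 r (c * A + d * C) (c * B + d * D) = jac8 a * dih0 r c d"
    "dih1 r (c * A + d * C) (c * B + d * D) = jac8 a * dih1 r c d"
    using dih_cong[OF dv(1) dv(2), of r] dih_diag[OF a8 cd] by simp_all
  \<comment> \<open>\<open>sgn_exp\<close> sees the difference of the row products modulo 4, and
    scaling the columns by a and a' multiplies each product by aa', which is 1.\<close>
  have sg: "sgn_exp (mat2 (\<alpha> * A + b * C) (\<alpha> * B + b * D) (c * A + d * C) (c * B + d * D)) = sgn_exp (mat2 \<alpha> b c d)"
  proof -
    have "[(\<alpha> * A + b * C) * (\<alpha> * B + b * D) - (c * A + d * C) * (c * B + d * D) =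
        (\<alpha> * a) * (b * a') - (c * a) * (d * a')] (mod 24)"
      by (intro cong_diff cong_mult row)
    also have "(\<alpha> * a) * (b * a') - (c * a) * (d * a') = (\<alpha> * b - c * d) * (a * a')" by (simp add: algebra_simps)
    also have "[(\<alpha> * b - c * d) * (a * a') = (\<alpha> * b - c * d) * 1] (mod 24)"
      by (intro cong_mult cong_refl aa)
    finally have c24: "[(\<alpha> * A + b * C) * (\<alpha> * B + b * D) - (c * A + d * C) * (c * B + d * D) =
        (\<alpha> * b - c * d) * 1] (mod 24)" .
    have e: "4 dvd (\<alpha> * A + b * C) * (\<alpha> * B + b * D) - (c * A + d * C) * (c * B + d * D) \<longleftrightarrow> 4 dvd \<alpha> * b - c * d"
      using cong_dvd_iff[OF cong_dvd_modulus[OF c24, of 4]] by simp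
    have "even A \<longleftrightarrow> even a" "even B \<longleftrightarrow> even (0::int)" "even C \<longleftrightarrow> even (0::int)" "even D \<longleftrightarrow> even a'"
      by (rule even_24, fact)+
    then have "odd A" "even B" "even C" "odd D" using jac4_inverse[OF a4] by simp_all
    then have par': "even (\<alpha> * B + b * D) \<and> even (c * A + d * C) \<and> odd (\<alpha> * A + b * C) \<and> odd (c * B + d * D) \<or>
      odd (\<alpha> * B + b * D) \<and> odd (c * A + d * C) \<and> even (\<alpha> * A + b * C) \<and> even (c * B + d * D)"
      using par by (elim disjE conjE) simp_all
    show ?thesis unfolding sgn_exp_mat2[OF par'] sgn_exp_mat2[OF par] e ..
  qed
  have J: "jac4 a * jac3 a \<in> {1, -1}" "jac8 a \<in> {1, -1}" "jac4 a \<in> {1, -1}"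
    by (auto simp: jac3_def jac4_def jac8_def)
  have v: "v (h l * mat2 A B C D) = (let y = jac4 a * jac3 a; x = jac8 a; u = jac4 a;
      P = theta_char \<i> c d * weil3 w c d; P' = theta_char \<i> c d * weil3' w c d;
      R = dih0 r c d; R' = dih1 r c d; K = sgn_exp (mat2 \<alpha> b c d) * theta_char (- \<i>) c d
    in (!) [x * R + y * P, x * R - y * P, x * R' + u * K, x * R' - u * K, - 2 * (y * P')])"
    unfolding g mat2_mult v_mat2 X W V sg Let_def
    by (simp add: mult.assoc mult.left_commute)
  show "v (h l * mat2 A B C D) k = (\<Sum>i<5. v (h l) i * P_B (jac8 a) (jac4 a * jac3 a) (jac4 a) $$ (i, k))"
    unfolding v Let_def P_B_action[OF J(2,1,3) k] unfolding g v_mat2 Let_def ..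
qed

lemma Gamma_kernel: "Gamma 24 \<subseteq> kernel Gamma_theta (GL 5) F"
proof (rule Gamma_sub_kernel)
  fix g assume "g \<in> Gamma 24"
  then show "F g = 1\<^sub>m 5"
    using F_diag[of _ 1 _ _ _ 1] P_B_one by (auto elim!: Gamma_cases simp: jac3_def jac4_def jac8_def)
qed simp

lemma congruence: "congruence_hom (GL 5) F"
  unfolding congruence_hom_def using F_hom Gamma_kernel by (auto intro!: exI[of _ 24])

lemma level: "level (GL 5) F = 24"
proof (rule level_eqI[OF _ Gamma_kernel])
  fix m :: nat
  assume m: "0 < m" "m < 24" "even m" and T: "T5_B w ^\<^sub>m (m div 2) = 1\<^sub>m 5"
  have "(T5_B w ^\<^sub>m (m div 2)) $$ (2, 2) = 1" "(T5_B w ^\<^sub>m (m div 2)) $$ (4, 4) = 1"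
    unfolding T by simp_all
  then have *: "(- 1 :: complex) ^ (m div 2) = 1" "w ^ (m div 2) = 1"
    by (simp_all add: T5_B_def mat_diag_pow)
  have "2 dvd m div 2"
    using *(1) by (metis minus_one_power_iff neg_equal_iff_equal one_neq_neg_one)
  moreover have "3 dvd m div 2"
    by (rule prime_order_dvd[OF w3(1,3) _ *(2)]) simp
  moreover note m
  ultimately have "\<exists>k. m = 12 * k" by presburger
  then have "m = 12" using m by auto
  \<comment> \<open>Here d = -11 is 5 modulo 8 and 1 modulo 12, so the dihedral coordinate R changes
    sign while P stays.\<close>
  moreover have "F (mat2 13 12 (-12) (-11)) \<noteq> 1\<^sub>m 5"
  proof
    assume "F (mat2 13 12 (-12) (-11)) = 1\<^sub>m 5"
    from F_eq_one_imp[OF this, of 0 0] show False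
      unfolding v_h by (simp add: h_def v_mat2 theta_char_def weil3_def dih0_def dih1_def
        jac3_def jac4_def jac8_def Let_def)
  qed
  moreover have "mat2 13 12 (-12) (-11) \<in> Gamma 12"
    by (simp add: mat2_in_Gamma cong_def)
  ultimately show "\<exists>g\<in>Gamma m. F g \<noteq> 1\<^sub>m 5" by blast
qed simp

lemma signed_permutation: "signed_permutation_condition 5 (S5_B p r) (T5_B w) 0"
proof (rule signed_permutation_condition[OF congruence])
  show "even (level (GL 5) F)" by (simp add: level)
  fix a a' :: nat
  assume "[int a * int a' = 1] (mod int (level (GL 5) F))"
  then have aa: "[int a * int a' = 1] (mod 24)" by (simp add: level)
  have "F (mat2 (int a * (2 - int a * int a')) (1 - int a * int a') (int a * int a' - 1) (int a')) =
      P_B (jac8 (int a)) (jac4 (int a) * jac3 (int a)) (jac4 (int a))"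
  proof (rule F_diag[OF _ _ _ cong_refl aa])
    show "[int a * (2 - int a * int a') = int a] (mod 24)"
      using cong_mult[OF cong_refl cong_diff[OF cong_refl aa], of "int a" 2] by simp
    show "[1 - int a * int a' = 0] (mod 24)" using cong_diff[OF cong_refl aa, of 1] by simp
    show "[int a * int a' - 1 = 0] (mod 24)" using cong_diff[OF aa cong_refl, of 1] by simp
  qed
  then show "signed_permutation_mat 5
      (F (mat2 (int a * (2 - int a * int a')) (1 - int a * int a') (int a * int a' - 1) (int a')))"
    by (simp add: signed_permutation_P_B jac3_def jac4_def jac8_def)
qed

end

subsection \<open>Unitarity, Verlinde formula and Frobenius-Schur indicators\<close>

definition N_A :: "nat list list list" where
  "N_A = [[[1, 0, 0, 0, 0], [0, 1, 0, 0, 0], [0, 0, 1, 0, 0], [0, 0, 0, 1, 0], [0, 0, 0, 0, 1]],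
    [[0, 1, 0, 0, 0], [1, 2, 2, 2, 2], [0, 2, 3, 2, 2], [0, 2, 2, 1, 2], [0, 2, 2, 2, 1]],
    [[0, 0, 1, 0, 0], [0, 2, 3, 2, 2], [1, 3, 3, 2, 2], [0, 2, 2, 2, 2], [0, 2, 2, 2, 2]],
    [[0, 0, 0, 1, 0], [0, 2, 2, 1, 2], [0, 2, 2, 2, 2], [1, 1, 2, 2, 1], [0, 2, 2, 1, 1]],
    [[0, 0, 0, 0, 1], [0, 2, 2, 2, 1], [0, 2, 2, 2, 2], [0, 2, 2, 1, 1], [1, 1, 2, 1, 2]]]"

lemma mat_adjoint_index:
  "A \<in> carrier_mat n n \<Longrightarrow> i < n \<Longrightarrow> k < n \<Longrightarrow> mat_adjoint A $$ (i, k) = cnj (A $$ (k, i))"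
  by (simp add: mat_adjoint_def mat_of_rows_def)

lemma is_unitaryI:
  assumes "A \<in> carrier_mat n n"
    "\<And>i k. i < n \<Longrightarrow> k < n \<Longrightarrow> (\<Sum>m<n. A $$ (i, m) * cnj (A $$ (k, m))) = (if i = k then 1 else 0)"
  shows "is_unitary n A"
  unfolding is_unitary_def
proof
  have d: "dim_row (mat_adjoint A) = n" "dim_col (mat_adjoint A) = n"
    using assms(1) by (simp_all add: mat_adjoint_def)
  show "A * mat_adjoint A = 1\<^sub>m n"
    by (rule eq_matI) (use assms d in \<open>simp_all add: scalar_prod_def atLeast0LessThan mat_adjoint_index\<close>)
qed (rule assms(1))

lemma Re_of_nat_table:
  assumes "\<And>i j k. i < 5 \<Longrightarrow> j < 5 \<Longrightarrow> k < 5 \<Longrightarrow> verlinde 5 S i j k = of_nat (N ! i ! j ! k)"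
    and "\<And>i j k. i < 5 \<Longrightarrow> j < 5 \<Longrightarrow> k < 5 \<Longrightarrow> N ! i ! j ! k \<le> M" and "N ! i0 ! j0 ! k0 = M" "i0 < 5" "j0 < 5" "k0 < 5"
  shows "Max {Re (verlinde 5 S i j k) | i j k. i < 5 \<and> j < 5 \<and> k < 5} = real M"
proof (rule Max_eqI)
  have "{Re (verlinde 5 S i j k) | i j k. i < 5 \<and> j < 5 \<and> k < 5} \<subseteq>
      (\<lambda>(i, j, k). Re (verlinde 5 S i j k)) ` ({..<5} \<times> {..<5} \<times> {..<5})"
    by (auto intro: image_eqI[where x = "(i, j, k)" for i j k])
  then show "finite {Re (verlinde 5 S i j k) | i j k. i < 5 \<and> j < 5 \<and> k < 5}"
    by (rule finite_subset) simp
  show "real M \<in> {Re (verlinde 5 S i j k) | i j k. i < 5 \<and> j < 5 \<and> k < 5}"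
    using assms(1)[OF assms(4-6)] assms(3-6) by (intro CollectI exI[of _ i0] exI[of _ j0] exI[of _ k0]) simp
  fix y assume "y \<in> {Re (verlinde 5 S i j k) | i j k. i < 5 \<and> j < 5 \<and> k < 5}"
  then show "y \<le> real M" using assms(1,2) by auto
qed

locale real_A =
  fixes p q :: complex
  assumes pp: "p * p = 1 / 3" and qq: "q * q = 1 / 5" and cnj_p: "cnj p = p" and cnj_q: "cnj q = q"
begin

lemma p2: "p * (p * x) = x / 3" and q2: "q * (q * x) = x / 5"
  unfolding mult.assoc[symmetric] pp qq by simp_all

lemma pq_ne: "p \<noteq> 0" "q \<noteq> 0" "p - q \<noteq> 0" "p + q \<noteq> 0"
proof -
  show "p \<noteq> 0" "q \<noteq> 0" using pp qq by auto
  have "(p - q) * (p + q) = 2 / 15" by (simp add: algebra_simps pp qq)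
  then show "p - q \<noteq> 0" "p + q \<noteq> 0" by auto
qed

text \<open>By (p - q)(p + q) = 2/15 the reciprocals of the first row are polynomials in p and q,
  and division disappears from the Verlinde sums.\<close>

lemma inverse_row_0: "m < 5 \<Longrightarrow> x / S5_A p q $$ (0, m) = x * [15 * (p + q), 15 * (p - q), 3 * p, 5 * q, 5 * q] ! m"
proof -
  assume "m < 5"
  moreover have "x / ((p - q) / 2) = x * (15 * (p + q))" "x / ((p + q) / 2) = x * (15 * (p - q))"
    "x / p = x * (3 * p)" "x / q = x * (5 * q)"
    using pq_ne by (simp_all add: field_simps pp qq p2 q2)
  ultimately show ?thesis
    by (elim less5_cases[THEN disjE] disjE) (simp_all add: S5_A_def)
qed

text \<open>The sums reduce by p^2 = 1/3, q^2 = 1/5 and reality of p and q, so the table is the same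
  for either sign of q. This is why unitary and non-unitary data share their fusion rules.\<close>

lemma verlinde_S5_A:
  assumes "i < 5" "j < 5" "k < 5"
  shows "verlinde 5 (S5_A p q) i j k = of_nat (N_A ! i ! j ! k)"
proof -
  have "verlinde 5 (S5_A p q) i j k = (\<Sum>m<5. S5_A p q $$ (i, m) * S5_A p q $$ (j, m) *
      cnj (S5_A p q $$ (k, m)) * [15 * (p + q), 15 * (p - q), 3 * p, 5 * q, 5 * q] ! m)"
    unfolding verlinde_def by (rule sum.cong) (simp_all add: inverse_row_0)
  also have "\<dots> = of_nat (N_A ! i ! j ! k)"
    unfolding sum5 using less5_cases[OF assms(1)] less5_cases[OF assms(2)] less5_cases[OF assms(3)]
    by (elim disjE) (simp_all add: S5_A_def N_A_def cnj_p cnj_q, (simp_all add: expand_simps pp qq p2 q2)?)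
  finally show ?thesis .
qed

text \<open>As pq is 1/sqrt 15 or -1/sqrt 15, this gives the two values 240 + 60 sqrt 15 and 240 -
  60 sqrt 15 of D^2.\<close>

lemma Dsq_S5_A: "Dsq 5 (S5_A p q) = 240 + 900 * (p * q)" "2 / Dsq 5 (S5_A p q) = S5_A p q $$ (0, 0) * S5_A p q $$ (0, 0)"
proof -
  have "qdim (S5_A p q) i = S5_A p q $$ (0, i) * (15 * (p + q))" for i
    using inverse_row_0[of 0] by (simp add: qdim_def)
  then show D: "Dsq 5 (S5_A p q) = 240 + 900 * (p * q)"
    unfolding Dsq_def sum5
    by (simp add: S5_A_def power2_eq_square expand_simps pp qq p2 q2)
  have S: "(240 + 900 * (p * q)) * (S5_A p q $$ (0, 0) * S5_A p q $$ (0, 0)) = 2"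
    by (simp add: S5_A_def expand_simps pp qq p2 q2)
  then have "240 + 900 * (p * q) \<noteq> 0" by auto
  then show "2 / Dsq 5 (S5_A p q) = S5_A p q $$ (0, 0) * S5_A p q $$ (0, 0)"
    unfolding D using S by (simp add: divide_eq_eq mult.commute)
qed

lemma unitary_S5_A: "is_unitary 5 (S5_A p q)"
proof (rule is_unitaryI)
  show "S5_A p q \<in> carrier_mat 5 5" by (simp add: S5_A_def)
  fix i k :: nat assume ik: "i < 5" "k < 5"
  show "(\<Sum>m<5. S5_A p q $$ (i, m) * cnj (S5_A p q $$ (k, m))) = (if i = k then 1 else 0)"
    unfolding sum5 using less5_cases[OF ik(1)] less5_cases[OF ik(2)]
    by (elim disjE) (simp_all add: S5_A_def cnj_p cnj_q, (simp_all add: expand_simps pp qq p2 q2)?)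
qed

lemma symmetric_S5_A: "(S5_A p q)\<^sup>T = S5_A p q"
  by (rule eq_matI) (auto simp: S5_A_def dest!: less5_cases)

lemma not_abelian_S5_A: "\<not> abelian_theory 5 (S5_A p q)"
proof
  assume "abelian_theory 5 (S5_A p q)"
  then have "(\<Sum>k<5. verlinde 5 (S5_A p q) 1 1 k) = 1" by (simp add: abelian_theory_def)
  then have "(\<Sum>k<5. (of_nat (N_A ! 1 ! 1 ! k) :: complex)) = 1" by (simp add: verlinde_S5_A)
  then show False unfolding sum5 by (simp add: N_A_def)
qed

lemma Max_verlinde_S5_A: "Max {Re (verlinde 5 (S5_A p q) i j k) | i j k. i < 5 \<and> j < 5 \<and> k < 5} = 3"
proof -
  have "N_A ! i ! j ! k \<le> 3" if "i < 5" "j < 5" "k < 5" for i j k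
    using less5_cases[OF that(1)] less5_cases[OF that(2)] less5_cases[OF that(3)]
    by (elim disjE) (simp_all add: N_A_def)
  then show ?thesis
    using Re_of_nat_table[OF verlinde_S5_A, of 3 2 2 1] by (simp add: N_A_def)
qed

end

locale unitary_data_A = data_A +
  assumes cnj_p: "cnj p = p" and cnj_q: "cnj q = q" and cnj_w: "w * cnj w = 1" and cnj_z: "z * cnj z = 1"
begin

sublocale real_A p q
  by unfold_locales (fact p_sq q_sq cnj_p cnj_q)+

lemma frobenius_schur: "frobenius_schur 5 (S5_A p q) (T5_A w z)"
  unfolding frobenius_schur_def
proof (intro allI impI)
  fix a :: nat assume a: "a < 5"
  \<comment> \<open>t' lists the inverses of the squared spins as polynomials: 1/w = -1 - w and 1/z
    = z^4. By 2/D^2 = S_00^2 the quantum dimensions in the sum turn into the entries s of the first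
    row.\<close>
  define t t' where "t = (!) [1, 1, w, z, z ^ 4]" and "t' = (!) [1, 1, - 1 - w, z ^ 4, z]"
  define s where "s = (!) [(p - q) / 2, (p + q) / 2, p, q, q]"
  have S0: "S5_A p q $$ (0, 0) \<noteq> 0" using pq_ne by (simp add: S5_A_def)
  have T: "T5_A w z $$ (l, l) / T5_A w z $$ (k, k) = t l * t' k" if "l < 5" "k < 5" for l k
  proof -
    have "w * (- 1 - w) = 1" "z ^ 4 * z = 1" using z_table(3) by (simp_all add: algebra_simps w)
    then have "T5_A w z $$ (k, k) * t' k = 1"
      using less5_cases[OF that(2)] by (elim disjE) (simp_all add: T5_A_def t'_def z_table)
    then have "x / T5_A w z $$ (k, k) = x * t' k" for x
      by (metis divide_eq_eq mult.assoc mult.commute mult_1 mult_zero_left zero_neq_one)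
    then show ?thesis using that by (simp add: T5_A_def t_def)
  qed
  have "2 / Dsq 5 (S5_A p q) * (\<Sum>l<5. \<Sum>k<5. verlinde 5 (S5_A p q) l k a * qdim (S5_A p q) l *
      qdim (S5_A p q) k * (T5_A w z $$ (l, l) / T5_A w z $$ (k, k))) =
    (\<Sum>l<5. \<Sum>k<5. of_nat (N_A ! l ! k ! a) * s l * s k * (t l * t' k))"
    unfolding Dsq_S5_A(2) sum_distrib_left
  proof (intro sum.cong refl)
    fix l k :: nat assume lk: "l \<in> {..<5}" "k \<in> {..<5}"
    then have "S5_A p q $$ (0, l) = s l" "S5_A p q $$ (0, k) = s k" by (simp_all add: S5_A_def s_def)
    then show "S5_A p q $$ (0, 0) * S5_A p q $$ (0, 0) * (verlinde 5 (S5_A p q) l k a * qdim (S5_A p q) l *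
        qdim (S5_A p q) k * (T5_A w z $$ (l, l) / T5_A w z $$ (k, k))) =
      of_nat (N_A ! l ! k ! a) * s l * s k * (t l * t' k)"
      using lk a S0 by (simp add: verlinde_S5_A T qdim_def)
  qed
  also have "\<dots> = 1"
  proof -
    obtain e1 e2 e3 e4 where e: "e1 = z" "e2 = z\<^sup>2" "e3 = z ^ 3" "e4 = z ^ 4" by blast
    note ze = z_rules(3-)[OF e]
    have te: "t = (!) [1, 1, w, e1, e4]" "t' = (!) [1, 1, - 1 - w, e4, e1]"
      by (simp_all add: t_def t'_def e)
    show ?thesis
      unfolding sum5 te s_def using less5_cases[OF a]
      by (elim disjE) (simp_all add: N_A_def, (simp_all add: expand_simps pp qq p2 q2 ze w w3(2), (simp_all add: z_rules[OF e] expand_simps)?)?)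
  qed
  finally show "2 / Dsq 5 (S5_A p q) * (\<Sum>l<5. \<Sum>k<5. verlinde 5 (S5_A p q) l k a * qdim (S5_A p q) l *
      qdim (S5_A p q) k * (T5_A w z $$ (l, l) / T5_A w z $$ (k, k))) \<in> {1, - 1}" by simp
qed

lemma unitary_T5_A: "is_unitary 5 (T5_A w z)"
proof (rule is_unitaryI)
  have z4: "z ^ 4 * cnj z ^ 4 = 1" by (simp add: cnj_z flip: power_mult_distrib)
  fix i k :: nat assume ik: "i < 5" "k < 5"
  show "(\<Sum>m<5. T5_A w z $$ (i, m) * cnj (T5_A w z $$ (k, m))) = (if i = k then 1 else 0)"
    unfolding sum5 using less5_cases[OF ik(1)] less5_cases[OF ik(2)]
    by (elim disjE) (simp_all add: T5_A_def cnj_w cnj_z z4)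
qed (simp add: T5_A_def mat_diag_def)

lemma valid:
  assumes "positive_real (p - q)"
  shows "valid_fermionic_data 5 (S5_A p q) (T5_A w z) 0"
proof -
  obtain x where "x > 0" "p - q = of_real x" using assms by (auto simp: positive_real_def)
  then have pos: "positive_real (S5_A p q $$ (0, 0))"
    unfolding positive_real_def by (intro exI[of _ "x / 2"]) (simp add: S5_A_def)
  have vi: "verlinde_integral 5 (S5_A p q)"
    unfolding verlinde_integral_def by (simp add: verlinde_S5_A)
  show ?thesis
    unfolding valid_fermionic_data_def
    using pos vi symmetric_S5_A unitary_S5_A unitary_T5_A projective_congruence[OF congruence]
      frobenius_schur signed_permutation
    by (auto simp: diagonal_mat_def T5_A_def mat_diag_def)
qed

end

definition N_B :: "nat list list list" where
  "N_B = [[[1, 0, 0, 0, 0], [0, 1, 0, 0, 0], [0, 0, 1, 0, 0], [0, 0, 0, 1, 0], [0, 0, 0, 0, 1]],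
    [[0, 1, 0, 0, 0], [1, 4, 2, 2, 4], [0, 2, 2, 1, 2], [0, 2, 1, 2, 2], [0, 4, 2, 2, 3]],
    [[0, 0, 1, 0, 0], [0, 2, 2, 1, 2], [0, 1, 0, 2, 1], [1, 2, 0, 0, 1], [0, 2, 1, 1, 2]],
    [[0, 0, 0, 1, 0], [0, 2, 1, 2, 2], [1, 2, 0, 0, 1], [0, 1, 2, 0, 1], [0, 2, 1, 1, 2]],
    [[0, 0, 0, 0, 1], [0, 4, 2, 2, 3], [0, 2, 1, 1, 2], [0, 2, 1, 1, 2], [1, 3, 2, 2, 3]]]"

locale real_B =
  fixes p r :: complex
  assumes pp: "p * p = 1 / 3" and rr: "r * r = 1 / 2" and cnj_p: "cnj p = p" and cnj_r: "cnj r = r"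
begin

lemma p2: "p * (p * x) = x / 3" and r2: "r * (r * x) = x / 2"
  unfolding mult.assoc[symmetric] pp rr by simp_all

lemma pr_ne: "p \<noteq> 0" "r \<noteq> 0" "r - p \<noteq> 0" "r + p \<noteq> 0"
proof -
  show "p \<noteq> 0" "r \<noteq> 0" using pp rr by auto
  have "(r - p) * (r + p) = 1 / 6" by (simp add: algebra_simps pp rr)
  then show "r - p \<noteq> 0" "r + p \<noteq> 0" by auto
qed

lemma inverse_row_0: "m < 5 \<Longrightarrow> x / S5_B p r $$ (0, m) = x * [12 * (r + p), 12 * (r - p), 4 * r, 4 * r, 3 * p] ! m"
proof -
  assume "m < 5"
  moreover have "x / ((r - p) / 2) = x * (12 * (r + p))" "x / ((r + p) / 2) = x * (12 * (r - p))"
    "x / (r / 2) = x * (4 * r)" "x / p = x * (3 * p)"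
    using pr_ne by (simp_all add: field_simps pp rr p2 r2)
  ultimately show ?thesis
    by (elim less5_cases[THEN disjE] disjE) (simp_all add: S5_B_def)
qed

lemma i2: "\<i> * (\<i> * x) = - x"
  by (simp flip: mult.assoc)

lemma verlinde_S5_B:
  assumes "i < 5" "j < 5" "k < 5"
  shows "verlinde 5 (S5_B p r) i j k = of_nat (N_B ! i ! j ! k)"
proof -
  have "verlinde 5 (S5_B p r) i j k = (\<Sum>m<5. S5_B p r $$ (i, m) * S5_B p r $$ (j, m) *
      cnj (S5_B p r $$ (k, m)) * [12 * (r + p), 12 * (r - p), 4 * r, 4 * r, 3 * p] ! m)"
    unfolding verlinde_def by (rule sum.cong) (simp_all add: inverse_row_0)
  also have "\<dots> = of_nat (N_B ! i ! j ! k)"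
    unfolding sum5 using less5_cases[OF assms(1)] less5_cases[OF assms(2)] less5_cases[OF assms(3)]
    by (elim disjE) (simp_all add: S5_B_def N_B_def cnj_p cnj_r, (simp_all add: expand_simps pp rr p2 r2 i2)?)
  finally show ?thesis .
qed

text \<open>As pr is 1/sqrt 6 or -1/sqrt 6, the two values of D^2 are 240 + 96 sqrt 6 and 240 - 96
  sqrt 6.\<close>

lemma Dsq_S5_B: "Dsq 5 (S5_B p r) = 240 + 576 * (p * r)" "2 / Dsq 5 (S5_B p r) = S5_B p r $$ (0, 0) * S5_B p r $$ (0, 0)"
proof -
  have "qdim (S5_B p r) i = S5_B p r $$ (0, i) * (12 * (r + p))" for i
    using inverse_row_0[of 0] by (simp add: qdim_def)
  then show D: "Dsq 5 (S5_B p r) = 240 + 576 * (p * r)"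
    unfolding Dsq_def sum5
    by (simp add: S5_B_def power2_eq_square expand_simps pp rr p2 r2)
  have S: "(240 + 576 * (p * r)) * (S5_B p r $$ (0, 0) * S5_B p r $$ (0, 0)) = 2"
    by (simp add: S5_B_def expand_simps pp rr p2 r2)
  then have "240 + 576 * (p * r) \<noteq> 0" by auto
  then show "2 / Dsq 5 (S5_B p r) = S5_B p r $$ (0, 0) * S5_B p r $$ (0, 0)"
    unfolding D using S by (simp add: divide_eq_eq mult.commute)
qed

lemma unitary_S5_B: "is_unitary 5 (S5_B p r)"
proof (rule is_unitaryI)
  show "S5_B p r \<in> carrier_mat 5 5" by (simp add: S5_B_def)
  fix i k :: nat assume ik: "i < 5" "k < 5"
  show "(\<Sum>m<5. S5_B p r $$ (i, m) * cnj (S5_B p r $$ (k, m))) = (if i = k then 1 else 0)"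
    unfolding sum5 using less5_cases[OF ik(1)] less5_cases[OF ik(2)]
    by (elim disjE) (simp_all add: S5_B_def cnj_p cnj_r, (simp_all add: expand_simps pp rr p2 r2 i2)?)
qed

lemma symmetric_S5_B: "(S5_B p r)\<^sup>T = S5_B p r"
  by (rule eq_matI) (auto simp: S5_B_def dest!: less5_cases)

lemma not_abelian_S5_B: "\<not> abelian_theory 5 (S5_B p r)"
proof
  assume "abelian_theory 5 (S5_B p r)"
  then have "(\<Sum>k<5. verlinde 5 (S5_B p r) 1 1 k) = 1" by (simp add: abelian_theory_def)
  then have "(\<Sum>k<5. (of_nat (N_B ! 1 ! 1 ! k) :: complex)) = 1" by (simp add: verlinde_S5_B)
  then show False unfolding sum5 by (simp add: N_B_def)
qed

lemma Max_verlinde_S5_B: "Max {Re (verlinde 5 (S5_B p r) i j k) | i j k. i < 5 \<and> j < 5 \<and> k < 5} = 4"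
proof -
  have "N_B ! i ! j ! k \<le> 4" if "i < 5" "j < 5" "k < 5" for i j k
    using less5_cases[OF that(1)] less5_cases[OF that(2)] less5_cases[OF that(3)]
    by (elim disjE) (simp_all add: N_B_def)
  then show ?thesis
    using Re_of_nat_table[OF verlinde_S5_B, of 4 1 1 1] by (simp add: N_B_def)
qed

end

locale unitary_data_B = data_B +
  assumes cnj_p: "cnj p = p" and cnj_r: "cnj r = r" and cnj_w: "w * cnj w = 1"
begin

sublocale real_B p r
  by unfold_locales (fact p_sq r cnj_p cnj_r)+

lemma frobenius_schur: "frobenius_schur 5 (S5_B p r) (T5_B w)"
  unfolding frobenius_schur_def
proof (intro allI impI)
  fix a :: nat assume a: "a < 5" and "verlinde 5 (S5_B p r) a a 0 = 1"
  \<comment> \<open>This excludes the labels 2 and 3, which are dual to each other.\<close>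
  then have a': "N_B ! a ! a ! 0 = 1" by (simp add: verlinde_S5_B)
  define t t' where "t = (!) [1, 1, -1, -1, w]" and "t' = (!) [1, 1, -1, -1, - 1 - w]"
  define s where "s = (!) [(r - p) / 2, (r + p) / 2, r / 2, r / 2, p]"
  have S0: "S5_B p r $$ (0, 0) \<noteq> 0" using pr_ne by (simp add: S5_B_def)
  have T: "T5_B w $$ (l, l) / T5_B w $$ (k, k) = t l * t' k" if "l < 5" "k < 5" for l k
  proof -
    have "w * (- 1 - w) = 1" by (simp add: algebra_simps w)
    then have "T5_B w $$ (k, k) * t' k = 1"
      using less5_cases[OF that(2)] by (elim disjE) (simp_all add: T5_B_def t'_def)
    then have "x / T5_B w $$ (k, k) = x * t' k" for x
      by (metis divide_eq_eq mult.assoc mult.commute mult_1 mult_zero_left zero_neq_one)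
    then show ?thesis using that by (simp add: T5_B_def t_def)
  qed
  have "2 / Dsq 5 (S5_B p r) * (\<Sum>l<5. \<Sum>k<5. verlinde 5 (S5_B p r) l k a * qdim (S5_B p r) l *
      qdim (S5_B p r) k * (T5_B w $$ (l, l) / T5_B w $$ (k, k))) =
    (\<Sum>l<5. \<Sum>k<5. of_nat (N_B ! l ! k ! a) * s l * s k * (t l * t' k))"
    unfolding Dsq_S5_B(2) sum_distrib_left
  proof (intro sum.cong refl)
    fix l k :: nat assume lk: "l \<in> {..<5}" "k \<in> {..<5}"
    then have "S5_B p r $$ (0, l) = s l" "S5_B p r $$ (0, k) = s k" by (simp_all add: S5_B_def s_def)
    then show "S5_B p r $$ (0, 0) * S5_B p r $$ (0, 0) * (verlinde 5 (S5_B p r) l k a * qdim (S5_B p r) l *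
        qdim (S5_B p r) k * (T5_B w $$ (l, l) / T5_B w $$ (k, k))) =
      of_nat (N_B ! l ! k ! a) * s l * s k * (t l * t' k)"
      using lk a S0 by (simp add: verlinde_S5_B T qdim_def)
  qed
  also have "\<dots> = 1"
    unfolding sum5 t_def t'_def s_def using less5_cases[OF a] a'
    by (elim disjE) (simp_all add: N_B_def, (simp_all add: expand_simps pp rr p2 r2 w w3(2))?)
  finally show "2 / Dsq 5 (S5_B p r) * (\<Sum>l<5. \<Sum>k<5. verlinde 5 (S5_B p r) l k a * qdim (S5_B p r) l *
      qdim (S5_B p r) k * (T5_B w $$ (l, l) / T5_B w $$ (k, k))) \<in> {1, - 1}" by simp
qed

lemma unitary_T5_B: "is_unitary 5 (T5_B w)"
proof (rule is_unitaryI)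
  fix i k :: nat assume ik: "i < 5" "k < 5"
  show "(\<Sum>m<5. T5_B w $$ (i, m) * cnj (T5_B w $$ (k, m))) = (if i = k then 1 else 0)"
    unfolding sum5 using less5_cases[OF ik(1)] less5_cases[OF ik(2)]
    by (elim disjE) (simp_all add: T5_B_def cnj_w)
qed (simp add: T5_B_def mat_diag_def)

lemma valid:
  assumes "positive_real (r - p)"
  shows "valid_fermionic_data 5 (S5_B p r) (T5_B w) 0"
proof -
  obtain x where "x > 0" "r - p = of_real x" using assms by (auto simp: positive_real_def)
  then have pos: "positive_real (S5_B p r $$ (0, 0))"
    unfolding positive_real_def by (intro exI[of _ "x / 2"]) (simp add: S5_B_def)
  have vi: "verlinde_integral 5 (S5_B p r)"
    unfolding verlinde_integral_def by (simp add: verlinde_S5_B)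
  show ?thesis
    unfolding valid_fermionic_data_def
    using pos vi symmetric_S5_B unitary_S5_B unitary_T5_B projective_congruence[OF congruence]
      frobenius_schur signed_permutation
    by (auto simp: diagonal_mat_def T5_B_def mat_diag_def)
qed

end

subsection \<open>Full fusion rules\<close>

(* M False i j k and M True i j k are the multiplicities in i x j of k and of its partner, for one choice
   of the spins t; flipping the signs of the spins in the set b regrades the labels. *)
locale graded_fusion =
  fixes n :: nat and \<delta> :: "nat \<Rightarrow> nat" and M :: "bool \<Rightarrow> nat \<Rightarrow> nat \<Rightarrow> nat \<Rightarrow> nat"
  assumes n: "n > 0"
    and \<delta>: "i < n \<Longrightarrow> \<delta> i < n" "i < n \<Longrightarrow> \<delta> (\<delta> i) = i"
    and M_unit: "i < n \<Longrightarrow> j < n \<Longrightarrow> M s 0 i j = (if \<not> s \<and> i = j then 1 else 0)"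
    and M_dual: "i < n \<Longrightarrow> j < n \<Longrightarrow> M s i j 0 = (if \<not> s \<and> j = \<delta> i then 1 else 0)"
    and M_comm: "i < n \<Longrightarrow> j < n \<Longrightarrow> k < n \<Longrightarrow> M s i j k = M s j i k"
    and M_conj: "i < n \<Longrightarrow> j < n \<Longrightarrow> k < n \<Longrightarrow> M s (\<delta> i) (\<delta> j) (\<delta> k) = M s i j k"
    and M_assoc: "i < n \<Longrightarrow> j < n \<Longrightarrow> k < n \<Longrightarrow> l < n \<Longrightarrow>
      (\<Sum>m<n. M False i j m * M s m k l + M True i j m * M (\<not> s) m k l) =
      (\<Sum>m<n. M False j k m * M s i m l + M True j k m * M (\<not> s) i m l)"
begin

context
  fixes b :: "nat \<Rightarrow> bool"
  assumes b0: "\<not> b 0"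
begin

text \<open>True if the spin of x is the negative of the reference spin t of its class. Counted by
  grade instead of by position in the list of labels, multiplicities depend on the total parity
  alone, whatever signs b prescribes.\<close>

definition grade :: "nat \<Rightarrow> bool" where
  "grade x \<longleftrightarrow> (x \<ge> n) \<noteq> b (x mod n)"

definition fusion :: "nat \<Rightarrow> nat \<Rightarrow> nat \<Rightarrow> nat" where
  "fusion x y u = M (grade x \<noteq> (grade y \<noteq> grade u)) (x mod n) (y mod n) (u mod n)"

definition dual :: "nat \<Rightarrow> nat" where
  "dual x = (if grade x = b (\<delta> (x mod n)) then \<delta> (x mod n) else \<delta> (x mod n) + n)"

lemma mod_n: "x mod n < n"
  using n by simp

lemma label_eq_iff: "x < 2 * n \<Longrightarrow> y < 2 * n \<Longrightarrow> x = y \<longleftrightarrow> x mod n = y mod n \<and> grade x = grade y"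
  by (auto simp: grade_def mod_if split: if_splits)

lemma dual_mod: "dual x mod n = \<delta> (x mod n)" and dual_less: "dual x < 2 * n"
  using \<delta>(1)[OF mod_n, of x] by (simp_all add: dual_def)

lemma grade_dual: "grade (dual x) = grade x"
proof -
  have "dual x \<ge> n \<longleftrightarrow> grade x \<noteq> b (\<delta> (x mod n))"
    using \<delta>(1)[OF mod_n, of x] by (simp add: dual_def)
  then show ?thesis unfolding grade_def[of "dual x"] dual_mod by blast
qed

lemma dual_dual: "x < 2 * n \<Longrightarrow> dual (dual x) = x"
  using label_eq_iff[OF dual_less] \<delta>(2)[OF mod_n] by (simp add: dual_mod grade_dual)

text \<open>Each class modulo n has two labels of opposite grade; b decides which of them comes
  first and drops out of the sum.\<close>

lemma sum_labels: "(\<Sum>m<2*n. f (m mod n) (grade m)) = (\<Sum>m<n. f m False + f m True)"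
  for f :: "nat \<Rightarrow> bool \<Rightarrow> 'a::comm_monoid_add"
proof -
  have "{..<2*n} = {..<n} \<union> (\<lambda>m. m + n) ` {..<n}"
  proof (intro equalityI subsetI)
    fix x assume x: "x \<in> {..<2 * n}"
    show "x \<in> {..<n} \<union> (\<lambda>m. m + n) ` {..<n}"
    proof (cases "x < n")
      case False
      then have "x = (x - n) + n" "x - n \<in> {..<n}" using x by auto
      then show ?thesis by blast
    qed simp
  qed auto
  then have "(\<Sum>m<2*n. f (m mod n) (grade m)) =
      (\<Sum>m<n. f (m mod n) (grade m)) + (\<Sum>m\<in>(\<lambda>m. m + n) ` {..<n}. f (m mod n) (grade m))"
    by (simp only:) (rule sum.union_disjoint, auto)
  also have "\<dots> = (\<Sum>m<n. f m (b m)) + (\<Sum>m<n. f m (\<not> b m))"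
    by (subst sum.reindex) (auto simp: grade_def intro!: arg_cong2[where f = "(+)"] sum.cong)
  also have "\<dots> = (\<Sum>m<n. f m False + f m True)"
  proof -
    have "f m (b m) + f m (\<not> b m) = f m False + f m True" for m
      by (cases "b m") (simp_all add: add.commute)
    then show ?thesis unfolding sum.distrib[symmetric] by simp
  qed
  finally show ?thesis .
qed

lemma fusion_rules: "fusion_rules (2 * n) fusion dual"
  unfolding fusion_rules_def
proof (intro conjI allI impI)
  fix x y u v assume l: "x < 2 * n" "y < 2 * n" "u < 2 * n" "v < 2 * n"
  show "(\<Sum>m<2*n. fusion x y m * fusion m u v) = (\<Sum>m<2*n. fusion y u m * fusion x m v)"
  proof -
    have "(\<Sum>m<2*n. fusion x y m * fusion m u v) =
      (\<Sum>m<n. M (grade x \<noteq> (grade y \<noteq> False)) (x mod n) (y mod n) m * M (False \<noteq> (grade u \<noteq> grade v)) m (u mod n) (v mod n) +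
        M (grade x \<noteq> (grade y \<noteq> True)) (x mod n) (y mod n) m * M (True \<noteq> (grade u \<noteq> grade v)) m (u mod n) (v mod n))"
      unfolding fusion_def by (rule sum_labels)
    moreover have "(\<Sum>m<2*n. fusion y u m * fusion x m v) =
      (\<Sum>m<n. M (grade y \<noteq> (grade u \<noteq> False)) (y mod n) (u mod n) m * M (grade x \<noteq> (False \<noteq> grade v)) (x mod n) m (v mod n) +
        M (grade y \<noteq> (grade u \<noteq> True)) (y mod n) (u mod n) m * M (grade x \<noteq> (True \<noteq> grade v)) (x mod n) m (v mod n))"
      unfolding fusion_def by (rule sum_labels)
    moreover have "M (p \<noteq> (q \<noteq> False)) i j m * M (False \<noteq> w) m k l + M (p \<noteq> (q \<noteq> True)) i j m * M (True \<noteq> w) m k l =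
        M False i j m * M (p \<noteq> (q \<noteq> w)) m k l + M True i j m * M (\<not> (p \<noteq> (q \<noteq> w))) m k l" for p q w i j k l m
      by (cases p; cases q; cases w) simp_all
    moreover have "M (q \<noteq> (r \<noteq> False)) j k m * M (p \<noteq> (False \<noteq> w)) i m l + M (q \<noteq> (r \<noteq> True)) j k m * M (p \<noteq> (True \<noteq> w)) i m l =
        M False j k m * M (p \<noteq> (q \<noteq> (r \<noteq> w))) i m l + M True j k m * M (\<not> (p \<noteq> (q \<noteq> (r \<noteq> w)))) i m l" for p q r w i j k l m
      by (cases p; cases q; cases r; cases w) simp_all
    ultimately show ?thesis
      using M_assoc[of "x mod n" "y mod n" "u mod n" "v mod n" "grade x \<noteq> (grade y \<noteq> (grade u \<noteq> grade v))"] mod_n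
      by (simp only:)
  qed
next
  fix x assume "x < 2 * n"
  then show "dual x < 2 * n" "dual (dual x) = x" by (simp_all add: dual_less dual_dual)
next
  fix x y assume l: "x < 2 * n" "y < 2 * n"
  have g0: "\<not> grade 0" using b0 n by (simp add: grade_def)
  show "fusion 0 x y = (if x = y then 1 else 0)"
    using M_unit[OF mod_n mod_n] label_eq_iff[OF l] g0 by (simp add: fusion_def)
  show "fusion x y 0 = (if y = dual x then 1 else 0)"
    using M_dual[OF mod_n mod_n] label_eq_iff[OF l(2) dual_less] g0 by (auto simp: fusion_def dual_mod grade_dual)
next
  fix x y u
  show "fusion x y u = fusion y x u"
  proof -
    have "(grade x \<noteq> (grade y \<noteq> grade u)) = (grade y \<noteq> (grade x \<noteq> grade u))" by blast
    then show ?thesis unfolding fusion_def by (simp only: M_comm[OF mod_n mod_n mod_n, of _ x y u])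
  qed
  show "fusion (dual x) (dual y) (dual u) = fusion x y u"
    using M_conj[OF mod_n mod_n mod_n] by (simp add: fusion_def dual_mod grade_dual)
qed

lemma grade_partner: "x < 2 * n \<Longrightarrow> grade (partner n x) = (\<not> grade x)" "x < 2 * n \<Longrightarrow> partner n x mod n = x mod n"
  "x < 2 * n \<Longrightarrow> partner n x < 2 * n"
  by (auto simp: grade_def partner_def mod_if)

lemma fusion_fermion:
  assumes "x < 2 * n" "y < 2 * n"
  shows "fusion n x y = (if y = partner n x then 1 else 0)"
proof -
  have "grade n" using b0 n by (simp add: grade_def)
  then show ?thesis
    using M_unit[OF mod_n mod_n] label_eq_iff[OF assms(2) grade_partner(3)[OF assms(1)]] grade_partner(1,2)[OF assms(1)]
    by (auto simp: fusion_def)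
qed

lemma fusion_sum:
  assumes "i < n" "j < n" "k < n"
  shows "fusion i j k + fusion i j (partner n k) = M False i j k + M True i j k"
proof -
  have k: "k < 2 * n" using assms by simp
  have "i mod n = i" "j mod n = j" "k mod n = k" using assms by simp_all
  then show ?thesis
    unfolding fusion_def grade_partner(1,2)[OF k]
    by (cases "grade i"; cases "grade j"; cases "grade k") simp_all
qed

text \<open>Partners have opposite spins and equal rows in the full S-matrix. The four equations
  over a pair of classes therefore agree up to a common sign on both sides, and partners contribute
  to the sum with opposite signs: one n x n equation in the difference of \<open>M False\<close> and
  \<open>M True\<close> remains.\<close>

lemma balanced:
  fixes S :: "complex mat" and \<theta> t :: "nat \<Rightarrow> complex"
  assumes S: "S \<in> carrier_mat n n" and x: "x > 0" "S $$ (0, 0) = of_real x" and D: "Dsq n S = 2 / (S $$ (0, 0))\<^sup>2"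
    and verlinde: "\<And>i j k. i < n \<Longrightarrow> j < n \<Longrightarrow> k < n \<Longrightarrow> verlinde n S i j k = of_nat (M False i j k + M True i j k)"
    and t: "\<And>i. i < n \<Longrightarrow> t i \<noteq> 0" and \<theta>: "\<And>i. i < n \<Longrightarrow> \<theta> i = (if b i then - t i else t i)"
    and balance: "\<And>i j. i < n \<Longrightarrow> j < n \<Longrightarrow> S $$ (i, j) * t i * t j =
      (\<Sum>k<n. (of_nat (M False (\<delta> i) j k) - of_nat (M True (\<delta> i) j k)) * t k * S $$ (0, k))"
  shows "balanced_full_fusion n S \<theta> fusion dual"
  unfolding balanced_full_fusion_def
proof (intro conjI allI impI)
  show "fusion_rules (2 * n) fusion dual" by (rule fusion_rules)
  show "fusion n i j = (if j = partner n i then 1 else 0)" if "i < 2 * n" "j < 2 * n" for i j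
    using that by (rule fusion_fermion)
  show "verlinde n S i j k = of_nat (fusion i j k + fusion i j (partner n k))" if "i < n" "j < n" "k < n" for i j k
    using that by (simp only: verlinde fusion_sum)
  fix i j assume ij: "i < 2 * n" "j < 2 * n"
  define sg :: "bool \<Rightarrow> complex" where "sg g = (if g then - 1 else 1)" for g
  have spin: "full_spin n \<theta> k = sg (grade k) * t (k mod n)" if "k < 2 * n" for k
  proof (cases "k < n")
    case True
    then show ?thesis using \<theta>[of k] by (simp add: full_spin_def sg_def grade_def)
  next
    case False
    then have "k mod n = k - n" "k - n < n" using that by (simp_all add: mod_if)
    then show ?thesis using False \<theta>[of "k - n"] by (simp add: full_spin_def sg_def grade_def)
  qed
  have "Dsq n S = of_real (2 / x\<^sup>2)" using x by (simp add: D)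
  \<comment> \<open>Positivity of S_00 makes D = sqrt 2 / S_00 the principal square root.\<close>
  then have cs: "csqrt (Dsq n S) = of_real (sqrt 2 / x)"
    using x(1) by (simp add: real_sqrt_divide csqrt_of_real_nonneg)
  let ?i = "i mod n" and ?j = "j mod n"
  have ij': "?i < n" "?j < n" by (rule mod_n)+
  have "(\<Sum>k<2*n. of_nat (fusion (dual i) j k) * full_spin n \<theta> k * full_qdim n S k) =
      (\<Sum>k<2*n. of_nat (M (grade i \<noteq> (grade j \<noteq> grade k)) (\<delta> ?i) ?j (k mod n)) * (sg (grade k) * t (k mod n)) * qdim S (k mod n))"
    by (rule sum.cong) (simp_all add: fusion_def dual_mod grade_dual spin full_qdim_def)
  also have "\<dots> = (\<Sum>k<n. of_nat (M (grade i \<noteq> (grade j \<noteq> False)) (\<delta> ?i) ?j k) * (sg False * t k) * qdim S k +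
      of_nat (M (grade i \<noteq> (grade j \<noteq> True)) (\<delta> ?i) ?j k) * (sg True * t k) * qdim S k)"
    by (rule sum_labels)
  also have "\<dots> = (\<Sum>k<n. sg (grade i) * sg (grade j) *
      ((of_nat (M False (\<delta> ?i) ?j k) - of_nat (M True (\<delta> ?i) ?j k)) * t k * S $$ (0, k)) / of_real x)"
    using x(1) by (cases "grade i"; cases "grade j")
      (simp_all add: sg_def qdim_def x(2) expand_simps)
  also have "\<dots> = sg (grade i) * sg (grade j) * (S $$ (?i, ?j) * t ?i * t ?j) / of_real x"
    unfolding balance[OF ij'] by (simp add: sum_distrib_left sum_divide_distrib)
  finally have sum: "(\<Sum>k<2*n. of_nat (fusion (dual i) j k) * full_spin n \<theta> k * full_qdim n S k) =
      sg (grade i) * sg (grade j) * (S $$ (?i, ?j) * t ?i * t ?j) / of_real x" .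
  have div: "i div n < 2" "j div n < 2" using ij by (simp_all add: less_mult_imp_div_less)
  have "full_S S $$ (i, j) = S $$ (?i, ?j) / of_real (sqrt 2)"
    using S ij div unfolding full_S_def kron_def by (auto simp: mat_of_rows_list_def less_2_cases_iff)
  also have "\<dots> = 1 / of_real (sqrt 2 / x) * inverse (sg (grade i) * t ?i) * inverse (sg (grade j) * t ?j) *
      (sg (grade i) * sg (grade j) * (S $$ (?i, ?j) * t ?i * t ?j) / of_real x)"
    using t[OF ij'(1)] t[OF ij'(2)] x(1) by (simp add: sg_def field_simps)
  finally show "full_S S $$ (i, j) = 1 / csqrt (Dsq n S) * inverse (full_spin n \<theta> i) * inverse (full_spin n \<theta> j) *
      (\<Sum>k<2*n. of_nat (fusion (dual i) j k) * full_spin n \<theta> k * full_qdim n S k)"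
    unfolding sum cs spin[OF ij(1)] spin[OF ij(2)] .
qed

end

text \<open>An admissible choice of spins differs from t by signs on a set b of labels that omits
  the vacuum, so a table M verified for t serves all choices.\<close>

lemma has_full_fusion_rules:
  fixes S :: "complex mat" and t :: "nat \<Rightarrow> complex"
  assumes "S \<in> carrier_mat n n" "x > 0" "S $$ (0, 0) = of_real x" "Dsq n S = 2 / (S $$ (0, 0))\<^sup>2"
    and "\<And>i j k. i < n \<Longrightarrow> j < n \<Longrightarrow> k < n \<Longrightarrow> verlinde n S i j k = of_nat (M False i j k + M True i j k)"
    and t: "\<And>i. i < n \<Longrightarrow> t i \<noteq> 0" "t 0 = 1" "\<And>i. i < n \<Longrightarrow> T2 $$ (i, i) = (t i)\<^sup>2"
    and "\<And>i j. i < n \<Longrightarrow> j < n \<Longrightarrow> S $$ (i, j) * t i * t j =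
      (\<Sum>k<n. (of_nat (M False (\<delta> i) j k) - of_nat (M True (\<delta> i) j k)) * t k * S $$ (0, k))"
  shows "has_full_fusion_rules n S T2"
  unfolding has_full_fusion_rules_def
proof (intro allI impI)
  fix \<theta> :: "nat \<Rightarrow> complex"
  assume \<theta>: "\<theta> 0 = 1 \<and> (\<forall>i<n. (\<theta> i)\<^sup>2 = T2 $$ (i, i))"
  define b where "b i \<longleftrightarrow> \<theta> i \<noteq> t i" for i
  have b0: "\<not> b 0" using \<theta> t(2) by (simp add: b_def)
  have "\<theta> i = (if b i then - t i else t i)" if "i < n" for i
    using \<theta> t(3)[OF that] that by (auto simp: b_def power2_eq_iff)
  note sign = this
  have "balanced_full_fusion n S \<theta> (fusion b) (dual b)"
  proof (rule balanced[of b S x t \<theta>])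
    show "\<theta> i = (if b i then - t i else t i)" if "i < n" for i using that by (rule sign)
  qed (fact b0 assms(1-6,9))+
  then show "\<exists>N dual. balanced_full_fusion n S \<theta> N dual" by blast
qed

end

section \<open>Splitting the fusion tables between labels and partners\<close>

definition even_A :: "nat list list list" where
  "even_A = [[[1, 0, 0, 0, 0], [0, 1, 0, 0, 0], [0, 0, 1, 0, 0], [0, 0, 0, 1, 0], [0, 0, 0, 0, 1]],
    [[0, 1, 0, 0, 0], [1, 1, 1, 1, 1], [0, 1, 2, 1, 1], [0, 1, 1, 0, 1], [0, 1, 1, 1, 0]],
    [[0, 0, 1, 0, 0], [0, 1, 2, 1, 1], [1, 2, 2, 1, 1], [0, 1, 1, 1, 1], [0, 1, 1, 1, 1]],
    [[0, 0, 0, 1, 0], [0, 1, 1, 0, 1], [0, 1, 1, 1, 1], [1, 0, 1, 1, 0], [0, 1, 1, 0, 0]],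
    [[0, 0, 0, 0, 1], [0, 1, 1, 1, 0], [0, 1, 1, 1, 1], [0, 1, 1, 0, 0], [1, 0, 1, 0, 1]]]"

text \<open>\<open>even_A\<close> and \<open>odd_A\<close> add up to \<open>N_A\<close>. The split
  belongs to the spins 1, 1, w^2, z^3, z^2.\<close>

definition odd_A :: "nat list list list" where
  "odd_A = [[[0, 0, 0, 0, 0], [0, 0, 0, 0, 0], [0, 0, 0, 0, 0], [0, 0, 0, 0, 0], [0, 0, 0, 0, 0]],
    [[0, 0, 0, 0, 0], [0, 1, 1, 1, 1], [0, 1, 1, 1, 1], [0, 1, 1, 1, 1], [0, 1, 1, 1, 1]],
    [[0, 0, 0, 0, 0], [0, 1, 1, 1, 1], [0, 1, 1, 1, 1], [0, 1, 1, 1, 1], [0, 1, 1, 1, 1]],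
    [[0, 0, 0, 0, 0], [0, 1, 1, 1, 1], [0, 1, 1, 1, 1], [0, 1, 1, 1, 1], [0, 1, 1, 1, 1]],
    [[0, 0, 0, 0, 0], [0, 1, 1, 1, 1], [0, 1, 1, 1, 1], [0, 1, 1, 1, 1], [0, 1, 1, 1, 1]]]"

definition even_B :: "nat list list list" where
  "even_B = [[[1, 0, 0, 0, 0], [0, 1, 0, 0, 0], [0, 0, 1, 0, 0], [0, 0, 0, 1, 0], [0, 0, 0, 0, 1]],
    [[0, 1, 0, 0, 0], [1, 2, 1, 1, 2], [0, 1, 1, 1, 1], [0, 1, 1, 1, 1], [0, 2, 1, 1, 1]],
    [[0, 0, 1, 0, 0], [0, 1, 1, 1, 1], [0, 1, 0, 1, 1], [1, 1, 0, 0, 0], [0, 1, 0, 1, 1]],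
    [[0, 0, 0, 1, 0], [0, 1, 1, 1, 1], [1, 1, 0, 0, 0], [0, 1, 1, 0, 1], [0, 1, 1, 0, 1]],
    [[0, 0, 0, 0, 1], [0, 2, 1, 1, 1], [0, 1, 0, 1, 1], [0, 1, 1, 0, 1], [1, 1, 1, 1, 1]]]"

text \<open>\<open>even_B\<close> and \<open>odd_B\<close> add up to \<open>N_B\<close>. The split
  belongs to the spins 1, 1, i, i, w^2.\<close>

definition odd_B :: "nat list list list" where
  "odd_B = [[[0, 0, 0, 0, 0], [0, 0, 0, 0, 0], [0, 0, 0, 0, 0], [0, 0, 0, 0, 0], [0, 0, 0, 0, 0]],
    [[0, 0, 0, 0, 0], [0, 2, 1, 1, 2], [0, 1, 1, 0, 1], [0, 1, 0, 1, 1], [0, 2, 1, 1, 2]],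
    [[0, 0, 0, 0, 0], [0, 1, 1, 0, 1], [0, 0, 0, 1, 0], [0, 1, 0, 0, 1], [0, 1, 1, 0, 1]],
    [[0, 0, 0, 0, 0], [0, 1, 0, 1, 1], [0, 1, 0, 0, 1], [0, 0, 1, 0, 0], [0, 1, 0, 1, 1]],
    [[0, 0, 0, 0, 0], [0, 2, 1, 1, 2], [0, 1, 1, 0, 1], [0, 1, 0, 1, 1], [0, 2, 1, 1, 2]]]"

(* code_simp evaluates this form of the sum without any set operations. *)
definition sum_five :: "(nat \<Rightarrow> nat) \<Rightarrow> nat" where
  "sum_five f = f 0 + f 1 + f 2 + f 3 + f 4"

text \<open>The conjuncts are the two graded components of associativity, over all 625 quadruples of
  labels.\<close>

definition assoc_table :: "nat list list list \<Rightarrow> nat list list list \<Rightarrow> bool" where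
  "assoc_table E D \<longleftrightarrow> (let L = [0, 1, 2, 3, 4] in
    list_all (\<lambda>i. list_all (\<lambda>j. list_all (\<lambda>k. list_all (\<lambda>l.
      sum_five (\<lambda>m. E ! i ! j ! m * E ! m ! k ! l + D ! i ! j ! m * D ! m ! k ! l) =
        sum_five (\<lambda>m. E ! j ! k ! m * E ! i ! m ! l + D ! j ! k ! m * D ! i ! m ! l) \<and>
      sum_five (\<lambda>m. E ! i ! j ! m * D ! m ! k ! l + D ! i ! j ! m * E ! m ! k ! l) =
        sum_five (\<lambda>m. E ! j ! k ! m * D ! i ! m ! l + D ! j ! k ! m * E ! i ! m ! l)) L) L) L) L)"

lemma assoc_tableD:
  assumes "assoc_table E D" "i < 5" "j < 5" "k < 5" "l < 5"
  shows "(\<Sum>m<5. (if False then D else E) ! i ! j ! m * (if s then D else E) ! m ! k ! l +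
      (if True then D else E) ! i ! j ! m * (if \<not> s then D else E) ! m ! k ! l) =
    (\<Sum>m<5. (if False then D else E) ! j ! k ! m * (if s then D else E) ! i ! m ! l +
      (if True then D else E) ! j ! k ! m * (if \<not> s then D else E) ! i ! m ! l)"
proof -
  have L: "x \<in> set [0, 1, 2, 3, 4]" if "x < 5" for x :: nat using less5_cases[OF that] by auto
  have "sum_five (\<lambda>m. E ! i ! j ! m * E ! m ! k ! l + D ! i ! j ! m * D ! m ! k ! l) =
        sum_five (\<lambda>m. E ! j ! k ! m * E ! i ! m ! l + D ! j ! k ! m * D ! i ! m ! l) \<and>
      sum_five (\<lambda>m. E ! i ! j ! m * D ! m ! k ! l + D ! i ! j ! m * E ! m ! k ! l) =
        sum_five (\<lambda>m. E ! j ! k ! m * D ! i ! m ! l + D ! j ! k ! m * E ! i ! m ! l)"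
    using assms(1) L[OF assms(2)] L[OF assms(3)] L[OF assms(4)] L[OF assms(5)]
    unfolding assoc_table_def Let_def list_all_iff by blast
  then show ?thesis unfolding sum5 sum_five_def if_True if_False by (cases s) simp_all
qed

lemma assoc_table_A: "assoc_table even_A odd_A" and assoc_table_B: "assoc_table even_B odd_B"
  by code_simp+

lemma graded_fusion_A: "graded_fusion 5 id (\<lambda>s i j k. (if s then odd_A else even_A) ! i ! j ! k)"
proof
  fix i j k l :: nat and s assume "i < 5" "j < 5" "k < 5" "l < 5"
  then show "(\<Sum>m<5. (if False then odd_A else even_A) ! i ! j ! m * (if s then odd_A else even_A) ! m ! k ! l +
      (if True then odd_A else even_A) ! i ! j ! m * (if \<not> s then odd_A else even_A) ! m ! k ! l) =
    (\<Sum>m<5. (if False then odd_A else even_A) ! j ! k ! m * (if s then odd_A else even_A) ! i ! m ! l +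
      (if True then odd_A else even_A) ! j ! k ! m * (if \<not> s then odd_A else even_A) ! i ! m ! l)"
    by (rule assoc_tableD[OF assoc_table_A])
next
  fix i j k :: nat and s assume ijk: "i < 5" "j < 5" "k < 5"
  note c = ijk[THEN less5_cases]
  show "(if s then odd_A else even_A) ! i ! j ! k = (if s then odd_A else even_A) ! j ! i ! k"
    using c by (elim disjE) (simp_all add: even_A_def odd_A_def)
next
  fix i j :: nat and s assume ij: "i < 5" "j < 5"
  note c = ij[THEN less5_cases]
  show "(if s then odd_A else even_A) ! 0 ! i ! j = (if \<not> s \<and> i = j then 1 else 0)"
    "(if s then odd_A else even_A) ! i ! j ! 0 = (if \<not> s \<and> j = id i then 1 else 0)"
    using c by (elim disjE; simp add: even_A_def odd_A_def)+
qed simp_all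

lemma graded_fusion_B: "graded_fusion 5 (transpose 2 3) (\<lambda>s i j k. (if s then odd_B else even_B) ! i ! j ! k)"
proof
  fix i j k l :: nat and s assume "i < 5" "j < 5" "k < 5" "l < 5"
  then show "(\<Sum>m<5. (if False then odd_B else even_B) ! i ! j ! m * (if s then odd_B else even_B) ! m ! k ! l +
      (if True then odd_B else even_B) ! i ! j ! m * (if \<not> s then odd_B else even_B) ! m ! k ! l) =
    (\<Sum>m<5. (if False then odd_B else even_B) ! j ! k ! m * (if s then odd_B else even_B) ! i ! m ! l +
      (if True then odd_B else even_B) ! j ! k ! m * (if \<not> s then odd_B else even_B) ! i ! m ! l)"
    by (rule assoc_tableD[OF assoc_table_B])
next
  fix i j k :: nat and s assume ijk: "i < 5" "j < 5" "k < 5"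
  note c = ijk[THEN less5_cases]
  show "(if s then odd_B else even_B) ! i ! j ! k = (if s then odd_B else even_B) ! j ! i ! k"
    using c by (elim disjE) (simp_all add: even_B_def odd_B_def)
  show "(if s then odd_B else even_B) ! (transpose 2 3 i) ! (transpose 2 3 j) ! (transpose 2 3 k) =
      (if s then odd_B else even_B) ! i ! j ! k"
    using c by (elim disjE) (simp_all add: even_B_def odd_B_def transpose_def)
next
  fix i j :: nat and s assume ij: "i < 5" "j < 5"
  note c = ij[THEN less5_cases]
  show "(if s then odd_B else even_B) ! 0 ! i ! j = (if \<not> s \<and> i = j then 1 else 0)"
    "(if s then odd_B else even_B) ! i ! j ! 0 = (if \<not> s \<and> j = transpose 2 3 i then 1 else 0)"
    using c by (elim disjE; simp add: even_B_def odd_B_def transpose_def)+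
qed (simp_all add: transpose_def)

text \<open>Since w and z have odd order, w, z and z^4 have the square roots w^2, z^3 and z^2 among
  their own powers. The balancing equation mixes q with powers of z, so q is finally expanded as a
  Gauss sum.\<close>

lemma (in unitary_data_A) full_fusion:
  assumes "positive_real (p - q)"
  shows "has_full_fusion_rules 5 (S5_A p q) (T5_A w z)"
proof -
  interpret G: graded_fusion 5 id "\<lambda>s i j k. (if s then odd_A else even_A) ! i ! j ! k" by (rule graded_fusion_A)
  obtain x where x: "x > 0" "p - q = of_real x" using assms by (auto simp: positive_real_def)
  obtain e1 e2 e3 e4 where e: "e1 = z" "e2 = z\<^sup>2" "e3 = z ^ 3" "e4 = z ^ 4" by blast
  note ze = z_rules(3-)[OF e]
  show ?thesis
  proof (rule G.has_full_fusion_rules)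
    show "S5_A p q \<in> carrier_mat 5 5" by (simp add: S5_A_def)
    show "x / 2 > 0" using x by simp
    show "S5_A p q $$ (0, 0) = of_real (x / 2)" using x by (simp add: S5_A_def)
    show "Dsq 5 (S5_A p q) = 2 / (S5_A p q $$ (0, 0))\<^sup>2"
      unfolding power2_eq_square Dsq_S5_A(2)[symmetric] by simp
    fix i assume i: "i < (5::nat)"
    have "- 1 - w \<noteq> 0"
    proof
      assume "- 1 - w = 0"
      then have "w = - 1" by (simp add: algebra_simps)
      then show False using w by simp
    qed
    then show "[1, 1, - 1 - w, e3, e2] ! i \<noteq> 0"
      using less5_cases[OF i] z_ne by (elim disjE) (simp_all add: e)
    have "T5_A w z $$ (i, i) = [1, 1, w, e1, e4] ! i" using i by (simp add: T5_A_def e)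
    then show "T5_A w z $$ (i, i) = ([1, 1, - 1 - w, e3, e2] ! i)\<^sup>2"
      using less5_cases[OF i] by (elim disjE) (simp_all add: power2_eq_square algebra_simps w ze)
    fix k assume k: "k < (5::nat)"
    show "S5_A p q $$ (i, k) * [1, 1, - 1 - w, e3, e2] ! i * [1, 1, - 1 - w, e3, e2] ! k =
      (\<Sum>m<5. (of_nat ((if False then odd_A else even_A) ! (id i) ! k ! m) -
        of_nat ((if True then odd_A else even_A) ! (id i) ! k ! m)) * [1, 1, - 1 - w, e3, e2] ! m * S5_A p q $$ (0, m))"
      unfolding sum5 using less5_cases[OF i] less5_cases[OF k]
      by (elim disjE; (simp add: S5_A_def even_A_def odd_A_def;
        (simp add: expand_simps pp qq p2 q2 ze w w3(2);
          (simp add: z_rules[OF e] expand_simps; fail)?)?))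
  next
    fix i j k :: nat assume ijk: "i < 5" "j < 5" "k < 5"
    note c = ijk[THEN less5_cases]
    show "verlinde 5 (S5_A p q) i j k =
        of_nat ((if False then odd_A else even_A) ! i ! j ! k + (if True then odd_A else even_A) ! i ! j ! k)"
      unfolding verlinde_S5_A[OF ijk] using c by (elim disjE) (simp_all add: N_A_def even_A_def odd_A_def)
  qed simp
qed

lemma (in unitary_data_B) full_fusion:
  assumes "positive_real (r - p)"
  shows "has_full_fusion_rules 5 (S5_B p r) (T5_B w)"
proof -
  interpret G: graded_fusion 5 "transpose 2 3" "\<lambda>s i j k. (if s then odd_B else even_B) ! i ! j ! k"
    by (rule graded_fusion_B)
  obtain x where x: "x > 0" "r - p = of_real x" using assms by (auto simp: positive_real_def)
  show ?thesis
  proof (rule G.has_full_fusion_rules)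
    show "S5_B p r \<in> carrier_mat 5 5" by (simp add: S5_B_def)
    show "x / 2 > 0" using x by simp
    show "S5_B p r $$ (0, 0) = of_real (x / 2)" using x by (simp add: S5_B_def)
    show "Dsq 5 (S5_B p r) = 2 / (S5_B p r $$ (0, 0))\<^sup>2"
      unfolding power2_eq_square Dsq_S5_B(2)[symmetric] by simp
    fix i assume i: "i < (5::nat)"
    have "- 1 - w \<noteq> 0"
    proof
      assume "- 1 - w = 0"
      then have "w = - 1" by (simp add: algebra_simps)
      then show False using w by simp
    qed
    then show "[1, 1, \<i>, \<i>, - 1 - w] ! i \<noteq> 0"
      using less5_cases[OF i] by (elim disjE) simp_all
    show "T5_B w $$ (i, i) = ([1, 1, \<i>, \<i>, - 1 - w] ! i)\<^sup>2"
      using less5_cases[OF i] by (elim disjE) (simp_all add: T5_B_def, simp_all add: power2_eq_square algebra_simps w)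
    fix k assume k: "k < (5::nat)"
    show "S5_B p r $$ (i, k) * [1, 1, \<i>, \<i>, - 1 - w] ! i * [1, 1, \<i>, \<i>, - 1 - w] ! k =
      (\<Sum>m<5. (of_nat ((if False then odd_B else even_B) ! (transpose 2 3 i) ! k ! m) -
        of_nat ((if True then odd_B else even_B) ! (transpose 2 3 i) ! k ! m)) * [1, 1, \<i>, \<i>, - 1 - w] ! m * S5_B p r $$ (0, m))"
      unfolding sum5 using less5_cases[OF i] less5_cases[OF k]
      \<comment> \<open>The balancing equation involves p, i and w together; they are related by the
        Gauss sum formula for p, hence its expansion in the last step.\<close>
      by (elim disjE; (simp add: S5_B_def even_B_def odd_B_def transpose_def;
        (simp add: expand_simps pp rr p2 r2 w w3(2) i2;
          (simp add: p expand_simps rr r2 w w3(2) i2; fail)?)?))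
  next
    fix i j k :: nat assume ijk: "i < 5" "j < 5" "k < 5"
    note c = ijk[THEN less5_cases]
    show "verlinde 5 (S5_B p r) i j k =
        of_nat ((if False then odd_B else even_B) ! i ! j ! k + (if True then odd_B else even_B) ! i ! j ! k)"
      unfolding verlinde_S5_B[OF ijk] using c by (elim disjE) (simp_all add: N_B_def even_B_def odd_B_def)
  qed simp
qed

subsection \<open>Primitivity\<close>

lemma mult_mat_entry:
  assumes "A \<in> carrier_mat n n" "B \<in> carrier_mat n n" "a < n" "b < n"
  shows "(A * B) $$ (a, b) = (\<Sum>m<n. A $$ (a, m) * B $$ (m, b))"
  using assms by (simp add: scalar_prod_def atLeast0LessThan)

text \<open>Cancelling one S from (ST)^3 = l S^2 leaves T S T S T = l S, whose entries for diagonal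
  T are the stated equations.\<close>

lemma modular_data_relation:
  assumes "modular_data n S T"
  shows "\<exists>l. cmod l = 1 \<and> (\<forall>a<n. \<forall>b<n. T $$ (a, a) * T $$ (b, b) *
    (\<Sum>m<n. S $$ (a, m) * T $$ (m, m) * S $$ (m, b)) = l * S $$ (a, b))"
proof -
  obtain c :: real where c: "(S * T) ^\<^sub>m 3 = exp (2 * of_real pi * \<i> * of_real c / 8) \<cdot>\<^sub>m (S * S)"
    and S: "S \<in> carrier_mat n n" "S * mat_adjoint S = 1\<^sub>m n" and T: "T \<in> carrier_mat n n" "diagonal_mat T"
    using assms by (auto simp: modular_data_def is_unitary_def)
  define l where "l = exp (2 * of_real pi * \<i> * of_real c / 8)"
  have l: "cmod l = 1" by (simp add: l_def)
  define A where "A = mat_adjoint S"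
  have A: "A \<in> carrier_mat n n" using S(1) by (simp add: A_def mat_adjoint_def mat_of_rows_def)
  have AS: "A * S = 1\<^sub>m n" using mat_mult_left_right_inverse[OF S(1) A] S(2) by (simp add: A_def)
  have ST: "S * T \<in> carrier_mat n n" using S(1) T(1) by simp
  note assoc = assoc_mult_mat[of _ n n _ n _ n]
  have "(S * T) ^\<^sub>m 3 = (S * T) * (S * T) * (S * T)"
    using ST by (simp add: numeral_3_eq_3)
  then have "(S * T) * (S * T) * (S * T) = l \<cdot>\<^sub>m (S * S)" using c by (simp add: l_def)
  then have "A * ((S * T) * (S * T) * (S * T)) = A * (l \<cdot>\<^sub>m (S * S))" by simp
  also have "A * (l \<cdot>\<^sub>m (S * S)) = l \<cdot>\<^sub>m (A * S * S)"
    using A S(1) by (simp add: mult_smult_distrib[of _ n n _ n] assoc)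
  also have "A * ((S * T) * (S * T) * (S * T)) = A * S * (T * (S * T * S * T))"
    using A S(1) T(1) by (simp add: assoc)
  finally have "1\<^sub>m n * (T * (S * T * S * T)) = l \<cdot>\<^sub>m (1\<^sub>m n * S)" unfolding AS .
  then have eq: "T * (S * T * S * T) = l \<cdot>\<^sub>m S"
    using S(1) T(1) by simp
  have Td: "T = mat_diag n (\<lambda>i. T $$ (i, i))"
    by (rule eq_matI) (use T in \<open>auto simp: mat_diag_def diagonal_mat_def\<close>)
  have "T $$ (a, a) * T $$ (b, b) * (\<Sum>m<n. S $$ (a, m) * T $$ (m, m) * S $$ (m, b)) = l * S $$ (a, b)"
    if ab: "a < n" "b < n" for a b
  proof -
    define X where "X = S * T * S"
    have X: "X \<in> carrier_mat n n" using S(1) T(1) by (simp add: X_def)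
    have "(T * (X * T)) $$ (a, b) = T $$ (a, a) * (X * T) $$ (a, b)"
      using ab X T(1) by (subst (1) Td, subst mat_diag_mult_left[of _ n n]) auto
    also have "(X * T) $$ (a, b) = X $$ (a, b) * T $$ (b, b)"
      using ab X T(1) by (subst (1) Td, subst mat_diag_mult_right[of _ n n]) auto
    also have "X $$ (a, b) = (\<Sum>m<n. (S * T) $$ (a, m) * S $$ (m, b))"
      unfolding X_def by (rule mult_mat_entry[OF ST S(1) ab])
    also have "\<dots> = (\<Sum>m<n. S $$ (a, m) * T $$ (m, m) * S $$ (m, b))"
    proof (rule sum.cong[OF refl])
      fix m assume "m \<in> {..<n}"
      then show "(S * T) $$ (a, m) * S $$ (m, b) = S $$ (a, m) * T $$ (m, m) * S $$ (m, b)"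
        using ab S(1) T(1) by (subst (1) Td, subst mat_diag_mult_right[of _ n n]) auto
    qed
    finally have "(T * (X * T)) $$ (a, b) =
      T $$ (a, a) * ((\<Sum>m<n. S $$ (a, m) * T $$ (m, m) * S $$ (m, b)) * T $$ (b, b))" .
    moreover have "(T * (X * T)) $$ (a, b) = l * S $$ (a, b)"
      using eq ab S(1) by (simp add: X_def)
    ultimately show ?thesis by (simp add: ac_simps)
  qed
  then show ?thesis using l by blast
qed

lemma valid_carrier:
  assumes "valid_fermionic_data n S T2 c"
  shows "S \<in> carrier_mat n n" "T2 \<in> carrier_mat n n" "n > 0"
  using assms by (simp_all add: valid_fermionic_data_def is_unitary_def)

text \<open>Unitarity gives |S_00| = 1, and positivity picks the value 1.\<close>

lemma rank_one_data:
  assumes "valid_fermionic_data 1 S T2 c"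
  shows "S $$ (0, 0) = 1" "T2 $$ (0, 0) = 1"
proof -
  have S: "S \<in> carrier_mat 1 1" "S * mat_adjoint S = 1\<^sub>m 1" and p: "positive_real (S $$ (0, 0))"
    using assms by (simp_all add: valid_fermionic_data_def is_unitary_def)
  obtain x where x: "x > 0" "S $$ (0, 0) = of_real x" using p by (auto simp: positive_real_def)
  have "(S * mat_adjoint S) $$ (0, 0) = S $$ (0, 0) * cnj (S $$ (0, 0))"
    using S(1) mat_adjoint_index[OF S(1), of 0 0] by (simp add: scalar_prod_def mat_adjoint_def)
  then have "of_real (x * x) = (1 :: complex)" using S(2) x by simp
  then have "x * x = 1" using of_real_eq_1_iff by blast
  then have "x = 1" using x(1) by (simp add: square_eq_1_iff)
  then show "S $$ (0, 0) = 1" using x by simp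
  show "T2 $$ (0, 0) = 1" using assms by (simp add: valid_fermionic_data_def)
qed

(* A factorisation of a theory with a prime number of labels is a product of the trivial
   super-modular theory and a modular theory, whose spins e satisfy the modular relation. *)
lemma stack_of_two_prime:
  assumes "prime n" and stack: "stack_of_two n S T2"
  obtains e l where "cmod l = 1" "e 0 = 1" "\<And>i. i < n \<Longrightarrow> (e i)\<^sup>2 = T2 $$ (i, i)"
    "\<And>a b. a < n \<Longrightarrow> b < n \<Longrightarrow> e a * e b * (\<Sum>m<n. S $$ (a, m) * e m * S $$ (m, b)) = l * S $$ (a, b)"
proof -
  have dims: "n = n1 * n2" if "equal_up_to_relabelling n S T2 (kron S1 S2) X" "S1 \<in> carrier_mat n1 n1" "S2 \<in> carrier_mat n2 n2"
    for S1 S2 X n1 n2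
    using that by (auto simp: equal_up_to_relabelling_def kron_def)
  from stack show ?thesis
    unfolding stack_of_two_def
  proof (elim disjE exE conjE)
    fix n1 S1 T1 c1 n2 S2 T2' c2
    assume "n1 > 1" "n2 > 1" "valid_fermionic_data n1 S1 T1 c1" "valid_fermionic_data n2 S2 T2' c2"
      "equal_up_to_relabelling n S T2 (kron S1 S2) (kron T1 T2')"
    then have "n = n1 * n2" using dims valid_carrier by blast
    then show ?thesis using \<open>prime n\<close> \<open>n1 > 1\<close> \<open>n2 > 1\<close> prime_product by auto
  next
    fix n1 S1 T1 c1 n2 S2 T
    assume n2: "n2 > 1" and v: "valid_fermionic_data n1 S1 T1 c1" and m: "modular_data n2 S2 T"
      and e: "equal_up_to_relabelling n S T2 (kron S1 S2) (kron T1 (T * T))"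
    have S2: "S2 \<in> carrier_mat n2 n2" and T: "T \<in> carrier_mat n2 n2" "diagonal_mat T" "T $$ (0, 0) = 1"
      using m by (simp_all add: modular_data_def is_unitary_def)
    have "n = n1 * n2" using dims[OF e valid_carrier(1)[OF v] S2] .
    then have n1: "n1 = 1" "n2 = n" using \<open>prime n\<close> n2 prime_product by auto
    note v1 = v[unfolded n1(1)]
    note car = valid_carrier(1,2)[OF v1]
    note one = rank_one_data[OF v1]
    obtain p where p: "p permutes {..<n}" "p 0 = 0"
      "\<And>i j. i < n \<Longrightarrow> j < n \<Longrightarrow> S $$ (i, j) = kron S1 S2 $$ (p i, p j)"
      "\<And>i j. i < n \<Longrightarrow> j < n \<Longrightarrow> T2 $$ (i, j) = kron T1 (T * T) $$ (p i, p j)"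
      using e by (auto simp: equal_up_to_relabelling_def)
    have pn: "p i < n" if "i < n" for i using permutes_in_image[OF p(1), of i] that by simp
    have S: "S $$ (i, j) = S2 $$ (p i, p j)" if "i < n" "j < n" for i j
      using p(3)[OF that] pn[OF that(1)] pn[OF that(2)] S2 car one n1 by (simp add: kron_def)
    have TT: "(T * T) $$ (i, i) = (T $$ (i, i))\<^sup>2" if "i < n" for i
    proof -
      have "(T * T) $$ (i, i) = (\<Sum>m<n. T $$ (i, m) * T $$ (m, i))"
        using T that n1 by (simp add: scalar_prod_def atLeast0LessThan)
      also have "\<dots> = (\<Sum>m<n. if m = i then T $$ (i, i) * T $$ (i, i) else 0)"
        by (rule sum.cong) (use T that n1 in \<open>auto simp: diagonal_mat_def\<close>)
      also have "\<dots> = (T $$ (i, i))\<^sup>2" using that by (simp add: power2_eq_square)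
      finally show ?thesis .
    qed
    define e where "e i = T $$ (p i, p i)" for i
    obtain l where l: "cmod l = 1" "\<And>a b. a < n \<Longrightarrow> b < n \<Longrightarrow> T $$ (a, a) * T $$ (b, b) *
        (\<Sum>m<n. S2 $$ (a, m) * T $$ (m, m) * S2 $$ (m, b)) = l * S2 $$ (a, b)"
      using modular_data_relation[OF m] n1 by blast
    show ?thesis
    proof (rule that[OF l(1), of e])
      show "e 0 = 1" using T p by (simp add: e_def)
      show "(e i)\<^sup>2 = T2 $$ (i, i)" if "i < n" for i
        using p(4)[OF that that] pn[OF that] T car one n1 TT[OF pn[OF that]] by (simp add: kron_def e_def)
      fix a b assume ab: "a < n" "b < n"
      have "(\<Sum>m<n. S $$ (a, m) * e m * S $$ (m, b)) =
          (\<Sum>m<n. S2 $$ (p a, p m) * T $$ (p m, p m) * S2 $$ (p m, p b))"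
        by (rule sum.cong) (use ab in \<open>simp_all add: S e_def\<close>)
      also have "\<dots> = (\<Sum>m<n. S2 $$ (p a, m) * T $$ (m, m) * S2 $$ (m, p b))"
        using sum.permute[OF p(1), of "\<lambda>m. S2 $$ (p a, m) * T $$ (m, m) * S2 $$ (m, p b)"] by (simp add: comp_def)
      finally show "e a * e b * (\<Sum>m<n. S $$ (a, m) * e m * S $$ (m, b)) = l * S $$ (a, b)"
        using l(2)[OF pn[OF ab(1)] pn[OF ab(2)]] ab by (simp add: e_def S)
    qed
  qed
qed

text \<open>The relations for a, b in {0, 1} suffice. The two diagonal ones give e 1 = 1; then sum
  and difference of the relations separate the two blocks and yield l twice, as p (1 + 2 e 2) and as
  -q (1 + 2s). The first, with |l| = 1, gives l^2 = -1, hence (1 + 2s)^2 = -5. But s is a sum of z^3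
  and z^2 with signs, and every choice of signs contradicts q^2 = 1/5.\<close>

lemma (in unitary_data_A) primitive: "primitive_theory 5 (S5_A p q) (T5_A w z)"
  unfolding primitive_theory_def
proof
  assume "stack_of_two 5 (S5_A p q) (T5_A w z)"
  then obtain e l where l: "cmod l = 1" and e0: "e 0 = 1"
    and e: "\<And>i. i < 5 \<Longrightarrow> (e i)\<^sup>2 = T5_A w z $$ (i, i)"
    and rel: "\<And>a b. a < 5 \<Longrightarrow> b < 5 \<Longrightarrow> e a * e b * (\<Sum>m<5. S5_A p q $$ (a, m) * e m * S5_A p q $$ (m, b)) =
      l * S5_A p q $$ (a, b)"
    by (rule stack_of_two_prime[rotated]) simp_all
  have e1: "e 1 * e 1 = 1" and e2: "e 2 * e 2 = w" and e3: "e 3 * e 3 = z" and e4: "e 4 * e 4 = z ^ 4"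
    using e[of 1] e[of 2] e[of 3] e[of 4] by (simp_all add: T5_A_def power2_eq_square)
  define s0 s1 where s0: "s0 = (p - q) / 2" and s1: "s1 = (p + q) / 2"
  have S: "S5_A p q $$ (0, 0) = s0" "S5_A p q $$ (0, 1) = s1" "S5_A p q $$ (1, 0) = s1" "S5_A p q $$ (1, 1) = s0"
    "S5_A p q $$ (0, 2) = p" "S5_A p q $$ (0, 3) = q" "S5_A p q $$ (0, 4) = q"
    "S5_A p q $$ (1, 2) = p" "S5_A p q $$ (1, 3) = - q" "S5_A p q $$ (1, 4) = - q"
    "S5_A p q $$ (2, 0) = p" "S5_A p q $$ (3, 0) = q" "S5_A p q $$ (4, 0) = q"
    "S5_A p q $$ (2, 1) = p" "S5_A p q $$ (3, 1) = - q" "S5_A p q $$ (4, 1) = - q"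
    by (simp_all add: S5_A_def s0 s1)
  have sum: "s0 + s1 = p" "s0 - s1 = - q" unfolding s0 s1 by (simp_all add: field_simps)
  define s where "s = e 3 + e 4"
  have r00: "s0 * s0 + e 1 * (s1 * s1) + p * p * e 2 + q * q * s = l * s0"
    using rel[of 0 0] unfolding sum5 S e0 s_def by (simp add: algebra_simps)
  have r11: "s1 * s1 + e 1 * (s0 * s0) + p * p * e 2 + q * q * s = l * s0"
    using rel[of 1 1] unfolding sum5 S e0 e1 s_def by (simp add: algebra_simps)
  have "(s0 * s0 + e 1 * (s1 * s1) + p * p * e 2 + q * q * s) - (s1 * s1 + e 1 * (s0 * s0) + p * p * e 2 + q * q * s) = 0"
    by (simp only: r00 r11 diff_self)
  then have "(s0 + s1) * (s0 - s1) * (1 - e 1) = 0" by (simp add: algebra_simps)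
  then have e1': "e 1 = 1" using pq_ne unfolding sum by simp
  have r01: "2 * (s0 * s1) + p * p * e 2 - q * q * s = l * s1"
    using rel[of 0 1] unfolding sum5 S e0 e1' s_def by (simp add: algebra_simps)
  have "(s0 * s0 + e 1 * (s1 * s1) + p * p * e 2 + q * q * s) + (2 * (s0 * s1) + p * p * e 2 - q * q * s) = l * s0 + l * s1"
    by (simp only: r00 r01)
  then have "(s0 + s1) * (s0 + s1) + 2 * (p * p * e 2) = l * (s0 + s1)"
    unfolding e1' by (simp add: algebra_simps)
  then have "p * (p * (1 + 2 * e 2)) = p * l" unfolding sum by (simp add: algebra_simps)
  then have lp: "l = p * (1 + 2 * e 2)" using pq_ne by simp
  have "(s0 * s0 + e 1 * (s1 * s1) + p * p * e 2 + q * q * s) - (2 * (s0 * s1) + p * p * e 2 - q * q * s) = l * s0 - l * s1"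
    by (simp only: r00 r01)
  then have "(s0 - s1) * (s0 - s1) + 2 * (q * q * s) = l * (s0 - s1)"
    unfolding e1' by (simp add: algebra_simps)
  then have "q * (q * (1 + 2 * s)) = q * (- l)" unfolding sum by (simp add: algebra_simps)
  then have "q * (1 + 2 * s) = - l" using pq_ne mult_left_cancel by blast
  then have lq: "l = - (q * (1 + 2 * s))" by simp
  have ll: "l * cnj l = 1" using l by (simp add: complex_norm_square[symmetric])
  have cw: "cnj w = w * w" using cnj_w w3(1) w
    by (metis mult.assoc mult.commute mult_1 power3_eq_cube)
  have "(e 2 - w * w) * (e 2 + w * w) = 0"
    by (simp add: algebra_simps e2 w w3(2))
  then have "e 2 = w * w \<or> e 2 = - (w * w)" by (auto simp: eq_neg_iff_add_eq_0)
  moreover have "e 2 \<noteq> - (w * w)"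
  proof
    assume "e 2 = - (w * w)"
    \<comment> \<open>|1 - 2 w^2|^2 is 7, so |l|^2 would be 7/3.\<close>
    then have "(p * (1 - 2 * (w * w))) * cnj (p * (1 - 2 * (w * w))) = 1" using ll lp by simp
    then have "p * (1 - 2 * (w * w)) * (p * (1 - 2 * ((w * w) * (w * w)))) = 1" by (simp add: cnj_p cw)
    then show False by (simp add: algebra_simps w w3(2) pp p2)
  qed
  ultimately have e2w: "e 2 = w * w" by blast
  have "l * l = - 1" unfolding lp e2w
    by (simp add: algebra_simps w w3(2) pp p2 add_divide_distrib diff_divide_distrib)
  moreover have "l * l = (q * q) * ((1 + 2 * s) * (1 + 2 * s))" unfolding lq by simp
  ultimately have "(1 + 2 * s) * (1 + 2 * s) = - 5" unfolding qq by (simp add: field_simps)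
  moreover have "s * s = ((1 + 2 * s) * (1 + 2 * s) - 1 - 4 * s) / 4" by (simp add: algebra_simps)
  ultimately have s5: "s * s = - 3 / 2 - s" by (simp add: diff_divide_distrib)
  obtain f1 f2 f3 f4 where f: "f1 = z" "f2 = z\<^sup>2" "f3 = z ^ 3" "f4 = z ^ 4" by blast
  note ze = z_rules[OF f]
  have "(e 3 - f3) * (e 3 + f3) = 0" "(e 4 - f2) * (e 4 + f2) = 0"
    using e3 e4 ze by (simp_all add: algebra_simps f(1,4))
  then have c: "e 3 = f3 \<or> e 3 = - f3" "e 4 = f2 \<or> e 4 = - f2" by (auto simp: eq_neg_iff_add_eq_0)
  have u: "f2 + f3 = (5 * q - 1) / 2" unfolding ze(2) by (simp add: field_simps)
  have d: "(f3 - f2) * (f3 - f2) = - (5 * q + 5) / 2"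
    by (simp add: algebra_simps ze(3-22), simp add: ze(1,2) field_simps)
  have "s \<noteq> f2 + f3"
  proof
    assume "s = f2 + f3"
    then have "s = (5 * q - 1) / 2" using u by simp
    from s5[unfolded this] show False
      by (simp add: algebra_simps qq q2 add_divide_distrib diff_divide_distrib)
  qed
  moreover have "s \<noteq> - (f2 + f3)"
  proof
    assume "s = - (f2 + f3)"
    then have s: "s = (1 - 5 * q) / 2" using u by (simp add: field_simps)
    have q: "q = 7 / 10"
      using s5[unfolded s] by (simp add: algebra_simps qq q2 add_divide_distrib diff_divide_distrib)
    show False using qq unfolding q by simp
  qed
  moreover have "s \<noteq> f3 - f2 \<and> s \<noteq> - (f3 - f2)"
  proof -
    \<comment> \<open>Both signs are treated at once through the square; s^2 = -3/2 - s then
      expresses s by q.\<close>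
    have False if s': "s * s = (f3 - f2) * (f3 - f2)"
    proof -
      have "s = - 3 / 2 - s * s" using s5 by simp
      also have "\<dots> = (5 * q + 2) / 2" unfolding s' d by (simp add: field_simps)
      finally have s: "s = (5 * q + 2) / 2" .
      have "9 / 4 + q * 15 / 2 = - (5 / 2)"
        using s5[unfolded s] by (simp add: algebra_simps qq q2 add_divide_distrib diff_divide_distrib)
      then have "q * 15 / 2 = - (5 / 2) - 9 / 4" by (metis add_diff_cancel_left')
      have "q = (q * 15 / 2) * (2 / 15)" by simp
      also have "\<dots> = - 19 / 30" unfolding \<open>q * 15 / 2 = - (5 / 2) - 9 / 4\<close> by simp
      finally have q: "q = - 19 / 30" .
      show False using qq unfolding q by simp
    qed
    then show ?thesis by (metis minus_mult_minus)
  qed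
  ultimately show False using c unfolding s_def by (auto simp: algebra_simps)
qed

text \<open>Again l is computed twice, as -p (1 + 2 e 4) and as r (1 + s/2). The first gives l^2 =
  -1 and so (1 + s/2)^2 = -2, whereas s/2 is i, 0 or -i.\<close>

lemma (in unitary_data_B) primitive: "primitive_theory 5 (S5_B p r) (T5_B w)"
  unfolding primitive_theory_def
proof
  assume "stack_of_two 5 (S5_B p r) (T5_B w)"
  then obtain e l where l: "cmod l = 1" and e0: "e 0 = 1"
    and e: "\<And>i. i < 5 \<Longrightarrow> (e i)\<^sup>2 = T5_B w $$ (i, i)"
    and rel: "\<And>a b. a < 5 \<Longrightarrow> b < 5 \<Longrightarrow> e a * e b * (\<Sum>m<5. S5_B p r $$ (a, m) * e m * S5_B p r $$ (m, b)) =
      l * S5_B p r $$ (a, b)"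
    by (rule stack_of_two_prime[rotated]) simp_all
  have e1: "e 1 * e 1 = 1" and e2: "e 2 * e 2 = -1" and e3: "e 3 * e 3 = -1" and e4: "e 4 * e 4 = w"
    using e[of 1] e[of 2] e[of 3] e[of 4] by (simp_all add: T5_B_def power2_eq_square)
  define s0 s1 where s0: "s0 = (r - p) / 2" and s1: "s1 = (r + p) / 2"
  have S: "S5_B p r $$ (0, 0) = s0" "S5_B p r $$ (0, 1) = s1" "S5_B p r $$ (1, 0) = s1" "S5_B p r $$ (1, 1) = s0"
    "S5_B p r $$ (0, 2) = r / 2" "S5_B p r $$ (0, 3) = r / 2" "S5_B p r $$ (0, 4) = p"
    "S5_B p r $$ (1, 2) = r / 2" "S5_B p r $$ (1, 3) = r / 2" "S5_B p r $$ (1, 4) = - p"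
    "S5_B p r $$ (2, 0) = r / 2" "S5_B p r $$ (3, 0) = r / 2" "S5_B p r $$ (4, 0) = p"
    "S5_B p r $$ (2, 1) = r / 2" "S5_B p r $$ (3, 1) = r / 2" "S5_B p r $$ (4, 1) = - p"
    by (simp_all add: S5_B_def s0 s1)
  have sum: "s0 + s1 = r" "s0 - s1 = - p" unfolding s0 s1 by (simp_all add: field_simps)
  define s where "s = e 2 + e 3"
  have r00: "s0 * s0 + e 1 * (s1 * s1) + p * p * e 4 + r * r * s / 4 = l * s0"
    using rel[of 0 0] unfolding sum5 S e0 s_def by (simp add: algebra_simps add_divide_distrib)
  have r11: "s1 * s1 + e 1 * (s0 * s0) + p * p * e 4 + r * r * s / 4 = l * s0"
    using rel[of 1 1] unfolding sum5 S e0 e1 s_def by (simp add: algebra_simps add_divide_distrib)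
  have "(s0 * s0 + e 1 * (s1 * s1) + p * p * e 4 + r * r * s / 4) - (s1 * s1 + e 1 * (s0 * s0) + p * p * e 4 + r * r * s / 4) = 0"
    by (simp only: r00 r11 diff_self)
  then have "(s0 + s1) * (s0 - s1) * (1 - e 1) = 0" by (simp add: algebra_simps)
  then have e1': "e 1 = 1" using pr_ne unfolding sum by simp
  have r01: "2 * (s0 * s1) - p * p * e 4 + r * r * s / 4 = l * s1"
    using rel[of 0 1] unfolding sum5 S e0 e1' s_def by (simp add: algebra_simps add_divide_distrib)
  have "(s0 * s0 + e 1 * (s1 * s1) + p * p * e 4 + r * r * s / 4) - (2 * (s0 * s1) - p * p * e 4 + r * r * s / 4) = l * s0 - l * s1"
    by (simp only: r00 r01)
  then have "(s0 - s1) * (s0 - s1) + 2 * (p * p * e 4) = l * (s0 - s1)"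
    unfolding e1' by (simp add: algebra_simps)
  then have "p * (p * (1 + 2 * e 4)) = p * (- l)" unfolding sum by (simp add: algebra_simps)
  then have "p * (1 + 2 * e 4) = - l" using pr_ne mult_left_cancel by blast
  then have lp: "l = - (p * (1 + 2 * e 4))" by simp
  have "(s0 * s0 + e 1 * (s1 * s1) + p * p * e 4 + r * r * s / 4) + (2 * (s0 * s1) - p * p * e 4 + r * r * s / 4) = l * s0 + l * s1"
    by (simp only: r00 r01)
  then have "(s0 + s1) * (s0 + s1) + r * r * s / 2 = l * (s0 + s1)"
    unfolding e1' by (simp add: algebra_simps)
  then have "r * (r * (1 + s / 2)) = r * l" unfolding sum by (simp add: algebra_simps)
  then have lr: "l = r * (1 + s / 2)" using pr_ne by simp
  have ll: "l * cnj l = 1" using l by (simp add: complex_norm_square[symmetric])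
  have cw: "cnj w = w * w" using cnj_w w3(1) w
    by (metis mult.assoc mult.commute mult_1 power3_eq_cube)
  have "(e 4 - w * w) * (e 4 + w * w) = 0"
    by (simp add: algebra_simps e4 w w3(2))
  then have "e 4 = w * w \<or> e 4 = - (w * w)" by (auto simp: eq_neg_iff_add_eq_0)
  moreover have "e 4 \<noteq> - (w * w)"
  proof
    assume "e 4 = - (w * w)"
    then have "(p * (1 - 2 * (w * w))) * cnj (p * (1 - 2 * (w * w))) = 1" using ll lp by simp
    then have "p * (1 - 2 * (w * w)) * (p * (1 - 2 * ((w * w) * (w * w)))) = 1" by (simp add: cnj_p cw)
    then show False by (simp add: algebra_simps w w3(2) pp p2)
  qed
  ultimately have e4w: "e 4 = w * w" by blast
  have "l * l = - 1" unfolding lp e4w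
    by (simp add: algebra_simps w w3(2) pp p2 add_divide_distrib diff_divide_distrib)
  moreover have "l * l = (r * r) * ((1 + s / 2) * (1 + s / 2))" unfolding lr by simp
  ultimately have sq: "(1 + s / 2) * (1 + s / 2) = - 2" unfolding rr by (simp add: field_simps)
  have "(e 2 - \<i>) * (e 2 + \<i>) = 0" "(e 3 - \<i>) * (e 3 + \<i>) = 0"
    using e2 e3 by (simp_all add: algebra_simps)
  then have "e 2 = \<i> \<or> e 2 = - \<i>" "e 3 = \<i> \<or> e 3 = - \<i>" by (auto simp: eq_neg_iff_add_eq_0)
  then have "s / 2 = \<i> \<or> s / 2 = 0 \<or> s / 2 = - \<i>" by (auto simp: s_def)
  then show False using sq by (auto simp: complex_eq_iff)
qed

subsection \<open>Evaluation at roots of unity\<close>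

lemma primitive_cube_root:
  assumes "w = cis (2 * pi / 3) \<or> w = cis (- (2 * pi / 3))"
  shows "w * w = - 1 - w" "w * cnj w = 1"
proof -
  obtain y where w: "w = Complex (- 1 / 2) y" and y: "y = sqrt 3 / 2 \<or> y = - (sqrt 3 / 2)"
    using assms that[of "Im w"] by (auto simp: complex_eq_iff cos_120 sin_120)
  have "y * y = 3 / 4" using y by (elim disjE) (simp_all only:, simp_all)
  then show "w * w = - 1 - w" unfolding w by (simp add: complex_eq_iff)
  show "w * cnj w = 1" using assms by (auto simp: cis_cnj cis_mult)
qed

lemma primitive_fifth_root:
  assumes "z ^ 5 = 1" "z \<noteq> (1::complex)"
  shows "z ^ 4 = - 1 - z - z\<^sup>2 - z ^ 3"
proof -
  have "(z - 1) * (z ^ 4 + z ^ 3 + z\<^sup>2 + z + 1) = z ^ 5 - 1"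
    by (simp add: algebra_simps eval_nat_numeral)
  then have "z ^ 4 + z ^ 3 + z\<^sup>2 + z + 1 = 0" using assms by simp
  then show ?thesis by (simp add: algebra_simps eq_neg_iff_add_eq_0)
qed

(* The sign of q = - (1 + 2 (z + 1/z)) / 5 distinguishes the two Galois orbits of primitive
   fifth roots of unity. *)
lemma fifth_root_trace:
  assumes z: "z = cis t" and z5: "z ^ 5 = 1" and z1: "z \<noteq> 1"
  shows "- (1 + 2 * (z + z ^ 4)) / 5 = of_real (- (1 + 4 * cos t) / 5)" "((1 + 4 * cos t) / 5)\<^sup>2 = 1 / 5"
    "z * cnj z = 1" "z ^ 4 = cis (- t)"
proof -
  show c: "z * cnj z = 1" by (simp add: z cis_cnj cis_mult)
  have "z * z ^ 4 = 1" using z5 by (simp flip: power_Suc)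
  then show z4: "z ^ 4 = cis (- t)"
    using c by (metis mult_cancel_left mult_zero_left zero_neq_one cis_cnj z)
  show e: "- (1 + 2 * (z + z ^ 4)) / 5 = of_real (- (1 + 4 * cos t) / 5)"
    unfolding z4 unfolding z by (simp add: complex_eq_iff)
  \<comment> \<open>Instantiated for the sake of \<open>q_sq\<close>, with simple admissible values
    for j, w and p.\<close>
  interpret data_A \<i> "cis (2 * pi / 3)" z "\<i> * (1 + 2 * cis (2 * pi / 3)) / 3" "- (1 + 2 * (z + z ^ 4)) / 5"
    by unfold_locales (simp_all add: primitive_cube_root primitive_fifth_root[OF z5 z1])
  have "of_real ((- (1 + 4 * cos t) / 5) * (- (1 + 4 * cos t) / 5)) = (of_real (1 / 5) :: complex)"
    using q_sq unfolding e by simp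
  then have "(- (1 + 4 * cos t) / 5) * (- (1 + 4 * cos t) / 5) = 1 / 5"
    using of_real_eq_iff by blast
  then show "((1 + 4 * cos t) / 5)\<^sup>2 = 1 / 5" by (metis minus_divide_left power2_eq_square power2_minus)
qed

abbreviation cube_root :: complex where "cube_root \<equiv> cis (2 * pi / 3)"

lemma unitary_data_A_root:
  assumes z: "z = cis t" "z ^ 5 = 1" "z \<noteq> 1"
  shows "unitary_data_A (- \<i>) cube_root z (of_real (1 / sqrt 3)) (of_real (- (1 + 4 * cos t) / 5))"
proof
  have w: "cube_root = Complex (- 1 / 2) (sqrt 3 / 2)" by (simp add: complex_eq_iff cos_120 sin_120)
  show "of_real (1 / sqrt 3) = - \<i> * (1 + 2 * cube_root) / 3"
    unfolding w by (simp add: complex_eq_iff field_simps)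
  show "of_real (- (1 + 4 * cos t) / 5) = - (1 + 2 * (z + z ^ 4)) / 5"
    by (rule fifth_root_trace(1)[OF z, symmetric])
qed (use fifth_root_trace[OF z] primitive_cube_root primitive_fifth_root[OF z(2,3)] in simp_all)

lemma unitary_data_B_root:
  assumes "s \<in> {1, -1}"
  shows "unitary_data_B (cis (s * (2 * pi / 3))) (of_real (s / sqrt 3)) (of_real (1 / sqrt 2))"
proof
  have w: "cis (s * (2 * pi / 3)) = Complex (- 1 / 2) (s * (sqrt 3 / 2))"
    using assms by (auto simp: complex_eq_iff cos_120 sin_120)
  show "of_real (s / sqrt 3) = - (\<i> * (1 + 2 * cis (s * (2 * pi / 3))) / 3)"
    unfolding w using assms by (auto simp: complex_eq_iff field_simps)
  show "of_real (1 / sqrt 2) * of_real (1 / sqrt 2) = (1 / 2 :: complex)"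
    by (simp flip: of_real_mult)
qed (use assms primitive_cube_root in auto)

lemma fifth_roots:
  "cis (4 * pi / 5) ^ 5 = 1" "cis (4 * pi / 5) \<noteq> 1" "cis (2 * pi / 5) ^ 5 = 1" "cis (2 * pi / 5) \<noteq> 1"
proof -
  have "sin (4 * pi / 5) > 0" "sin (2 * pi / 5) > 0" by (rule sin_gt_zero; simp)+
  then show "cis (4 * pi / 5) \<noteq> 1" "cis (2 * pi / 5) \<noteq> 1" by (auto simp: complex_eq_iff)
  have "cis (4 * pi / 5) ^ 5 = cis (2 * pi * 2)" "cis (2 * pi / 5) ^ 5 = cis (2 * pi * 1)"
    by (simp_all add: DeMoivre del: cis_multiple_2pi)
  then show "cis (4 * pi / 5) ^ 5 = 1" "cis (2 * pi / 5) ^ 5 = 1"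
    by (simp_all only: cis_multiple_2pi Ints_numeral Ints_1)
qed

text \<open>The squares are known to be 1/5; cos (4 pi / 5) < -1/2 and cos (2 pi / 5) > 0 decide the
  signs.\<close>

lemma cos_fifths:
  "- (1 + 4 * cos (4 * pi / 5)) / 5 = 1 / sqrt 5" "- (1 + 4 * cos (2 * pi / 5)) / 5 = - (1 / sqrt 5)"
proof -
  have sq: "x = 1 / sqrt 5" if "x\<^sup>2 = 1 / 5" "x > 0" for x :: real
    using that real_sqrt_unique[of x "1 / 5"] by (simp add: real_sqrt_divide)
  have "cos (pi / 3) < cos (pi - 4 * pi / 5)" by (rule cos_monotone_0_pi) simp_all
  then have "cos (4 * pi / 5) < - 1 / 2" unfolding cos_pi_minus cos_60 by simp
  then have "- ((1 + 4 * cos (4 * pi / 5)) / 5) = 1 / sqrt 5"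
    by (intro sq) (simp_all only: power2_minus fifth_root_trace(2)[OF refl fifth_roots(1,2)], simp)
  then show "- (1 + 4 * cos (4 * pi / 5)) / 5 = 1 / sqrt 5" by (simp only: minus_divide_left)
  have "cos (2 * pi / 5) > 0" by (rule cos_gt_zero_pi; use pi_gt_zero in linarith)
  then have "(1 + 4 * cos (2 * pi / 5)) / 5 = 1 / sqrt 5"
    using fifth_root_trace(2)[OF refl fifth_roots(3,4)] by (intro sq) simp_all
  then show "- (1 + 4 * cos (2 * pi / 5)) / 5 = - (1 / sqrt 5)" by (simp only: flip: minus_divide_left)
qed

lemma positive_real_of_real: "positive_real (of_real x) \<longleftrightarrow> x > 0"
  by (auto simp: positive_real_def)

lemma S5_A_real: "S5_A (of_real x) (of_real y) $$ (0, k) = of_real ([(x - y) / 2, (x + y) / 2, x, y, y] ! k)" if "k < 5"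
  using less5_cases[OF that] by (elim disjE) (simp_all add: S5_A_def)

lemma S5_B_real: "S5_B (of_real x) (of_real y) $$ (0, k) = of_real ([(y - x) / 2, (y + x) / 2, y / 2, y / 2, x] ! k)" if "k < 5"
  using less5_cases[OF that] by (elim disjE) (simp_all add: S5_B_def)

section \<open>Identification with the given radical expressions\<close>

lemma sqrt_simps:
  "sqrt 15 = sqrt 3 * sqrt 5" "sqrt 6 = sqrt 2 * sqrt 3" "sqrt 24 = 2 * (sqrt 2 * sqrt 3)"
proof -
  have "sqrt 24 = sqrt (4 * 6)" by simp
  also have "\<dots> = 2 * sqrt 6" unfolding real_sqrt_mult by simp
  finally have "sqrt 24 = 2 * sqrt 6" .
  moreover show "sqrt 15 = sqrt 3 * sqrt 5" "sqrt 6 = sqrt 2 * sqrt 3" by (simp_all flip: real_sqrt_mult)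
  ultimately show "sqrt 24 = 2 * (sqrt 2 * sqrt 3)" by simp
qed

lemma S_A_eq: "S_A = S5_A (of_real (1 / sqrt 3)) (of_real (1 / sqrt 5))"
proof -
  define a b where a: "a = sqrt 3" and b: "b = sqrt 5"
  have ab: "a * a = 3" "b * b = 5" "a > 0" "b > 0" by (simp_all add: a b)
  have ext: "a * (a * x) = 3 * x" "b * (b * x) = 5 * x" for x
    using ab by (simp_all flip: mult.assoc)
  \<comment> \<open>The nested radical denests because 30 (4 + sqrt 15) = 15 (sqrt 3 + sqrt
    5)^2.\<close>
  have "30 * chi 4 15 = (a * b * (a + b))\<^sup>2"
    by (simp add: chi_def sqrt_simps flip: a b) (simp add: power2_eq_square algebra_simps ab ext)
  then have k: "sqrt (30 * chi 4 15) = a * b * (a + b)" using ab by simp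
  have ne: "a \<noteq> 0" "b \<noteq> 0" "a + b \<noteq> 0" "5 + b \<noteq> 0" using ab by auto
  have inv: "1 / a = a / 3" "1 / b = b / 5" "1 / (a * b * (a + b)) = (b - a) / (2 * a * b)"
    using ne ab by (simp_all add: field_simps ext)
  have inv': "2 * (a * b * (a + b)) / (5 + b) = (a + b) * a * (b - 1) / 2"
    using ne ab by (simp add: field_simps ext)
  have c: "chi 4 15 = 4 + a * b" "chi 5 15 = 5 + a * b" "chi 3 15 = 3 + a * b" "chi 1 5 = 1 + b" "chi 5 5 = 5 + b"
    by (simp_all add: chi_def sqrt_simps a b)
  show ?thesis
    unfolding S_A_def k unfolding c inv' a[symmetric] b[symmetric]
    by (rule eq_matI) (auto dest!: less5_cases simp: S5_A_def mat_of_rows_list_def complex_eq_iff inv,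
      (simp_all add: field_simps ab ext ne)?)
qed

lemma T2_A_eq: "T2_A = T5_A cube_root (cis (4 * pi / 5))"
proof -
  have "cis (4 * pi / 5) ^ 4 = cis (- (4 * pi / 5))"
    by (rule fifth_root_trace(4)[OF refl fifth_roots(1,2)])
  moreover have "exp (2 * of_real pi * \<i> / 3) = cube_root" "exp (4 * of_real pi * \<i> / 5) = cis (4 * pi / 5)"
    "exp (- (4 * of_real pi * \<i> / 5)) = cis (- (4 * pi / 5))"
    by (simp_all add: cis_conv_exp algebra_simps)
  ultimately show ?thesis by (simp add: T2_A_def T5_A_def)
qed

lemma S_B_eq: "S_B = S5_B (of_real (1 / sqrt 3)) (of_real (1 / sqrt 2))"
proof -
  define a b where a: "a = sqrt 3" and b: "b = sqrt 2"
  have ab: "a * a = 3" "b * b = 2" "a > 0" "b > 0" by (simp_all add: a b)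
  have ext: "a * (a * x) = 3 * x" "b * (b * x) = 2 * x" for x
    using ab by (simp_all flip: mult.assoc)
  \<comment> \<open>Likewise 6 (5 + sqrt 24) = 6 (sqrt 2 + sqrt 3)^2.\<close>
  have "6 * chi 5 24 = (a * b * (a + b))\<^sup>2"
    by (simp add: chi_def sqrt_simps flip: a b) (simp add: power2_eq_square algebra_simps ab ext)
  then have k: "sqrt (6 * chi 5 24) = a * b * (a + b)" using ab by simp
  have ne: "a \<noteq> 0" "b \<noteq> 0" "a + b \<noteq> 0" using ab by auto
  have inv: "1 / a = a / 3" "1 / b = b / 2" "1 / (2 * (a * b * (a + b))) = a * b * (a - b) / 12"
    using ne ab by (simp_all add: field_simps ext)
  have c: "chi 5 24 = 5 + 2 * (b * a)" "chi 3 6 = 3 + b * a" "chi 4 24 = 4 + 2 * (b * a)"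
    by (simp_all add: chi_def sqrt_simps a b)
  show ?thesis
    unfolding S_B_def Let_def k unfolding c inv a[symmetric] b[symmetric]
    by (rule eq_matI) (auto dest!: less5_cases simp: S5_B_def mat_of_rows_list_def complex_eq_iff,
      (simp_all add: field_simps ab ext ne)?)
qed

lemma T2_B_eq: "T2_B = T5_B cube_root"
proof -
  have "exp (2 * of_real pi * \<i> / 3) = cube_root" by (simp add: cis_conv_exp algebra_simps)
  then show ?thesis by (simp add: T2_B_def T5_B_def)
qed

section \<open>Numerical values, the unitary data and their Galois conjugates\<close>

lemma sqrt_bounds: "3.8729833 \<le> sqrt 15" "sqrt 15 \<le> 3.8729834" "2.4494897 \<le> sqrt 6" "sqrt 6 \<le> 2.4494898"
  by (rule real_le_rsqrt real_le_lsqrt; simp add: power2_eq_square)+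

lemma unitary_theory_real:
  assumes "\<And>k. k < n \<Longrightarrow> S $$ (0, k) = of_real (f k)" and "n > 0" "f 0 > 0"
  shows "unitary_theory n S \<longleftrightarrow> (\<forall>k<n. f k > 0)"
  using assms by (simp add: unitary_theory_def qdim_def positive_real_of_real zero_less_divide_iff flip: of_real_divide)

lemma unitary_theory_S5_A:
  assumes "x > y"
  shows "unitary_theory 5 (S5_A (of_real x) (of_real y)) \<longleftrightarrow> (\<forall>k<5. [(x - y) / 2, (x + y) / 2, x, y, y] ! k > 0)"
  using assms by (intro unitary_theory_real[OF S5_A_real]) simp_all

lemma unitary_theory_S5_B:
  assumes "y > x"
  shows "unitary_theory 5 (S5_B (of_real x) (of_real y)) \<longleftrightarrow> (\<forall>k<5. [(y - x) / 2, (y + x) / 2, y / 2, y / 2, x] ! k > 0)"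
  using assms by (intro unitary_theory_real[OF S5_B_real]) simp_all

lemma sqrt_inverses:
  "1 / sqrt 3 * (1 / sqrt 5) = sqrt 15 / 15" "1 / sqrt 3 * (1 / sqrt 2) = sqrt 6 / 6"
  by (simp_all add: field_simps sqrt_simps) 

lemma sqrt_order: "1 / sqrt 5 < 1 / sqrt 3" "1 / sqrt 3 < 1 / sqrt 2"
  by (simp_all add: field_simps)

lemma theory_A:
  "valid_fermionic_data 5 S_A T2_A 0 \<and> unitary_theory 5 S_A \<and>
     Max {Re (verlinde 5 S_A i j k) | i j k. i < 5 \<and> j < 5 \<and> k < 5} = 3 \<and>
     cmod (Dsq 5 S_A - 472.379) \<le> 0.0005 \<and>
     (\<forall>c. central_charge 5 S_A T2_A c \<longleftrightarrow> (\<exists>m::int. c = of_int m / 2)) \<and>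
     \<not> abelian_theory 5 S_A \<and> primitive_theory 5 S_A T2_A \<and>
     has_full_fusion_rules 5 S_A T2_A"
proof -
  define x y where x: "x = 1 / sqrt 3" and y: "y = 1 / sqrt 5"
  have xy: "x > y" "y > 0" "x * y = sqrt 15 / 15" by (simp_all only: x y sqrt_order sqrt_inverses, simp)
  interpret unitary_data_A "- \<i>" cube_root "cis (4 * pi / 5)" "of_real x" "of_real y"
    using unitary_data_A_root[OF refl fifth_roots(1,2)] unfolding cos_fifths x y .
  have S: "S_A = S5_A (of_real x) (of_real y)" unfolding S_A_eq x y ..
  have pos: "positive_real (of_real x - of_real y)"
    unfolding of_real_diff[symmetric] positive_real_of_real using xy by simp
  have "Dsq 5 S_A - 472.379 = of_real (60 * sqrt 15 - 232.379)"
    unfolding S Dsq_S5_A of_real_mult[symmetric] xy(3) by simp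
  then have D: "cmod (Dsq 5 S_A - 472.379) \<le> 0.0005"
    using sqrt_bounds by (simp only: norm_of_real) (simp add: abs_if)
  have "unitary_theory 5 S_A"
    unfolding S using xy by (subst unitary_theory_S5_A) (auto dest!: less5_cases)
  then show ?thesis
    using D valid[OF pos] Max_verlinde_S5_A central_charge_iff[OF congruence] not_abelian_S5_A primitive
      full_fusion[OF pos] unfolding S T2_A_eq by blast
qed

text \<open>The fifth root exp(2 pi i/5), from the other Galois orbit, turns q into -1/sqrt 5. The
  fusion table is unchanged and the vacuum entry (p - q)/2 stays positive, but the labels 3 and 4
  acquire negative dimension.\<close>

lemma conjugate_theory_A:
  "\<exists>S T2. valid_fermionic_data 5 S T2 0 \<and> \<not> unitary_theory 5 S \<and>
        (\<forall>i<5. \<forall>j<5. \<forall>k<5. verlinde 5 S i j k = verlinde 5 S_A i j k) \<and>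
        cmod (Dsq 5 S - 7.621) \<le> 0.0005"
proof -
  define x y where x: "x = 1 / sqrt 3" and y: "y = 1 / sqrt 5"
  have xy: "x > y" "y > 0" "x * y = sqrt 15 / 15" by (simp_all only: x y sqrt_order sqrt_inverses, simp)
  interpret U: unitary_data_A "- \<i>" cube_root "cis (4 * pi / 5)" "of_real x" "of_real y"
    using unitary_data_A_root[OF refl fifth_roots(1,2)] unfolding cos_fifths x y .
  interpret unitary_data_A "- \<i>" cube_root "cis (2 * pi / 5)" "of_real x" "of_real (- y)"
    using unitary_data_A_root[OF refl fifth_roots(3,4)] unfolding cos_fifths x y .
  let ?S = "S5_A (of_real x) (of_real (- y))"
  have pos: "positive_real (of_real x - of_real (- y))"
    unfolding of_real_diff[symmetric] positive_real_of_real using xy by simp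
  have "Dsq 5 ?S - 7.621 = of_real (232.379 - 60 * sqrt 15)"
    unfolding Dsq_S5_A of_real_mult[symmetric] mult_minus_right xy(3) by simp
  then have D: "cmod (Dsq 5 ?S - 7.621) \<le> 0.0005"
    using sqrt_bounds by (simp only: norm_of_real) (simp add: abs_if)
  have "\<not> unitary_theory 5 ?S"
    using xy by (subst unitary_theory_S5_A) (auto intro!: exI[of _ 3])
  moreover have "verlinde 5 ?S i j k = verlinde 5 S_A i j k" if "i < 5" "j < 5" "k < 5" for i j k
    unfolding S_A_eq x[symmetric] y[symmetric] verlinde_S5_A[OF that] U.verlinde_S5_A[OF that] ..
  ultimately show ?thesis using D valid[OF pos] by blast
qed

lemma theory_B:
  "valid_fermionic_data 5 S_B T2_B 0 \<and> unitary_theory 5 S_B \<and>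
     Max {Re (verlinde 5 S_B i j k) | i j k. i < 5 \<and> j < 5 \<and> k < 5} = 4 \<and>
     cmod (Dsq 5 S_B - 475.151) \<le> 0.0005 \<and>
     (\<forall>c. central_charge 5 S_B T2_B c \<longleftrightarrow> (\<exists>m::int. c = of_int m / 2)) \<and>
     \<not> abelian_theory 5 S_B \<and> primitive_theory 5 S_B T2_B \<and>
     has_full_fusion_rules 5 S_B T2_B"
proof -
  define x y where x: "x = 1 / sqrt 3" and y: "y = 1 / sqrt 2"
  have xy: "x < y" "x > 0" "x * y = sqrt 6 / 6" by (simp_all only: x y sqrt_order sqrt_inverses, simp)
  interpret unitary_data_B cube_root "of_real x" "of_real y"
    using unitary_data_B_root[of 1] unfolding x y by simp
  have S: "S_B = S5_B (of_real x) (of_real y)" unfolding S_B_eq x y ..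
  have pos: "positive_real (of_real y - of_real x)"
    unfolding of_real_diff[symmetric] positive_real_of_real using xy by simp
  have "Dsq 5 S_B - 475.151 = of_real (96 * sqrt 6 - 235.151)"
    unfolding S Dsq_S5_B of_real_mult[symmetric] xy(3) by simp
  then have D: "cmod (Dsq 5 S_B - 475.151) \<le> 0.0005"
    using sqrt_bounds by (simp only: norm_of_real) (simp add: abs_if)
  have "unitary_theory 5 S_B"
    unfolding S using xy by (subst unitary_theory_S5_B) (auto dest!: less5_cases)
  then show ?thesis
    using D valid[OF pos] Max_verlinde_S5_B central_charge_iff[OF congruence] not_abelian_S5_B primitive
      full_fusion[OF pos] unfolding S T2_B_eq by blast
qed

text \<open>Replacing w by its conjugate while keeping i and r turns p into -p. The vacuum entry
  becomes half of 1/sqrt 2 + 1/sqrt 3, still positive, and label 4 acquires negative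
  dimension.\<close>

lemma conjugate_theory_B:
  "\<exists>S T2. valid_fermionic_data 5 S T2 0 \<and> \<not> unitary_theory 5 S \<and>
        (\<forall>i<5. \<forall>j<5. \<forall>k<5. verlinde 5 S i j k = verlinde 5 S_B i j k) \<and>
        cmod (Dsq 5 S - 4.849) \<le> 0.0005"
proof -
  define x y where x: "x = 1 / sqrt 3" and y: "y = 1 / sqrt 2"
  have xy: "x < y" "x > 0" "x * y = sqrt 6 / 6" by (simp_all only: x y sqrt_order sqrt_inverses, simp)
  interpret U: unitary_data_B cube_root "of_real x" "of_real y"
    using unitary_data_B_root[of 1] unfolding x y by simp
  interpret unitary_data_B "cis (- 1 * (2 * pi / 3))" "of_real (- x)" "of_real y"
    using unitary_data_B_root[of "- 1"] unfolding x y by simp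
  let ?S = "S5_B (of_real (- x)) (of_real y)"
  have pos: "positive_real (of_real y - of_real (- x))"
    unfolding of_real_diff[symmetric] positive_real_of_real using xy by simp
  have "Dsq 5 ?S - 4.849 = of_real (235.151 - 96 * sqrt 6)"
    unfolding Dsq_S5_B of_real_mult[symmetric] mult_minus_left xy(3) by simp
  then have D: "cmod (Dsq 5 ?S - 4.849) \<le> 0.0005"
    using sqrt_bounds by (simp only: norm_of_real) (simp add: abs_if)
  have "\<not> unitary_theory 5 ?S"
    using xy by (subst unitary_theory_S5_B) (auto intro!: exI[of _ 4])
  moreover have "verlinde 5 ?S i j k = verlinde 5 S_B i j k" if "i < 5" "j < 5" "k < 5" for i j k
    unfolding S_B_eq x[symmetric] y[symmetric] verlinde_S5_B[OF that] U.verlinde_S5_B[OF that] ..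
  ultimately show ?thesis using D valid[OF pos] by blast
qed

theorem mainTheorem5:
  shows "
     valid_fermionic_data 5 S_A T2_A 0 \<and> unitary_theory 5 S_A \<and>
     Max {Re (verlinde 5 S_A i j k) | i j k. i < 5 \<and> j < 5 \<and> k < 5} = 3 \<and>
     cmod (Dsq 5 S_A - 472.379) \<le> 0.0005 \<and>
     (\<forall>c. central_charge 5 S_A T2_A c \<longleftrightarrow> (\<exists>m::int. c = of_int m / 2)) \<and>
     \<not> abelian_theory 5 S_A \<and> primitive_theory 5 S_A T2_A \<and>
     has_full_fusion_rules 5 S_A T2_A \<and>
     (\<exists>S T2. valid_fermionic_data 5 S T2 0 \<and> \<not> unitary_theory 5 S \<and>
        (\<forall>i<5. \<forall>j<5. \<forall>k<5. verlinde 5 S i j k = verlinde 5 S_A i j k) \<and>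
        cmod (Dsq 5 S - 7.621) \<le> 0.0005)
   \<and>
     valid_fermionic_data 5 S_B T2_B 0 \<and> unitary_theory 5 S_B \<and>
     Max {Re (verlinde 5 S_B i j k) | i j k. i < 5 \<and> j < 5 \<and> k < 5} = 4 \<and>
     cmod (Dsq 5 S_B - 475.151) \<le> 0.0005 \<and>
     (\<forall>c. central_charge 5 S_B T2_B c \<longleftrightarrow> (\<exists>m::int. c = of_int m / 2)) \<and>
     \<not> abelian_theory 5 S_B \<and> primitive_theory 5 S_B T2_B \<and>
     has_full_fusion_rules 5 S_B T2_B \<and>
     (\<exists>S T2. valid_fermionic_data 5 S T2 0 \<and> \<not> unitary_theory 5 S \<and>
        (\<forall>i<5. \<forall>j<5. \<forall>k<5. verlinde 5 S i j k = verlinde 5 S_B i j k) \<and>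
        cmod (Dsq 5 S - 4.849) \<le> 0.0005)"
  using theory_A conjugate_theory_A theory_B conjugate_theory_B by (intro conjI) simp_all

end
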